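(* Let $k$ be a field, let $V$ be a $k$-vector space of finite dimension $n\ge 2$, and let $\Lambda=\wedge(V^* )$ be the exterior algebra on the dual space $V^*$. Let $$0\to k\xrightarrow{\partial_1^*=0}\overline{\Lambda}^*\xrightarrow{\partial_2^*}\overline{\Lambda}^*\otimes\overline{\Lambda}^*\xrightarrow{\partial_3^*}\cdots$$ be the complex obtained by applying $\mathrm{Hom}_\Lambda(-,k)$ to the normalized bar resolution of $k$ over $\Lambda$. Then for every $t\ge 1$, under the identification of the total degree $t$ part of $(\overline{\Lambda}^* )^{\otimes p}$ with $T_t^p$, the restriction of $\partial^*$ to total degree $t$ is the negative of $\delta$; that is, $\partial_{p+1}^*=-\delta$ as maps $T_t^p\to T_t^{p+1}$ for $1\le p\le t-1$. The bar resolution, the identification, the spaces $T_t^p$ and the map $\delta$ are as defined in the context.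
   Context: All tensor products are over $k$. Normalized bar resolution. Let $\varepsilon:\Lambda\to k$ be the augmentation of $\Lambda=\wedge(V^* )$ (killing $\wedge^i(V^* )$ for $i\ge1$), and let $\overline{\Lambda}=\Lambda/k$ be the quotient vector space, with $\overline{\lambda}$ the class of $\lambda\in\Lambda$; thus $\overline{\Lambda}$ can be viewed as $\bigoplus_{1\le i\le n}\wedge^i(V^* )$. The normalized bar resolution of $k$ as a left $\Lambda$-module is $$\cdots\to\Lambda\otimes\overline{\Lambda}\otimes\overline{\Lambda}\xrightarrow{\partial_2}\Lambda\otimes\overline{\Lambda}\xrightarrow{\partial_1}\Lambda\xrightarrow{\varepsilon}k\to0,$$ with $\Lambda$ acting by multiplication on the leftmost factor and, for $p\ge1$, $$\partial_p(\lambda\otimes\overline{\lambda}_1\otimes\cdots\otimes\overline{\lambda}_p)=\lambda\lambda_1\otimes\overline{\lambda}_2\otimes\cdots\otimes\overline{\lambda}_p+\sum_{j=1}^{p-1}(-1)^j\lambda\otimes\overline{\lambda}_1\otimes\cdots\otimes\overline{\lambda_j\lambda_{j+1}}\otimes\cdots\otimes\overline{\lambda}_p+(-1)^p\varepsilon(\lambda_p)\,\lambda\otimes\overline{\lambda}_1\otimes\cdots\otimes\overline{\lambda}_{p-1}$$ (this is well defined). Dual complex and identification. For a $k$-vector space $M$, $\mathrm{Hom}_\Lambda(\Lambda\otimes M,k)$ is naturally identified with $M^*$ by restricting to $1\otimes M$ (here $k$ is a $\Lambda$-module via $\varepsilon$). The map $\partial_p^*$ is precomposition with $\partial_p$, and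 $(\overline{\Lambda}^{\otimes p})^*$ is identified with $(\overline{\Lambda}^* )^{\otimes p}$ by $\langle\phi_1\otimes\cdots\otimes\phi_p,\overline{\lambda}_1\otimes\cdots\otimes\overline{\lambda}_p\rangle=\prod_j\langle\phi_j,\overline{\lambda}_j\rangle$. Further, $\overline{\Lambda}^*$ is identified with $\bigoplus_{i\ge1}\wedge^iV$: the element $\alpha=v_1\wedge\cdots\wedge v_i\in\wedge^iV$ annihilates $\wedge^{i'}(V^* )$ for $i'\ne i$ and $$\langle\alpha,v_1^*\wedge\cdots\wedge v_i^*\rangle=\det\bigl(\langle v_j,v_l^*\rangle\bigr)_{1\le j,l\le i}\qquad(v_1^*,\dots,v_i^*\in V^* ).$$ The complex is graded by total degree, where $\wedge^{i_1}V\otimes\cdots\otimes\wedge^{i_p}V$ has total degree $i_1+\cdots+i_p$, and $\partial^*$ preserves it. The total degree $t$ part of $(\overline{\Lambda}^* )^{\otimes p}$ is then $$T_t^p=\bigoplus_{\substack{1\le i_1,\dots,i_p\le n\\ i_1+\cdots+i_p=t}}\bigl(\wedge^{i_1}V\otimes\cdots\otimes\wedge^{i_p}V\bigr),$$ which for $t\ge 1$ is zero unless $1\le p\le t$. The map $\delta$. For $v_1,\dots,v_i\in V$ and nonempty $A=\{a_1<\dots<a_j\}\subset\{1,\dots,i\}$, write $v_A=v_{a_1}\wedge\cdots\wedge v_{a_j}$. For disjoint nonempty $A,B\subset\{1,\dots,i\}$ let $s(A,B)\in\{\pm1\}$ be the sign such that $v_{A\cup B}=s(A,B)\,v_A\wedge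 v_B$ for all $v_1,\dots,v_i$ (it is $(-1)^m$ with $m$ the number of pairs $(a,b)\in A\times B$ with $a>b$). On $\wedge^iV=T_i^1$ define $$\delta(v_1\wedge\cdots\wedge v_i)=\sum_{\substack{A,B\neq\emptyset,\ A\cap B=\emptyset\\ A\cup B=\{1,\dots,i\}}}s(A,B)\,v_A\otimes v_B\in T_i^2$$ (well defined, and zero for $i=1$). For $1\le p\le t-1$ define $\delta:T_t^p\to T_t^{p+1}$ on $\alpha_1\otimes\cdots\otimes\alpha_p\in\wedge^{i_1}V\otimes\cdots\otimes\wedge^{i_p}V$ by $$\delta(\alpha_1\otimes\cdots\otimes\alpha_p)=\sum_{j=1}^p(-1)^{j-1}\alpha_1\otimes\cdots\otimes\alpha_{j-1}\otimes\delta(\alpha_j)\otimes\alpha_{j+1}\otimes\cdots\otimes\alpha_p.$$ *)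

theory Defs
  imports
    "Jordan_Normal_Form.VS_Connect"
    "Jordan_Normal_Form.Determinant"
    "HOL-Library.Poly_Mapping"
    "HOL-Algebra.QuotRing"
begin

text \<open>
  The field is a type \<open>'k\<close> of class \<open>field\<close>, used as the ring record \<^term>\<open>class_ring\<close>. Vector spaces
  and associative algebras over it are \<open>module\<close> records; for a mere vector space the fields
  \<open>mult\<close> and \<open>one\<close> carry no information.
\<close>

section \<open>Linear algebra\<close>

abbreviation span_in :: "('k::field, 'a) module \<Rightarrow> 'a set \<Rightarrow> 'a set" where
  "span_in \<equiv> LinearCombinations.module.span class_ring"

definition scalars :: "('k::field, 'k) module" where
  "scalars = \<lparr>carrier = UNIV, mult = (*), one = 1, zero = 0, add = (+), smult = (*)\<rparr>"

definition lin :: "('k::field, 'a) module \<Rightarrow> ('k, 'b) module \<Rightarrow> ('a \<Rightarrow> 'b) set" where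
  "lin M N = LinearCombinations.module_hom class_ring M N \<inter> extensional (carrier M)"

text \<open>
  The linear map determined by a condition \<open>P\<close>, which below always prescribes the values on a
  spanning set.
\<close>
definition the_lin ::
    "('k::field, 'a) module \<Rightarrow> ('k, 'b) module \<Rightarrow> (('a \<Rightarrow> 'b) \<Rightarrow> bool) \<Rightarrow> 'a \<Rightarrow> 'b" where
  "the_lin M N P = (THE f. f \<in> lin M N \<and> P f)"

definition dual :: "('k::field, 'a) module \<Rightarrow> ('k, 'a \<Rightarrow> 'k) module" where
  "dual M = (ring.func_space class_ring (carrier M))\<lparr>carrier := lin M scalars\<rparr>"

text \<open>
  \<open>M/N\<close>, for a subspace \<open>N\<close> of a vector space or a two-sided ideal \<open>N\<close> of an algebra. A scalar
  multiple of a coset \<open>X\<close> is again a full coset, also for the scalar \<open>0\<close>.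
\<close>
definition quot :: "('k::field, 'a) module \<Rightarrow> 'a set \<Rightarrow> ('k, 'a set) module" where
  "quot M N = ring.extend (M Quot N)
     (module.fields (\<lambda>c X. \<Union>x\<in>X. N +>\<^bsub>M\<^esub> (c \<odot>\<^bsub>M\<^esub> x)))"

definition free_space :: "'s set \<Rightarrow> ('k::field, 's \<Rightarrow>\<^sub>0 'k) module" where
  "free_space S = \<lparr>carrier = {x. Poly_Mapping.keys x \<subseteq> S}, mult = (\<lambda>x y. 0), one = 0, zero = 0, add = (+),
     smult = (\<lambda>c. Poly_Mapping.map ((*) c))\<rparr>"

text \<open>The free associative unital algebra on \<open>S\<close>, with the words over \<open>S\<close> as a basis.\<close>
definition free_algebra :: "'s set \<Rightarrow> ('k::field, 's list \<Rightarrow>\<^sub>0 'k) module" where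
  "free_algebra S = \<lparr>carrier = {x. Poly_Mapping.keys x \<subseteq> lists S},
     mult = (\<lambda>x y. \<Sum>u\<in>Poly_Mapping.keys x. \<Sum>v\<in>Poly_Mapping.keys y.
               Poly_Mapping.single (u @ v) (Poly_Mapping.lookup x u * Poly_Mapping.lookup y v)),
     one = Poly_Mapping.single [] 1, zero = 0, add = (+),
     smult = (\<lambda>c. Poly_Mapping.map ((*) c))\<rparr>"

section \<open>Tensor products\<close>

definition tensor_rels ::
    "('k::field, 'a) module \<Rightarrow> ('k, 'b) module \<Rightarrow> ('a \<times> 'b \<Rightarrow>\<^sub>0 'k) set" where
  "tensor_rels M N =
     {Poly_Mapping.single (x \<oplus>\<^bsub>M\<^esub> x', y) 1 - Poly_Mapping.single (x, y) 1
        - Poly_Mapping.single (x', y) 1 | x x' y.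
        x \<in> carrier M \<and> x' \<in> carrier M \<and> y \<in> carrier N} \<union>
     {Poly_Mapping.single (x, y \<oplus>\<^bsub>N\<^esub> y') 1 - Poly_Mapping.single (x, y) 1
        - Poly_Mapping.single (x, y') 1 | x y y'.
        x \<in> carrier M \<and> y \<in> carrier N \<and> y' \<in> carrier N} \<union>
     {Poly_Mapping.single (c \<odot>\<^bsub>M\<^esub> x, y) 1 - Poly_Mapping.single (x, y) c | c x y.
        x \<in> carrier M \<and> y \<in> carrier N} \<union>
     {Poly_Mapping.single (x, c \<odot>\<^bsub>N\<^esub> y) 1 - Poly_Mapping.single (x, y) c | c x y.
        x \<in> carrier M \<and> y \<in> carrier N}"

definition tensor ::
    "('k::field, 'a) module \<Rightarrow> ('k, 'b) module \<Rightarrow> ('k, ('a \<times> 'b \<Rightarrow>\<^sub>0 'k) set) module" where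
  "tensor M N = quot (free_space (carrier M \<times> carrier N))
     (span_in (free_space (carrier M \<times> carrier N)) (tensor_rels M N))"

definition pure_tensor ::
    "('k::field, 'a) module \<Rightarrow> ('k, 'b) module \<Rightarrow> 'a \<Rightarrow> 'b \<Rightarrow> ('a \<times> 'b \<Rightarrow>\<^sub>0 'k) set" where
  "pure_tensor M N x y = span_in (free_space (carrier M \<times> carrier N)) (tensor_rels M N)
     +>\<^bsub>free_space (carrier M \<times> carrier N) :: ('k, _) module\<^esub> Poly_Mapping.single (x, y) 1"

definition tuples :: "('k::field, 'a) module \<Rightarrow> nat \<Rightarrow> 'a list set" where
  "tuples W p = {xs. set xs \<subseteq> carrier W \<and> length xs = p}"

definition tpow_rels :: "('k::field, 'a) module \<Rightarrow> nat \<Rightarrow> ('a list \<Rightarrow>\<^sub>0 'k) set" where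
  "tpow_rels W p =
     {Poly_Mapping.single (xs[j := x \<oplus>\<^bsub>W\<^esub> y]) 1 - Poly_Mapping.single (xs[j := x]) 1
        - Poly_Mapping.single (xs[j := y]) 1 | xs j x y.
        xs \<in> tuples W p \<and> j < p \<and> x \<in> carrier W \<and> y \<in> carrier W} \<union>
     {Poly_Mapping.single (xs[j := c \<odot>\<^bsub>W\<^esub> x]) 1 - Poly_Mapping.single (xs[j := x]) c | xs j c x.
        xs \<in> tuples W p \<and> j < p \<and> x \<in> carrier W}"

text \<open>The tensor power \<open>W\<^sup>\<otimes>\<^sup>p\<close>; for \<open>p = 0\<close> it is the one-dimensional space spanned by the empty tensor.\<close>
definition tpow :: "('k::field, 'a) module \<Rightarrow> nat \<Rightarrow> ('k, ('a list \<Rightarrow>\<^sub>0 'k) set) module" where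
  "tpow W p = quot (free_space (tuples W p)) (span_in (free_space (tuples W p)) (tpow_rels W p))"

definition pure_tpow :: "('k::field, 'a) module \<Rightarrow> 'a list \<Rightarrow> ('a list \<Rightarrow>\<^sub>0 'k) set" where
  "pure_tpow W xs =
     span_in (free_space (tuples W (length xs))) (tpow_rels W (length xs))
       +>\<^bsub>free_space (tuples W (length xs)) :: ('k, _) module\<^esub> Poly_Mapping.single xs 1"

section \<open>The exterior algebra\<close>

definition ext_rels :: "('k::field, 'a) module \<Rightarrow> ('a list \<Rightarrow>\<^sub>0 'k) set" where
  "ext_rels W =
     {Poly_Mapping.single [x \<oplus>\<^bsub>W\<^esub> y] 1 - Poly_Mapping.single [x] 1 - Poly_Mapping.single [y] 1 | x y.
        x \<in> carrier W \<and> y \<in> carrier W} \<union>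
     {Poly_Mapping.single [c \<odot>\<^bsub>W\<^esub> x] 1 - Poly_Mapping.single [x] c | c x. x \<in> carrier W} \<union>
     {Poly_Mapping.single [x, x] 1 | x. x \<in> carrier W}"

text \<open>
  The first two kinds of relations turn the free algebra on the elements of \<open>W\<close> into the tensor
  algebra of \<open>W\<close>; the third kind is \<open>x \<otimes> x = 0\<close>.
\<close>
definition ext :: "('k::field, 'a) module \<Rightarrow> ('k, ('a list \<Rightarrow>\<^sub>0 'k) set) module" where
  "ext W = quot (free_algebra (carrier W))
     (Idl\<^bsub>free_algebra (carrier W) :: ('k, _) module\<^esub> (ext_rels W))"

text \<open>\<open>wedge W [w\<^sub>1, \<dots>, w\<^sub>i]\<close> is \<open>w\<^sub>1 \<and> \<dots> \<and> w\<^sub>i\<close>, and the unit of the algebra for \<open>i = 0\<close>.\<close>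
definition wedge :: "('k::field, 'a) module \<Rightarrow> 'a list \<Rightarrow> ('a list \<Rightarrow>\<^sub>0 'k) set" where
  "wedge W ws = (Idl\<^bsub>free_algebra (carrier W) :: ('k, _) module\<^esub> (ext_rels W))
     +>\<^bsub>free_algebra (carrier W) :: ('k, _) module\<^esub> Poly_Mapping.single ws 1"

definition ext_pow :: "('k::field, 'a) module \<Rightarrow> nat \<Rightarrow> ('k, ('a list \<Rightarrow>\<^sub>0 'k) set) module" where
  "ext_pow W i = (ext W)\<lparr>carrier := span_in (ext W) (wedge W ` tuples W i)\<rparr>"

text \<open>\<open>\<Oplus>\<^sub>i\<^sub>\<ge>\<^sub>1 \<and>\<^sup>iW\<close>, as a subspace of the exterior algebra.\<close>
definition ext_pos :: "('k::field, 'a) module \<Rightarrow> ('k, ('a list \<Rightarrow>\<^sub>0 'k) set) module" where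
  "ext_pos W = (ext W)\<lparr>carrier := span_in (ext W) (\<Union>i\<in>{1..}. carrier (ext_pow W i))\<rparr>"

definition augmentation :: "('k::field, 'a) module \<Rightarrow> ('a list \<Rightarrow>\<^sub>0 'k) set \<Rightarrow> 'k" where
  "augmentation W = the_lin (ext W) scalars
     (\<lambda>e. e \<one>\<^bsub>ext W\<^esub> = 1 \<and> (\<forall>i\<ge>1. \<forall>x\<in>carrier (ext_pow W i). e x = 0))"

section \<open>The normalized bar resolution of an augmented algebra\<close>

definition unit_line :: "('k::field, 'l) module \<Rightarrow> 'l set" where
  "unit_line L = {c \<odot>\<^bsub>L\<^esub> \<one>\<^bsub>L\<^esub> | c. True}"

definition reduced :: "('k::field, 'l) module \<Rightarrow> ('k, 'l set) module" where
  "reduced L = quot L (unit_line L)"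

definition reduced_class :: "('k::field, 'l) module \<Rightarrow> 'l \<Rightarrow> 'l set" where
  "reduced_class L x = unit_line L +>\<^bsub>L\<^esub> x"

text \<open>In degree \<open>0\<close> this is \<open>\<Lambda> \<otimes> k\<close> instead of \<open>\<Lambda>\<close>.\<close>
definition bar ::
    "('k::field, 'l) module \<Rightarrow> nat \<Rightarrow> ('k, ('l \<times> ('l set list \<Rightarrow>\<^sub>0 'k) set \<Rightarrow>\<^sub>0 'k) set) module" where
  "bar L p = tensor L (tpow (reduced L) p)"

text \<open>\<open>bar_gen L x [y\<^sub>1, \<dots>, y\<^sub>p]\<close> is \<open>x \<otimes> y\<^sub>1 \<otimes> \<dots> \<otimes> y\<^sub>p\<close> with the classes of \<open>y\<^sub>1, \<dots>, y\<^sub>p\<close> modulo \<open>k\<close>.\<close>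
definition bar_gen ::
    "('k::field, 'l) module \<Rightarrow> 'l \<Rightarrow> 'l list \<Rightarrow> ('l \<times> ('l set list \<Rightarrow>\<^sub>0 'k) set \<Rightarrow>\<^sub>0 'k) set" where
  "bar_gen L x ys = pure_tensor L (tpow (reduced L) (length ys)) x
     (pure_tpow (reduced L) (map (reduced_class L) ys))"

text \<open>Multiplies the \<open>j\<close>-th and the \<open>(j+1)\<close>-st entry of a list, counting from \<open>1\<close>.\<close>
definition contract :: "('k::field, 'l) module \<Rightarrow> nat \<Rightarrow> 'l list \<Rightarrow> 'l list" where
  "contract L j ys = take (j - 1) ys @ [ys ! (j - 1) \<otimes>\<^bsub>L\<^esub> ys ! j] @ drop (j + 1) ys"

text \<open>The differential from \<open>bar L p\<close> to \<open>bar L (p - 1)\<close>, for \<open>p \<ge> 1\<close>.\<close>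
definition bar_diff :: "('k::field, 'l) module \<Rightarrow> ('l \<Rightarrow> 'k) \<Rightarrow> nat \<Rightarrow>
    ('l \<times> ('l set list \<Rightarrow>\<^sub>0 'k) set \<Rightarrow>\<^sub>0 'k) set \<Rightarrow> ('l \<times> ('l set list \<Rightarrow>\<^sub>0 'k) set \<Rightarrow>\<^sub>0 'k) set" where
  "bar_diff L \<epsilon> p = the_lin (bar L p) (bar L (p - 1)) (\<lambda>d.
     \<forall>x\<in>carrier L. \<forall>ys\<in>tuples L p.
       d (bar_gen L x ys) =
         bar_gen L (x \<otimes>\<^bsub>L\<^esub> hd ys) (tl ys)
         \<oplus>\<^bsub>bar L (p - 1)\<^esub> (\<Oplus>\<^bsub>bar L (p - 1)\<^esub> j\<in>{1..p - 1}.
              (- 1) ^ j \<odot>\<^bsub>bar L (p - 1)\<^esub> bar_gen L x (contract L j ys))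
         \<oplus>\<^bsub>bar L (p - 1)\<^esub> ((- 1) ^ p * \<epsilon> (last ys)) \<odot>\<^bsub>bar L (p - 1)\<^esub> bar_gen L x (butlast ys))"

definition bar_act :: "('k::field, 'l) module \<Rightarrow> nat \<Rightarrow> 'l \<Rightarrow>
    ('l \<times> ('l set list \<Rightarrow>\<^sub>0 'k) set \<Rightarrow>\<^sub>0 'k) set \<Rightarrow> ('l \<times> ('l set list \<Rightarrow>\<^sub>0 'k) set \<Rightarrow>\<^sub>0 'k) set" where
  "bar_act L p a = the_lin (bar L p) (bar L p) (\<lambda>m.
     \<forall>x\<in>carrier L. \<forall>y\<in>carrier (tpow (reduced L) p).
       m (pure_tensor L (tpow (reduced L) p) x y) =
         pure_tensor L (tpow (reduced L) p) (a \<otimes>\<^bsub>L\<^esub> x) y)"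

text \<open>\<open>Hom\<^sub>L(bar L p, k)\<close>, where \<open>L\<close> acts on \<open>k\<close> through \<open>\<epsilon>\<close>.\<close>
definition bar_hom :: "('k::field, 'l) module \<Rightarrow> ('l \<Rightarrow> 'k) \<Rightarrow> nat \<Rightarrow>
    (('l \<times> ('l set list \<Rightarrow>\<^sub>0 'k) set \<Rightarrow>\<^sub>0 'k) set \<Rightarrow> 'k) set" where
  "bar_hom L \<epsilon> p = {f \<in> lin (bar L p) scalars.
     \<forall>a\<in>carrier L. \<forall>b\<in>carrier (bar L p). f (bar_act L p a b) = \<epsilon> a * f b}"

definition bar_codiff :: "('k::field, 'l) module \<Rightarrow> ('l \<Rightarrow> 'k) \<Rightarrow> nat \<Rightarrow>
    (('l \<times> ('l set list \<Rightarrow>\<^sub>0 'k) set \<Rightarrow>\<^sub>0 'k) set \<Rightarrow> 'k) \<Rightarrow>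
    (('l \<times> ('l set list \<Rightarrow>\<^sub>0 'k) set \<Rightarrow>\<^sub>0 'k) set \<Rightarrow> 'k)" where
  "bar_codiff L \<epsilon> p f = compose (carrier (bar L p)) f (bar_diff L \<epsilon> p)"

definition bar_restrict :: "('k::field, 'l) module \<Rightarrow> nat \<Rightarrow>
    (('l \<times> ('l set list \<Rightarrow>\<^sub>0 'k) set \<Rightarrow>\<^sub>0 'k) set \<Rightarrow> 'k) \<Rightarrow> (('l set list \<Rightarrow>\<^sub>0 'k) set \<Rightarrow> 'k)" where
  "bar_restrict L p f =
     (\<lambda>m\<in>carrier (tpow (reduced L) p). f (pure_tensor L (tpow (reduced L) p) \<one>\<^bsub>L\<^esub> m))"

section \<open>The dual complex of the exterior algebra of \<open>V\<^sup>*\<close>\<close>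

abbreviation Lam :: "('k::field, 'v) module \<Rightarrow> ('k, (('v \<Rightarrow> 'k) list \<Rightarrow>\<^sub>0 'k) set) module" where
  "Lam V \<equiv> ext (dual V)"

definition pairing :: "('k::field, 'v) module \<Rightarrow>
    ('v list \<Rightarrow>\<^sub>0 'k) set \<Rightarrow> (('v \<Rightarrow> 'k) list \<Rightarrow>\<^sub>0 'k) set set \<Rightarrow> 'k" where
  "pairing V = the_lin (ext_pos V) (dual (reduced (Lam V))) (\<lambda>F.
     \<forall>i\<ge>1. \<forall>i'. \<forall>vs\<in>tuples V i. \<forall>fs\<in>tuples (dual V) i'.
       F (wedge V vs) (reduced_class (Lam V) (wedge (dual V) fs)) =
         (if i' = i then det (mat i i (\<lambda>(j, l). (fs ! l) (vs ! j))) else 0))"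

definition tpow_pairing :: "('k::field, 'v) module \<Rightarrow> nat \<Rightarrow>
    (('v list \<Rightarrow>\<^sub>0 'k) set list \<Rightarrow>\<^sub>0 'k) set \<Rightarrow>
    ((('v \<Rightarrow> 'k) list \<Rightarrow>\<^sub>0 'k) set set list \<Rightarrow>\<^sub>0 'k) set \<Rightarrow> 'k" where
  "tpow_pairing V p = the_lin (tpow (ext_pos V) p) (dual (tpow (reduced (Lam V)) p)) (\<lambda>F.
     \<forall>as\<in>tuples (ext_pos V) p. \<forall>ls\<in>tuples (reduced (Lam V)) p.
       F (pure_tpow (ext_pos V) as) (pure_tpow (reduced (Lam V)) ls) =
         (\<Prod>j<p. pairing V (as ! j) (ls ! j)))"

text \<open>
  The identification of the \<open>p\<close>-fold tensor power of \<open>\<Oplus>\<^sub>i\<^sub>\<ge>\<^sub>1 \<and>\<^sup>iV\<close> with \<open>Hom\<^sub>\<Lambda>(bar \<Lambda> p, k)\<close>: the homomorphism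
  whose restriction to \<open>1 \<otimes> M\<close>, with \<open>M\<close> the \<open>p\<close>-fold tensor power of \<open>\<Lambda>/k\<close>, is pairing with \<open>x\<close>.
\<close>
definition cobar_ident :: "('k::field, 'v) module \<Rightarrow> nat \<Rightarrow>
    (('v list \<Rightarrow>\<^sub>0 'k) set list \<Rightarrow>\<^sub>0 'k) set \<Rightarrow>
    (((('v \<Rightarrow> 'k) list \<Rightarrow>\<^sub>0 'k) set \<times> ((('v \<Rightarrow> 'k) list \<Rightarrow>\<^sub>0 'k) set set list \<Rightarrow>\<^sub>0 'k) set \<Rightarrow>\<^sub>0 'k) set
      \<Rightarrow> 'k)" where
  "cobar_ident V p x =
     the_inv_into (bar_hom (Lam V) (augmentation (dual V)) p) (bar_restrict (Lam V) p)
       (tpow_pairing V p x)"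

text \<open>
  For \<open>p \<ge> 1\<close>, the map \<open>\<partial>\<^sub>p\<^sup>*\<close> from the \<open>(p-1)\<close>-st to the \<open>p\<close>-th tensor power of \<open>\<Oplus>\<^sub>i\<^sub>\<ge>\<^sub>1 \<and>\<^sup>iV\<close>.
\<close>
definition cobar_diff :: "('k::field, 'v) module \<Rightarrow> nat \<Rightarrow>
    (('v list \<Rightarrow>\<^sub>0 'k) set list \<Rightarrow>\<^sub>0 'k) set \<Rightarrow> (('v list \<Rightarrow>\<^sub>0 'k) set list \<Rightarrow>\<^sub>0 'k) set" where
  "cobar_diff V p x =
     the_inv_into (carrier (tpow (ext_pos V) p)) (cobar_ident V p)
       (bar_codiff (Lam V) (augmentation (dual V)) p (cobar_ident V (p - 1) x))"

section \<open>The spaces \<open>T\<^sub>t\<^sup>p\<close> and the map \<open>\<delta>\<close>\<close>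

definition multidegrees :: "('k::field, 'v) module \<Rightarrow> nat \<Rightarrow> nat \<Rightarrow> nat list set" where
  "multidegrees V t p =
     {ks. length ks = p \<and> set ks \<subseteq> {1..vectorspace.dim class_ring V} \<and> sum_list ks = t}"

definition homog_tuples ::
    "('k::field, 'v) module \<Rightarrow> nat list \<Rightarrow> ('v list \<Rightarrow>\<^sub>0 'k) set list set" where
  "homog_tuples V ks =
     {as. length as = length ks \<and> (\<forall>j<length ks. as ! j \<in> carrier (ext_pow V (ks ! j)))}"

definition T :: "('k::field, 'v) module \<Rightarrow> nat \<Rightarrow> nat \<Rightarrow>
    ('k, (('v list \<Rightarrow>\<^sub>0 'k) set list \<Rightarrow>\<^sub>0 'k) set) module" where
  "T V t p = (tpow (ext_pos V) p)\<lparr>carrier := span_in (tpow (ext_pos V) p)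
     (\<Union>ks\<in>multidegrees V t p. pure_tpow (ext_pos V) ` homog_tuples V ks)\<rparr>"

text \<open>Index sets are subsets of \<open>{0..<i}\<close> instead of \<open>{1..i}\<close>, as list positions count from \<open>0\<close>.\<close>
definition splittings :: "nat \<Rightarrow> (nat set \<times> nat set) set" where
  "splittings i = {(A, B). A \<noteq> {} \<and> B \<noteq> {} \<and> A \<inter> B = {} \<and> A \<union> B = {..<i}}"

definition split_sign :: "nat set \<Rightarrow> nat set \<Rightarrow> 'k::field" where
  "split_sign A B = (- 1) ^ card {(a, b) \<in> A \<times> B. a > b}"

text \<open>
  \<open>\<delta>\<close> on \<open>\<and>\<^sup>iV\<close>. Here \<open>nths vs A\<close> lists the entries of \<open>vs\<close> at the positions in \<open>A\<close>, in increasing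
  order of positions.
\<close>
definition delta1 :: "('k::field, 'v) module \<Rightarrow> nat \<Rightarrow>
    ('v list \<Rightarrow>\<^sub>0 'k) set \<Rightarrow> (('v list \<Rightarrow>\<^sub>0 'k) set list \<Rightarrow>\<^sub>0 'k) set" where
  "delta1 V i = the_lin (ext_pow V i) (T V i 2) (\<lambda>d. \<forall>vs\<in>tuples V i.
     d (wedge V vs) = finsum (T V i 2)
       (\<lambda>(A, B). split_sign A B \<odot>\<^bsub>T V i 2\<^esub>
          pure_tpow (ext_pos V) [wedge V (nths vs A), wedge V (nths vs B)])
       (splittings i))"

text \<open>
  The linear map from \<open>W\<^sup>\<otimes>\<^sup>2\<close> that inserts its argument in place of the factor at position \<open>j\<close>
  (counting from \<open>0\<close>) of the pure tensor given by \<open>as\<close>.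
\<close>
definition insert_at :: "('k::field, 'a) module \<Rightarrow> 'a list \<Rightarrow> nat \<Rightarrow>
    ('a list \<Rightarrow>\<^sub>0 'k) set \<Rightarrow> ('a list \<Rightarrow>\<^sub>0 'k) set" where
  "insert_at W as j = the_lin (tpow W 2) (tpow W (length as + 1)) (\<lambda>F.
     \<forall>x\<in>carrier W. \<forall>y\<in>carrier W.
       F (pure_tpow W [x, y]) = pure_tpow W (take j as @ [x, y] @ drop (j + 1) as))"

definition delta :: "('k::field, 'v) module \<Rightarrow> nat \<Rightarrow> nat \<Rightarrow>
    (('v list \<Rightarrow>\<^sub>0 'k) set list \<Rightarrow>\<^sub>0 'k) set \<Rightarrow> (('v list \<Rightarrow>\<^sub>0 'k) set list \<Rightarrow>\<^sub>0 'k) set" where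
  "delta V t p = the_lin (T V t p) (T V t (p + 1)) (\<lambda>d.
     \<forall>ks\<in>multidegrees V t p. \<forall>as\<in>homog_tuples V ks.
       d (pure_tpow (ext_pos V) as) =
         (\<Oplus>\<^bsub>T V t (p + 1)\<^esub> j\<in>{..<p}.
            (- 1) ^ j \<odot>\<^bsub>T V t (p + 1)\<^esub>
              insert_at (ext_pos V) as j (delta1 V (ks ! j) (as ! j))))"

end

theory Submission
  imports Defs
begin

text \<open>
  Let \<open>P\<close> be the positive part of the exterior algebra of \<open>V\<close> and \<open>R = \<Lambda>/k\<close>. A \<open>\<Lambda>\<close>-linear functional on
  \<open>\<Lambda> \<otimes> R\<^sup>\<otimes>\<^sup>p\<close> is determined by its restriction to \<open>1 \<otimes> R\<^sup>\<otimes>\<^sup>p\<close>, and the determinant pairing turns the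
  functionals on \<open>R\<^sup>\<otimes>\<^sup>p\<close> into the elements of \<open>P\<^sup>\<otimes>\<^sup>p\<close>. Hence \<open>\<partial>\<^sup>*x\<close> is known once its values at the tensors
  \<open>\<lambda>\<^sub>1 \<otimes> \<dots> \<otimes> \<lambda>\<^sub>p\<^sub>+\<^sub>1\<close> of classes are known, and here every \<open>\<lambda>\<^sub>j\<close> may be taken from the augmentation ideal
  (\<open>tpow_pairing_separates\<close>). For such arguments the two outer terms of the bar differential contribute
  nothing to a homomorphism into \<open>k\<close>: they carry the factors \<open>\<epsilon>(\<lambda>\<^sub>1)\<close> and \<open>\<epsilon>(\<lambda>\<^sub>p\<^sub>+\<^sub>1)\<close>. What remains is the sum
  over \<open>1 \<le> j \<le> p\<close> of \<open>(-1)\<^sup>j\<close> times the value of \<open>x\<close> at \<open>\<lambda>\<^sub>1 \<otimes> \<dots> \<otimes> \<lambda>\<^sub>j\<lambda>\<^sub>j\<^sub>+\<^sub>1 \<otimes> \<dots> \<otimes> \<lambda>\<^sub>p\<^sub>+\<^sub>1\<close>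
  (\<open>bar_codiff_aug_ideal\<close>, \<open>pairing_cobar_diff\<close>).

  So the claim is that \<open>\<delta>\<close> on \<open>\<and>\<^sup>iV\<close> is adjoint to the multiplication of \<open>\<Lambda>\<close>. For wedge products this is the
  Laplace expansion of a determinant along several columns (\<open>det_form_append\<close>, \<open>pairing_mult_split\<close>). On a
  tensor \<open>\<alpha>\<^sub>1 \<otimes> \<dots> \<otimes> \<alpha>\<^sub>p\<close> the \<open>j\<close>-th summand of \<open>\<delta>\<close> applies this to \<open>\<alpha>\<^sub>j\<close> and has the sign \<open>(-1)\<^sup>j\<^sup>-\<^sup>1\<close>
  instead of \<open>(-1)\<^sup>j\<close>, whence \<open>\<partial>\<^sup>* = -\<delta>\<close> (\<open>delta_sum_eq\<close>).

  The linear maps in the statement are specified by their values on spanning sets, and that such maps exist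
  is the larger part of the work. It rests on the universal properties \<open>tensor_lift\<close>, \<open>tpow_lift\<close> and
  \<open>ext_lift\<close>; the bar differential descends to \<open>\<Lambda>/k\<close> because the two terms that can survive a scalar entry
  cancel (\<open>sum_faces_unit_line\<close>). The pairing of \<open>P\<close> with \<open>R\<close> is perfect because the wedge products over
  increasing words in dual bases of \<open>V\<close> and \<open>V\<^sup>*\<close> are spanning families dual to each other
  (\<open>pairing_dual_bases\<close>, \<open>bij_betw_dual_basis\<close>), a property that passes to tensor powers
  (\<open>tpow_pairing_bij\<close>). Finally, \<open>\<delta>\<close> is well defined because \<open>-\<partial>\<^sup>*\<close> is a linear map with the values
  prescribed for \<open>\<delta>\<close> (\<open>delta1_props\<close>, \<open>delta_eq\<close>).
\<close>

section \<open>Vector spaces, subspaces and linear maps\<close>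

abbreviation (input) vspace :: "('k::field, 'a) module \<Rightarrow> bool" where
  "vspace M \<equiv> vectorspace class_ring M"

text \<open>
  Subspaces and linear maps are handled by plain predicates, so that several spaces can be treated side
  by side without interpreting a locale for each of them.
\<close>
definition subsp :: "('k::field, 'a) module \<Rightarrow> 'a set \<Rightarrow> bool" where
  "subsp M N \<longleftrightarrow> N \<subseteq> carrier M \<and> \<zero>\<^bsub>M\<^esub> \<in> N \<and> (\<forall>x\<in>N. \<forall>y\<in>N. x \<oplus>\<^bsub>M\<^esub> y \<in> N) \<and>
     (\<forall>c. \<forall>x\<in>N. c \<odot>\<^bsub>M\<^esub> x \<in> N)"

definition linmap :: "('k::field, 'a) module \<Rightarrow> ('k, 'b) module \<Rightarrow> ('a \<Rightarrow> 'b) \<Rightarrow> bool" where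
  "linmap M N f \<longleftrightarrow> (\<forall>x\<in>carrier M. f x \<in> carrier N) \<and>
     (\<forall>x\<in>carrier M. \<forall>y\<in>carrier M. f (x \<oplus>\<^bsub>M\<^esub> y) = f x \<oplus>\<^bsub>N\<^esub> f y) \<and>
     (\<forall>c. \<forall>x\<in>carrier M. f (c \<odot>\<^bsub>M\<^esub> x) = c \<odot>\<^bsub>N\<^esub> f x)"

lemma vspaceI:
  fixes M :: "('k::field, 'a) module"
  assumes "\<zero>\<^bsub>M\<^esub> \<in> carrier M"
    and "\<And>x y. x \<in> carrier M \<Longrightarrow> y \<in> carrier M \<Longrightarrow> x \<oplus>\<^bsub>M\<^esub> y \<in> carrier M"
    and "\<And>x. x \<in> carrier M \<Longrightarrow> \<exists>y\<in>carrier M. x \<oplus>\<^bsub>M\<^esub> y = \<zero>\<^bsub>M\<^esub>"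
    and "\<And>c x. x \<in> carrier M \<Longrightarrow> c \<odot>\<^bsub>M\<^esub> x \<in> carrier M"
    and "\<And>x y. x \<in> carrier M \<Longrightarrow> y \<in> carrier M \<Longrightarrow> x \<oplus>\<^bsub>M\<^esub> y = y \<oplus>\<^bsub>M\<^esub> x"
    and "\<And>x y z. x \<in> carrier M \<Longrightarrow> y \<in> carrier M \<Longrightarrow> z \<in> carrier M \<Longrightarrow>
           (x \<oplus>\<^bsub>M\<^esub> y) \<oplus>\<^bsub>M\<^esub> z = x \<oplus>\<^bsub>M\<^esub> (y \<oplus>\<^bsub>M\<^esub> z)"
    and "\<And>x. x \<in> carrier M \<Longrightarrow> \<zero>\<^bsub>M\<^esub> \<oplus>\<^bsub>M\<^esub> x = x"
    and "\<And>x. x \<in> carrier M \<Longrightarrow> 1 \<odot>\<^bsub>M\<^esub> x = x"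
    and "\<And>c d x. x \<in> carrier M \<Longrightarrow> (c * d) \<odot>\<^bsub>M\<^esub> x = c \<odot>\<^bsub>M\<^esub> (d \<odot>\<^bsub>M\<^esub> x)"
    and "\<And>c d x. x \<in> carrier M \<Longrightarrow> (c + d) \<odot>\<^bsub>M\<^esub> x = c \<odot>\<^bsub>M\<^esub> x \<oplus>\<^bsub>M\<^esub> d \<odot>\<^bsub>M\<^esub> x"
    and "\<And>c x y. x \<in> carrier M \<Longrightarrow> y \<in> carrier M \<Longrightarrow>
           c \<odot>\<^bsub>M\<^esub> (x \<oplus>\<^bsub>M\<^esub> y) = c \<odot>\<^bsub>M\<^esub> x \<oplus>\<^bsub>M\<^esub> c \<odot>\<^bsub>M\<^esub> y"
  shows "vspace M"
proof (rule vs_criteria[OF class_field])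
  show "\<forall>x\<in>carrier M. x \<oplus>\<^bsub>M\<^esub> \<zero>\<^bsub>M\<^esub> = x"
    using assms(1,5,7) by metis
  show "\<forall>v w. v \<in> carrier M \<and> w \<in> carrier M \<longrightarrow> v \<oplus>\<^bsub>M\<^esub> w = w \<oplus>\<^bsub>M\<^esub> v"
    using assms(5) by blast
qed (use assms(1) in blast, use assms(2) in blast, use assms(3) in blast, use assms(4) in blast,
    use assms(6) in blast, use assms(9) in simp, use assms(8) in simp, use assms(10) in simp,
    use assms(11) in simp)

context
  fixes M :: "('k::field, 'a) module"
  assumes vs: "vspace M"
begin

interpretation vectorspace class_ring M by (rule vs)

lemma vs_zero [simp]: "\<zero>\<^bsub>M\<^esub> \<in> carrier M"
  and vs_add [simp]: "x \<in> carrier M \<Longrightarrow> y \<in> carrier M \<Longrightarrow> x \<oplus>\<^bsub>M\<^esub> y \<in> carrier M"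
  and vs_smult [simp]: "x \<in> carrier M \<Longrightarrow> c \<odot>\<^bsub>M\<^esub> x \<in> carrier M"
  and vs_neg [simp]: "x \<in> carrier M \<Longrightarrow> \<ominus>\<^bsub>M\<^esub> x \<in> carrier M"
  and vs_minus [simp]: "x \<in> carrier M \<Longrightarrow> y \<in> carrier M \<Longrightarrow> x \<ominus>\<^bsub>M\<^esub> y \<in> carrier M"
  and vs_zero_add [simp]: "x \<in> carrier M \<Longrightarrow> \<zero>\<^bsub>M\<^esub> \<oplus>\<^bsub>M\<^esub> x = x"
  and vs_add_zero [simp]: "x \<in> carrier M \<Longrightarrow> x \<oplus>\<^bsub>M\<^esub> \<zero>\<^bsub>M\<^esub> = x"
  and vs_one_smult [simp]: "x \<in> carrier M \<Longrightarrow> 1 \<odot>\<^bsub>M\<^esub> x = x"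
  and vs_zero_smult [simp]: "x \<in> carrier M \<Longrightarrow> 0 \<odot>\<^bsub>M\<^esub> x = \<zero>\<^bsub>M\<^esub>"
  and vs_smult_zero [simp]: "c \<odot>\<^bsub>M\<^esub> \<zero>\<^bsub>M\<^esub> = \<zero>\<^bsub>M\<^esub>"
  and vs_add_neg [simp]: "x \<in> carrier M \<Longrightarrow> x \<oplus>\<^bsub>M\<^esub> \<ominus>\<^bsub>M\<^esub> x = \<zero>\<^bsub>M\<^esub>"
  and vs_neg_add [simp]: "x \<in> carrier M \<Longrightarrow> \<ominus>\<^bsub>M\<^esub> x \<oplus>\<^bsub>M\<^esub> x = \<zero>\<^bsub>M\<^esub>"
  and vs_assoc: "x \<in> carrier M \<Longrightarrow> y \<in> carrier M \<Longrightarrow> z \<in> carrier M \<Longrightarrow>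
        (x \<oplus>\<^bsub>M\<^esub> y) \<oplus>\<^bsub>M\<^esub> z = x \<oplus>\<^bsub>M\<^esub> (y \<oplus>\<^bsub>M\<^esub> z)"
  and vs_comm: "x \<in> carrier M \<Longrightarrow> y \<in> carrier M \<Longrightarrow> x \<oplus>\<^bsub>M\<^esub> y = y \<oplus>\<^bsub>M\<^esub> x"
  and vs_lcomm: "x \<in> carrier M \<Longrightarrow> y \<in> carrier M \<Longrightarrow> z \<in> carrier M \<Longrightarrow>
        x \<oplus>\<^bsub>M\<^esub> (y \<oplus>\<^bsub>M\<^esub> z) = y \<oplus>\<^bsub>M\<^esub> (x \<oplus>\<^bsub>M\<^esub> z)"
  and vs_mult_smult: "x \<in> carrier M \<Longrightarrow> (c * d) \<odot>\<^bsub>M\<^esub> x = c \<odot>\<^bsub>M\<^esub> (d \<odot>\<^bsub>M\<^esub> x)"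
  and vs_add_smult: "x \<in> carrier M \<Longrightarrow> (c + d) \<odot>\<^bsub>M\<^esub> x = c \<odot>\<^bsub>M\<^esub> x \<oplus>\<^bsub>M\<^esub> d \<odot>\<^bsub>M\<^esub> x"
  and vs_smult_add: "x \<in> carrier M \<Longrightarrow> y \<in> carrier M \<Longrightarrow>
        c \<odot>\<^bsub>M\<^esub> (x \<oplus>\<^bsub>M\<^esub> y) = c \<odot>\<^bsub>M\<^esub> x \<oplus>\<^bsub>M\<^esub> c \<odot>\<^bsub>M\<^esub> y"
  and vs_minus_eq: "x \<ominus>\<^bsub>M\<^esub> y = x \<oplus>\<^bsub>M\<^esub> \<ominus>\<^bsub>M\<^esub> y"
  and vs_minus_zero_iff: "x \<in> carrier M \<Longrightarrow> y \<in> carrier M \<Longrightarrow> x \<ominus>\<^bsub>M\<^esub> y = \<zero>\<^bsub>M\<^esub> \<longleftrightarrow> x = y"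
  and vs_neg_unique: "x \<in> carrier M \<Longrightarrow> y \<in> carrier M \<Longrightarrow> y \<oplus>\<^bsub>M\<^esub> x = \<zero>\<^bsub>M\<^esub> \<Longrightarrow> \<ominus>\<^bsub>M\<^esub> x = y"
  subgoal by simp
  subgoal by simp
  subgoal by simp
  subgoal by simp
  subgoal by simp
  subgoal by simp
  subgoal by simp
  subgoal using smult_one by simp
  subgoal using smult_l_null by simp
  subgoal using smult_r_null by simp
  subgoal by (rule M.r_neg)
  subgoal by (rule M.l_neg)
  subgoal by (rule M.a_assoc)
  subgoal by (rule M.a_comm)
  subgoal by (rule M.a_lcomm)
  subgoal using smult_assoc1 by simp
  subgoal using smult_l_distr by simp
  subgoal using smult_r_distr by simp
  subgoal by (rule M.minus_eq)
  subgoal by simp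
  subgoal by (rule M.minus_equality)
  done

lemma vs_neg_eq: "x \<in> carrier M \<Longrightarrow> \<ominus>\<^bsub>M\<^esub> x = (- 1) \<odot>\<^bsub>M\<^esub> x"
  by (rule vs_neg_unique) (use vs_add_smult[of x "-1" 1] in auto)

lemma vs_minus_eq_smult: "x \<in> carrier M \<Longrightarrow> y \<in> carrier M \<Longrightarrow> x \<ominus>\<^bsub>M\<^esub> y = x \<oplus>\<^bsub>M\<^esub> (- 1) \<odot>\<^bsub>M\<^esub> y"
  by (simp add: vs_minus_eq vs_neg_eq)

lemma vs_add_minus_cancel: "x \<in> carrier M \<Longrightarrow> y \<in> carrier M \<Longrightarrow> (x \<oplus>\<^bsub>M\<^esub> y) \<ominus>\<^bsub>M\<^esub> y = x"
  by (simp add: vs_minus_eq vs_assoc)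

lemma vs_minus_add_cancel: "x \<in> carrier M \<Longrightarrow> y \<in> carrier M \<Longrightarrow> (x \<ominus>\<^bsub>M\<^esub> y) \<oplus>\<^bsub>M\<^esub> y = x"
  by (simp add: vs_minus_eq vs_assoc)

lemma subsp_submodule: "subsp M N \<longleftrightarrow> LinearCombinations.submodule class_ring N M"
  using module_axioms by (auto simp: subsp_def LinearCombinations.submodule_def)

lemma subsp_span: "S \<subseteq> carrier M \<Longrightarrow> subsp M (span_in M S)"
  by (simp add: subsp_submodule span_is_submodule)

lemma span_superset: "S \<subseteq> carrier M \<Longrightarrow> x \<in> S \<Longrightarrow> x \<in> span_in M S"
  using in_own_span by blast

lemma span_least: "subsp M N \<Longrightarrow> S \<subseteq> N \<Longrightarrow> span_in M S \<subseteq> N"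
  by (simp add: subsp_submodule span_is_subset)

lemma finsum_in_subsp:
  assumes "subsp M N" "\<And>i. i \<in> A \<Longrightarrow> g i \<in> N"
  shows "finsum M g A \<in> N"
  using assms(2)
proof (induction A rule: infinite_finite_induct)
  case (insert x F)
  then have "finsum M g (insert x F) = g x \<oplus>\<^bsub>M\<^esub> finsum M g F"
    using assms(1) by (intro M.finsum_insert) (auto simp: subsp_def)
  then show ?case using insert assms(1) by (auto simp: subsp_def)
qed (use assms(1) in \<open>auto simp: subsp_def\<close>)

lemma vs_finsum_closed: "(\<And>i. i \<in> A \<Longrightarrow> g i \<in> carrier M) \<Longrightarrow> finsum M g A \<in> carrier M"
  by (rule M.finsum_closed) auto

lemma vs_finsum_insert: "finite A \<Longrightarrow> a \<notin> A \<Longrightarrow> (\<And>i. i \<in> A \<Longrightarrow> g i \<in> carrier M) \<Longrightarrow> g a \<in> carrier M \<Longrightarrow>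
    finsum M g (insert a A) = g a \<oplus>\<^bsub>M\<^esub> finsum M g A"
  by (rule M.finsum_insert) auto

lemma vs_finsum_empty: "finsum M g {} = \<zero>\<^bsub>M\<^esub>"
  by simp

lemma vs_finsum_infinite: "infinite A \<Longrightarrow> finsum M g A = \<zero>\<^bsub>M\<^esub>"
  by (rule M.finsum_infinite)

lemma vs_finsum_cong: "(\<And>i. i \<in> A \<Longrightarrow> f i = g i) \<Longrightarrow> (\<And>i. i \<in> A \<Longrightarrow> g i \<in> carrier M) \<Longrightarrow>
    finsum M f A = finsum M g A"
  by (rule M.finsum_cong') auto

lemma vs_finsum_add: "(\<And>i. i \<in> A \<Longrightarrow> f i \<in> carrier M) \<Longrightarrow> (\<And>i. i \<in> A \<Longrightarrow> g i \<in> carrier M) \<Longrightarrow>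
    finsum M (\<lambda>i. f i \<oplus>\<^bsub>M\<^esub> g i) A = finsum M f A \<oplus>\<^bsub>M\<^esub> finsum M g A"
  by (rule M.finsum_addf) auto

lemma vs_finsum_mono: "finite B \<Longrightarrow> A \<subseteq> B \<Longrightarrow> (\<And>i. i \<in> B - A \<Longrightarrow> g i = \<zero>\<^bsub>M\<^esub>) \<Longrightarrow>
    (\<And>i. i \<in> A \<Longrightarrow> g i \<in> carrier M) \<Longrightarrow> finsum M g A = finsum M g B"
  by (rule M.add.finprod_mono_neutral_cong_left) (auto, metis DiffI vs_zero)

lemma vspace_subsp:
  assumes N: "subsp M N"
  shows "vspace (M\<lparr>carrier := N\<rparr>)"
proof (rule vspaceI)
  fix x assume "x \<in> carrier (M\<lparr>carrier := N\<rparr>)"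
  then show "\<exists>y\<in>carrier (M\<lparr>carrier := N\<rparr>). x \<oplus>\<^bsub>M\<lparr>carrier := N\<rparr>\<^esub> y = \<zero>\<^bsub>M\<lparr>carrier := N\<rparr>\<^esub>"
    using N vs_add_neg[of x] vs_neg_eq[of x] by (intro bexI[of _ "(- 1) \<odot>\<^bsub>M\<^esub> x"]) (auto simp: subsp_def)
qed (use N in \<open>auto simp: subsp_def subset_iff vs_assoc vs_mult_smult vs_add_smult vs_smult_add intro: vs_comm\<close>)

end

lemma span_subset_carrier: "vspace M \<Longrightarrow> S \<subseteq> carrier M \<Longrightarrow> span_in M S \<subseteq> carrier M"
  using subsp_span[of M S] by (simp add: subsp_def)

lemma span_mono: "vspace M \<Longrightarrow> R \<subseteq> carrier M \<Longrightarrow> S \<subseteq> R \<Longrightarrow> span_in M S \<subseteq> span_in M R"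
  by (intro span_least subsp_span) (auto intro: span_superset)

lemma subsp_carrier_D: "subsp M N \<Longrightarrow> x \<in> N \<Longrightarrow> x \<in> carrier M"
  by (auto simp: subsp_def)

lemma subsp_neg: "vspace M \<Longrightarrow> subsp M N \<Longrightarrow> x \<in> N \<Longrightarrow> \<ominus>\<^bsub>M\<^esub> x \<in> N"
  by (simp add: vs_neg_eq subsp_carrier_D) (simp add: subsp_def)

lemma subsp_sub: "subsp M N \<Longrightarrow> subsp (M\<lparr>carrier := N\<rparr>) P \<longleftrightarrow> subsp M P \<and> P \<subseteq> N"
  by (auto simp: subsp_def)

lemma span_sub:
  assumes M: "vspace M" and N: "subsp M N" and S: "S \<subseteq> N"
  shows "span_in (M\<lparr>carrier := N\<rparr>) S = span_in M S"
proof -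
  have S': "S \<subseteq> carrier M" using N S by (auto simp: subsp_def)
  have MN: "vspace (M\<lparr>carrier := N\<rparr>)" by (rule vspace_subsp[OF M N])
  show ?thesis
  proof (rule antisym)
    show "span_in (M\<lparr>carrier := N\<rparr>) S \<subseteq> span_in M S"
      using span_least[OF M N S] subsp_span[OF M S'] span_superset[OF M S']
      by (intro span_least[OF MN]) (auto simp: subsp_sub[OF N])
    have "subsp (M\<lparr>carrier := N\<rparr>) (span_in (M\<lparr>carrier := N\<rparr>) S)"
      using S by (intro subsp_span[OF MN]) auto
    then show "span_in M S \<subseteq> span_in (M\<lparr>carrier := N\<rparr>) S"
      using S span_superset[OF MN, of S] by (intro span_least[OF M]) (auto simp: subsp_sub[OF N])
  qed
qed

lemma linmap_closed: "linmap M N f \<Longrightarrow> x \<in> carrier M \<Longrightarrow> f x \<in> carrier N"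
  and linmap_add: "linmap M N f \<Longrightarrow> x \<in> carrier M \<Longrightarrow> y \<in> carrier M \<Longrightarrow> f (x \<oplus>\<^bsub>M\<^esub> y) = f x \<oplus>\<^bsub>N\<^esub> f y"
  and linmap_smult: "linmap M N f \<Longrightarrow> x \<in> carrier M \<Longrightarrow> f (c \<odot>\<^bsub>M\<^esub> x) = c \<odot>\<^bsub>N\<^esub> f x"
  by (auto simp: linmap_def)

lemma linmapI:
  assumes "\<And>x. x \<in> carrier M \<Longrightarrow> f x \<in> carrier N"
    and "\<And>x y. x \<in> carrier M \<Longrightarrow> y \<in> carrier M \<Longrightarrow> f (x \<oplus>\<^bsub>M\<^esub> y) = f x \<oplus>\<^bsub>N\<^esub> f y"
    and "\<And>c x. x \<in> carrier M \<Longrightarrow> f (c \<odot>\<^bsub>M\<^esub> x) = c \<odot>\<^bsub>N\<^esub> f x"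
  shows "linmap M N f"
  using assms by (auto simp: linmap_def)

lemma linmap_zero: "vspace M \<Longrightarrow> vspace N \<Longrightarrow> linmap M N f \<Longrightarrow> f \<zero>\<^bsub>M\<^esub> = \<zero>\<^bsub>N\<^esub>"
  using linmap_smult[of M N f "\<zero>\<^bsub>M\<^esub>" 0] linmap_closed[of M N f "\<zero>\<^bsub>M\<^esub>"] by simp

lemma linmap_neg: "vspace M \<Longrightarrow> vspace N \<Longrightarrow> linmap M N f \<Longrightarrow> x \<in> carrier M \<Longrightarrow> f (\<ominus>\<^bsub>M\<^esub> x) = \<ominus>\<^bsub>N\<^esub> f x"
  by (simp add: vs_neg_eq linmap_smult linmap_closed)

lemma linmap_minus: "vspace M \<Longrightarrow> vspace N \<Longrightarrow> linmap M N f \<Longrightarrow> x \<in> carrier M \<Longrightarrow> y \<in> carrier M \<Longrightarrow>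
    f (x \<ominus>\<^bsub>M\<^esub> y) = f x \<ominus>\<^bsub>N\<^esub> f y"
  by (simp add: vs_minus_eq linmap_neg linmap_add)

lemma linmap_cong: "vspace M \<Longrightarrow> (\<And>x. x \<in> carrier M \<Longrightarrow> f x = g x) \<Longrightarrow> linmap M N f \<longleftrightarrow> linmap M N g"
  by (auto simp: linmap_def)

lemma linmap_comp: "linmap M N f \<Longrightarrow> linmap N K g \<Longrightarrow> linmap M K (\<lambda>x. g (f x))"
  by (auto simp: linmap_def)

lemma linmap_into_sub: "subsp N P \<Longrightarrow> linmap M (N\<lparr>carrier := P\<rparr>) f \<longleftrightarrow> linmap M N f \<and> (\<forall>x\<in>carrier M. f x \<in> P)"
  by (auto simp: linmap_def subsp_def)

lemma linmap_from_sub: "subsp M P \<Longrightarrow> linmap M N f \<Longrightarrow> linmap (M\<lparr>carrier := P\<rparr>) N f"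
  by (auto simp: linmap_def subsp_def subset_iff)

lemma linmap_finsum:
  assumes M: "vspace M" and N: "vspace N" and f: "linmap M N f"
    and g: "\<And>i. i \<in> A \<Longrightarrow> g i \<in> carrier M"
  shows "f (finsum M g A) = finsum N (\<lambda>i. f (g i)) A"
  using g
proof (induction A rule: infinite_finite_induct)
  case (insert x F)
  then show ?case
    by (simp add: vs_finsum_insert[OF M] vs_finsum_insert[OF N] linmap_closed[OF f] linmap_add[OF f]
          vs_finsum_closed[OF M])
qed (simp_all add: vs_finsum_infinite[OF M] vs_finsum_infinite[OF N] vs_finsum_empty[OF M]
       vs_finsum_empty[OF N] linmap_zero[OF M N f])

lemma finsum_sub:
  assumes M: "vspace M" and N: "subsp M N" and g: "\<And>i. i \<in> A \<Longrightarrow> g i \<in> N"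
  shows "finsum (M\<lparr>carrier := N\<rparr>) g A = finsum M g A"
  using linmap_finsum[OF vspace_subsp[OF M N] M, of "\<lambda>x. x" A g] g N
  by (auto simp: linmap_def subsp_def)

lemma subsp_preimage:
  assumes M: "vspace M" and N: "vspace N" and f: "linmap M N f" and P: "subsp N P"
  shows "subsp M {x \<in> carrier M. f x \<in> P}"
  using assms by (auto simp: subsp_def linmap_add linmap_smult linmap_zero)

text \<open>The preimage of a subspace is a subspace, so membership in \<open>P\<close> can be tested on a spanning set.\<close>
lemma linmap_span_into:
  assumes M: "vspace M" and N: "vspace N" and f: "linmap M N f" and P: "subsp N P"
    and S: "S \<subseteq> carrier M" "\<And>s. s \<in> S \<Longrightarrow> f s \<in> P" and x: "x \<in> span_in M S"
  shows "f x \<in> P"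
  using span_least[OF M subsp_preimage[OF M N f P], of S] S x by auto

lemma subsp_equalizer:
  assumes "vspace M" "vspace N" "linmap M N f" "linmap M N g"
  shows "subsp M {x \<in> carrier M. f x = g x}"
  using assms by (auto simp: subsp_def linmap_add linmap_smult linmap_zero)

lemma linmap_eq_on_span:
  assumes "vspace M" "vspace N" "linmap M N f" "linmap M N g" "S \<subseteq> carrier M"
    and "\<And>s. s \<in> S \<Longrightarrow> f s = g s" "x \<in> span_in M S"
  shows "f x = g x"
  using span_least[OF assms(1) subsp_equalizer[OF assms(1-4)], of S] assms(5-7) by auto

lemma lin_iff: "f \<in> lin M N \<longleftrightarrow> linmap M N f \<and> f \<in> extensional (carrier M)"
  by (auto simp: lin_def LinearCombinations.module_hom_def linmap_def)

lemma lin_linmap: "f \<in> lin M N \<Longrightarrow> linmap M N f"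
  by (simp add: lin_iff)

lemma lin_restrict: "vspace M \<Longrightarrow> linmap M N f \<Longrightarrow> restrict f (carrier M) \<in> lin M N"
  by (auto simp: lin_iff linmap_def)

text \<open>
  Members of \<open>lin\<close> are \<open>undefined\<close> off the carrier; agreement on a spanning set is therefore equality of
  functions, as the definite descriptions in \<open>the_lin\<close> require.
\<close>
lemma lin_eqI:
  assumes "vspace M" "vspace N" "f \<in> lin M N" "g \<in> lin M N"
    and "S \<subseteq> carrier M" "carrier M \<subseteq> span_in M S" "\<And>s. s \<in> S \<Longrightarrow> f s = g s"
  shows "f = g"
proof
  fix x
  show "f x = g x"
  proof (cases "x \<in> carrier M")
    case True
    then show ?thesis
      using assms by (intro linmap_eq_on_span[of M N f g S x]) (auto simp: lin_iff)
  next
    case False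
    then show ?thesis using assms(3,4) by (simp add: lin_iff extensional_def)
  qed
qed

lemma the_lin_eqI:
  assumes "g \<in> lin M N" "P g" "\<And>f. f \<in> lin M N \<Longrightarrow> P f \<Longrightarrow> f = g"
  shows "the_lin M N P = g"
  unfolding the_lin_def using assms by (intro the_equality) blast+

lemma scalars_simps [simp]:
  "carrier (scalars :: ('k::field, 'k) module) = UNIV"
  "x \<oplus>\<^bsub>scalars\<^esub> y = x + y" "c \<odot>\<^bsub>scalars\<^esub> x = c * x" "\<zero>\<^bsub>scalars\<^esub> = 0"
  by (simp_all add: scalars_def)

lemma vspace_scalars [simp]: "vspace (scalars :: ('k::field, 'k) module)"
proof (rule vspaceI)
  fix x :: 'k
  show "\<exists>y\<in>carrier scalars. x \<oplus>\<^bsub>scalars\<^esub> y = \<zero>\<^bsub>scalars\<^esub>"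
    by (rule bexI[of _ "- x"]) simp_all
qed (simp_all add: algebra_simps)

lemma neg_scalars [simp]: "\<ominus>\<^bsub>scalars\<^esub> x = - x" "x \<ominus>\<^bsub>scalars\<^esub> y = x - y"
  by (simp_all add: vs_neg_eq vs_minus_eq)

lemma finsum_scalars: "finsum scalars g A = sum g A"
  by (induction A rule: infinite_finite_induct)
    (simp_all add: vs_finsum_infinite vs_finsum_empty vs_finsum_insert)

lemma linmap_sum:
  assumes "vspace M" "linmap M scalars f" "\<And>i. i \<in> A \<Longrightarrow> g i \<in> carrier M"
  shows "f (finsum M g A) = (\<Sum>i\<in>A. f (g i))"
  using linmap_finsum[OF assms(1) _ assms(2,3)] by (simp add: finsum_scalars)

section \<open>The dual space\<close>

lemma dual_simps:
  "carrier (dual M) = lin M scalars"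
  "f \<oplus>\<^bsub>dual M\<^esub> g = (\<lambda>x\<in>carrier M. f x + g x)"
  "c \<odot>\<^bsub>dual M\<^esub> f = (\<lambda>x\<in>carrier M. c * f x)"
  "\<zero>\<^bsub>dual M\<^esub> = (\<lambda>x\<in>carrier M. 0)"
  by (simp_all add: dual_def class_ring.func_space_def)

lemma vspace_dual:
  assumes M: "vspace M"
  shows "vspace (dual M)"
proof (rule vspaceI)
  fix f assume f: "f \<in> carrier (dual M)"
  show "\<exists>g\<in>carrier (dual M). f \<oplus>\<^bsub>dual M\<^esub> g = \<zero>\<^bsub>dual M\<^esub>"
    using f M by (intro bexI[of _ "\<lambda>x\<in>carrier M. - f x"])
      (auto simp: dual_simps lin_iff linmap_def intro!: restrict_ext)
qed (use M in \<open>auto simp: dual_simps lin_iff linmap_def algebra_simps fun_eq_iff restrict_def extensional_def\<close>)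

lemma linmap_dual_eval:
  assumes "linmap M (dual N) F" "y \<in> carrier N"
  shows "linmap M scalars (\<lambda>x. F x y)"
  using assms by (auto simp: linmap_def dual_simps)

section \<open>Quotient spaces\<close>

lemma quot_simps:
  "carrier (quot M N) = (\<lambda>x. N +>\<^bsub>M\<^esub> x) ` carrier M"
  "X \<oplus>\<^bsub>quot M N\<^esub> Y = X <+>\<^bsub>M\<^esub> Y"
  "c \<odot>\<^bsub>quot M N\<^esub> X = (\<Union>x\<in>X. N +>\<^bsub>M\<^esub> (c \<odot>\<^bsub>M\<^esub> x))"
  "\<zero>\<^bsub>quot M N\<^esub> = N"
  "X \<otimes>\<^bsub>quot M N\<^esub> Y = rcoset_mult M N X Y"
  "\<one>\<^bsub>quot M N\<^esub> = N +>\<^bsub>M\<^esub> \<one>\<^bsub>M\<^esub>"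
  by (auto simp: quot_def FactRing_def ring.defs module.defs A_RCOSETS_def' image_def)

context
  fixes M :: "('k::field, 'a) module" and N :: "'a set"
  assumes M: "vspace M" and N: "subsp M N"
begin

interpretation vectorspace class_ring M by (rule M)

lemma subsp_abelian_subgroup: "abelian_subgroup N M"
proof (rule abelian_subgroupI3)
  show "additive_subgroup N M"
    using N subsp_neg[OF M N]
    by (intro additive_subgroupI M.add.subgroupI) (auto simp: subsp_def a_inv_def)
  show "abelian_group M" by unfold_locales
qed

interpretation N: abelian_subgroup N M by (rule subsp_abelian_subgroup)

lemma coset_eq_iff:
  assumes x: "x \<in> carrier M" and y: "y \<in> carrier M"
  shows "N +>\<^bsub>M\<^esub> x = N +>\<^bsub>M\<^esub> y \<longleftrightarrow> x \<ominus>\<^bsub>M\<^esub> y \<in> N"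
proof
  assume "N +>\<^bsub>M\<^esub> x = N +>\<^bsub>M\<^esub> y"
  then have "x \<in> N +>\<^bsub>M\<^esub> y" using N.a_rcos_self[OF x] by simp
  then obtain n where n: "n \<in> N" "x = n \<oplus>\<^bsub>M\<^esub> y" by (auto simp: a_r_coset_def')
  then have "x \<ominus>\<^bsub>M\<^esub> y = n"
    using y subsp_carrier_D[OF N n(1)] vs_add_minus_cancel[OF M] by simp
  then show "x \<ominus>\<^bsub>M\<^esub> y \<in> N" using n by simp
next
  assume d: "x \<ominus>\<^bsub>M\<^esub> y \<in> N"
  have "(x \<ominus>\<^bsub>M\<^esub> y) \<oplus>\<^bsub>M\<^esub> y = x"
    by (rule vs_minus_add_cancel[OF M x y])
  then have "x \<in> N +>\<^bsub>M\<^esub> y" using d unfolding a_r_coset_def' by (metis UN_I singletonI)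
  then show "N +>\<^bsub>M\<^esub> x = N +>\<^bsub>M\<^esub> y"
    using M.a_repr_independence[of x N y] N.a_subgroup y by simp
qed

lemma coset_carrier: "x \<in> carrier M \<Longrightarrow> N +>\<^bsub>M\<^esub> x \<in> carrier (quot M N)"
  by (simp add: quot_simps)

lemma coset_add: "x \<in> carrier M \<Longrightarrow> y \<in> carrier M \<Longrightarrow>
    (N +>\<^bsub>M\<^esub> x) \<oplus>\<^bsub>quot M N\<^esub> (N +>\<^bsub>M\<^esub> y) = N +>\<^bsub>M\<^esub> (x \<oplus>\<^bsub>M\<^esub> y)"
  by (simp add: quot_simps N.a_rcos_sum)

lemma coset_smult:
  assumes x: "x \<in> carrier M"
  shows "c \<odot>\<^bsub>quot M N\<^esub> (N +>\<^bsub>M\<^esub> x) = N +>\<^bsub>M\<^esub> (c \<odot>\<^bsub>M\<^esub> x)"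
proof -
  have "N +>\<^bsub>M\<^esub> (c \<odot>\<^bsub>M\<^esub> y) = N +>\<^bsub>M\<^esub> (c \<odot>\<^bsub>M\<^esub> x)" if yx: "y \<in> N +>\<^bsub>M\<^esub> x" for y
  proof -
    obtain n where n: "n \<in> N" "y = n \<oplus>\<^bsub>M\<^esub> x"
      using yx unfolding a_r_coset_def' by blast
    have nc: "n \<in> carrier M" by (rule subsp_carrier_D[OF N n(1)])
    have "c \<odot>\<^bsub>M\<^esub> y \<ominus>\<^bsub>M\<^esub> c \<odot>\<^bsub>M\<^esub> x = c \<odot>\<^bsub>M\<^esub> n"
      using vs_add_minus_cancel[OF M vs_smult[OF M nc] vs_smult[OF M x], of c c]
        vs_smult_add[OF M nc x, of c] by (simp only: n(2))
    moreover have "c \<odot>\<^bsub>M\<^esub> n \<in> N" using N n(1) unfolding subsp_def by blast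
    moreover have "y \<in> carrier M" unfolding n(2) by (rule vs_add[OF M nc x])
    ultimately show ?thesis
      by (subst coset_eq_iff) (simp_all only: vs_smult[OF M] x)
  qed
  then show ?thesis
    unfolding quot_simps(3) using N.a_rcos_self[OF x] by (intro SUP_eq_const) blast+
qed

lemma coset_zero: "N +>\<^bsub>M\<^esub> \<zero>\<^bsub>M\<^esub> = \<zero>\<^bsub>quot M N\<^esub>"
  using M.a_coset_add_zero[OF N.a_subset] by (simp add: quot_simps)

lemma coset_eq_zero_iff: "x \<in> carrier M \<Longrightarrow> N +>\<^bsub>M\<^esub> x = \<zero>\<^bsub>quot M N\<^esub> \<longleftrightarrow> x \<in> N"
  using coset_eq_iff[of x "\<zero>\<^bsub>M\<^esub>"] by (simp add: coset_zero M vs_minus_eq_smult[OF M])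

lemma quot_cases:
  assumes "X \<in> carrier (quot M N)"
  obtains x where "x \<in> carrier M" "X = N +>\<^bsub>M\<^esub> x"
  using assms by (auto simp: quot_simps)

lemma vspace_quot: "vspace (quot M N)"
proof (rule vspaceI)
  show "\<zero>\<^bsub>quot M N\<^esub> \<in> carrier (quot M N)"
    using coset_carrier[of "\<zero>\<^bsub>M\<^esub>"] by (simp add: coset_zero M)
next
  fix X assume "X \<in> carrier (quot M N)"
  then obtain x where x: "x \<in> carrier M" "X = N +>\<^bsub>M\<^esub> x" by (rule quot_cases)
  then show "\<exists>Y\<in>carrier (quot M N). X \<oplus>\<^bsub>quot M N\<^esub> Y = \<zero>\<^bsub>quot M N\<^esub>"
    by (intro bexI[of _ "N +>\<^bsub>M\<^esub> (\<ominus>\<^bsub>M\<^esub> x)"]) (simp_all add: coset_add coset_carrier M coset_zero)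
  show "\<zero>\<^bsub>quot M N\<^esub> \<oplus>\<^bsub>quot M N\<^esub> X = X"
    using x by (simp add: coset_zero[symmetric] coset_add M)
qed (elim quot_cases; simp add: coset_add coset_smult coset_carrier M vs_assoc[OF M] vs_comm[OF M]
      vs_lcomm[OF M] vs_mult_smult[OF M] vs_add_smult[OF M] vs_smult_add[OF M])+

lemma linmap_coset: "linmap M (quot M N) (\<lambda>x. N +>\<^bsub>M\<^esub> x)"
  by (rule linmapI) (simp_all add: coset_add coset_smult coset_carrier)

text \<open>The value at a coset is read off at an arbitrary representative, since \<open>g\<close> is constant on cosets.\<close>
lemma quot_lift:
  assumes K: "vspace K" and g: "linmap M K g" and van: "\<And>n. n \<in> N \<Longrightarrow> g n = \<zero>\<^bsub>K\<^esub>"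
  shows "\<exists>h\<in>lin (quot M N) K. \<forall>x\<in>carrier M. h (N +>\<^bsub>M\<^esub> x) = g x"
proof -
  define h where "h = (\<lambda>X\<in>carrier (quot M N). g (SOME x. x \<in> carrier M \<and> X = N +>\<^bsub>M\<^esub> x))"
  have h: "h (N +>\<^bsub>M\<^esub> x) = g x" if x: "x \<in> carrier M" for x
  proof -
    define y where "y = (SOME y. y \<in> carrier M \<and> N +>\<^bsub>M\<^esub> x = N +>\<^bsub>M\<^esub> y)"
    have y: "y \<in> carrier M \<and> N +>\<^bsub>M\<^esub> x = N +>\<^bsub>M\<^esub> y"
      unfolding y_def by (rule someI_ex) (use x in blast)
    then have "x \<ominus>\<^bsub>M\<^esub> y \<in> N" using coset_eq_iff x by blast
    then have "g x \<ominus>\<^bsub>K\<^esub> g y = \<zero>\<^bsub>K\<^esub>" using van x y linmap_minus[OF M K g, of x y] by simp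
    then have "g x = g y" using x y by (simp add: vs_minus_zero_iff[OF K] linmap_closed[OF g])
    then show ?thesis using x by (simp add: h_def coset_carrier y_def)
  qed
  have "linmap (quot M N) K h"
    by (rule linmapI; elim quot_cases; simp add: coset_add coset_smult h M linmap_closed[OF g]
          linmap_add[OF g] linmap_smult[OF g])
  then have "h \<in> lin (quot M N) K" by (auto simp: lin_iff h_def)
  then show ?thesis using h by blast
qed

end

section \<open>Free spaces\<close>

lemma lookup_map_mult:
  "Poly_Mapping.lookup (Poly_Mapping.map ((*) c) x) s = c * Poly_Mapping.lookup x (s :: 's) "
  for x :: "'s \<Rightarrow>\<^sub>0 'k::field"
  by (simp add: Poly_Mapping.map.rep_eq when_def)

lemma map_mult_single: "Poly_Mapping.map ((*) c) (Poly_Mapping.single s d) = Poly_Mapping.single s (c * d)"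
  for d :: "'k::field"
  by (rule poly_mapping_eqI) (simp add: lookup_map_mult lookup_single when_def)

lemma map_mult_add: "Poly_Mapping.map ((*) c) (x + y) = Poly_Mapping.map ((*) c) x + Poly_Mapping.map ((*) c) y"
  for c :: "'k::field"
  by (rule poly_mapping_eqI) (simp add: lookup_map_mult lookup_add algebra_simps)

lemma keys_map_mult: "Poly_Mapping.keys (Poly_Mapping.map ((*) c) x) \<subseteq> Poly_Mapping.keys x"
  for c :: "'k::field"
  by (auto simp: in_keys_iff lookup_map_mult)

lemma free_space_simps:
  "carrier (free_space S :: ('k::field, _) module) = {x. Poly_Mapping.keys x \<subseteq> S}"
  "x \<oplus>\<^bsub>free_space S :: ('k, _) module\<^esub> y = x + y"
  "c \<odot>\<^bsub>free_space S :: ('k, _) module\<^esub> x = Poly_Mapping.map ((*) c) x"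
  "\<zero>\<^bsub>free_space S :: ('k, _) module\<^esub> = 0"
  by (simp_all add: free_space_def)

lemma vspace_free: "vspace (free_space S :: ('k::field, 's \<Rightarrow>\<^sub>0 'k) module)"
proof (rule vspaceI; (simp only: free_space_simps mem_Collect_eq)?)
  fix x y :: "'s \<Rightarrow>\<^sub>0 'k" and c d :: 'k assume x: "Poly_Mapping.keys x \<subseteq> S" and y: "Poly_Mapping.keys y \<subseteq> S"
  show "Poly_Mapping.keys (x + y) \<subseteq> S" using x y keys_add[of x y] by auto
next
  fix x :: "'s \<Rightarrow>\<^sub>0 'k" and c :: 'k assume x: "Poly_Mapping.keys x \<subseteq> S"
  show "\<exists>y\<in>{x. Poly_Mapping.keys x \<subseteq> S}. x + y = 0" by (rule bexI[of _ "- x"]) (use x in auto)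
  show "Poly_Mapping.keys (Poly_Mapping.map ((*) c) x) \<subseteq> S" using keys_map_mult[of c x] x by auto
qed (auto simp: algebra_simps intro!: poly_mapping_eqI simp: lookup_map_mult lookup_add)

lemma neg_free: "x \<in> carrier (free_space S) \<Longrightarrow> \<ominus>\<^bsub>free_space S\<^esub> x = - (x :: 's \<Rightarrow>\<^sub>0 'k::field)"
  by (rule vs_neg_unique[OF vspace_free]) (auto simp: free_space_simps)

lemma minus_free: "x \<in> carrier (free_space S) \<Longrightarrow> y \<in> carrier (free_space S) \<Longrightarrow>
    x \<ominus>\<^bsub>free_space S\<^esub> y = x - (y :: 's \<Rightarrow>\<^sub>0 'k::field)"
  by (simp add: vs_minus_eq[OF vspace_free] neg_free) (simp add: free_space_simps)

lemma finsum_free: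
  assumes "\<And>i. i \<in> A \<Longrightarrow> g i \<in> carrier (free_space S)"
  shows "finsum (free_space S) g A = (\<Sum>i\<in>A. g i :: 's \<Rightarrow>\<^sub>0 'k::field)"
  using assms
  by (induction A rule: infinite_finite_induct)
    (auto simp: vs_finsum_infinite[OF vspace_free] vs_finsum_empty[OF vspace_free]
      vs_finsum_insert[OF vspace_free] free_space_simps)

lemma poly_mapping_sum_singles:
  "x = (\<Sum>s\<in>Poly_Mapping.keys x. Poly_Mapping.single s (Poly_Mapping.lookup x s))"
  for x :: "'s \<Rightarrow>\<^sub>0 'k::field"
  by (rule poly_mapping_eqI) (auto simp: lookup_sum lookup_single when_def sum.delta' in_keys_iff)

lemma single_free [simp]: "s \<in> S \<Longrightarrow> Poly_Mapping.single s c \<in> carrier (free_space S)"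
  by (auto simp: free_space_simps)

lemma span_free:
  assumes "x \<in> carrier (free_space S)"
  shows "x \<in> span_in (free_space S) ((\<lambda>s. Poly_Mapping.single s (1 :: 'k::field)) ` S)"
proof -
  let ?F = "free_space S :: ('k, _) module"
  let ?B = "(\<lambda>s. Poly_Mapping.single s (1 :: 'k)) ` S"
  have B: "?B \<subseteq> carrier ?F" by auto
  have "Poly_Mapping.single s (Poly_Mapping.lookup x s) \<in> span_in ?F ?B" if "s \<in> Poly_Mapping.keys x" for s
  proof -
    have "Poly_Mapping.lookup x s \<odot>\<^bsub>?F\<^esub> Poly_Mapping.single s 1 \<in> span_in ?F ?B"
      using subsp_span[OF vspace_free B] span_superset[OF vspace_free B, of "Poly_Mapping.single s 1"] that assms
      unfolding subsp_def by (auto simp: free_space_simps(1))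
    then show ?thesis by (simp add: free_space_simps map_mult_single)
  qed
  then have "finsum ?F (\<lambda>s. Poly_Mapping.single s (Poly_Mapping.lookup x s)) (Poly_Mapping.keys x) \<in> span_in ?F ?B"
    by (rule finsum_in_subsp[OF vspace_free subsp_span[OF vspace_free B]])
  then show ?thesis
    using assms poly_mapping_sum_singles[of x] by (subst (asm) finsum_free) (auto simp: free_space_simps)
qed

lemma free_lift:
  fixes K :: "('k::field, 'b) module"
  assumes K: "vspace K" and phi: "\<And>s. s \<in> S \<Longrightarrow> \<phi> s \<in> carrier K"
  shows "\<exists>g. linmap (free_space S) K g \<and> (\<forall>s\<in>S. \<forall>c. g (Poly_Mapping.single s c) = c \<odot>\<^bsub>K\<^esub> \<phi> s)"
proof -
  define g where "g x = finsum K (\<lambda>s. Poly_Mapping.lookup x s \<odot>\<^bsub>K\<^esub> \<phi> s) (Poly_Mapping.keys x)"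
    for x :: "'a \<Rightarrow>\<^sub>0 'k"
  have ext: "g x = finsum K (\<lambda>s. Poly_Mapping.lookup x s \<odot>\<^bsub>K\<^esub> \<phi> s) A"
    if "finite A" "Poly_Mapping.keys x \<subseteq> A" "A \<subseteq> S" for x A
    unfolding g_def using that phi by (intro vs_finsum_mono[OF K]) (auto simp: K in_keys_iff subset_iff intro!: vs_smult[OF K])
  have "linmap (free_space S) K g"
  proof (rule linmapI; (simp only: free_space_simps mem_Collect_eq)?)
    fix x y :: "'a \<Rightarrow>\<^sub>0 'k" assume x: "Poly_Mapping.keys x \<subseteq> S" and y: "Poly_Mapping.keys y \<subseteq> S"
    let ?A = "Poly_Mapping.keys x \<union> Poly_Mapping.keys y"
    have "g (x + y) = finsum K (\<lambda>s. Poly_Mapping.lookup (x + y) s \<odot>\<^bsub>K\<^esub> \<phi> s) ?A"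
      using x y keys_add[of x y] by (intro ext) auto
    also have "\<dots> = finsum K (\<lambda>s. Poly_Mapping.lookup x s \<odot>\<^bsub>K\<^esub> \<phi> s \<oplus>\<^bsub>K\<^esub> Poly_Mapping.lookup y s \<odot>\<^bsub>K\<^esub> \<phi> s) ?A"
      using x y phi by (intro vs_finsum_cong[OF K]) (auto simp: lookup_add vs_add_smult[OF K] K subset_iff)
    also have "\<dots> = g x \<oplus>\<^bsub>K\<^esub> g y"
      using x y phi ext[of ?A x] ext[of ?A y] by (subst vs_finsum_add[OF K]) (auto simp: K subset_iff)
    finally show "g (x + y) = g x \<oplus>\<^bsub>K\<^esub> g y" .
  next
    fix c and x :: "'a \<Rightarrow>\<^sub>0 'k" assume x: "Poly_Mapping.keys x \<subseteq> S"
    show "g x \<in> carrier K" unfolding g_def using x phi by (intro vs_finsum_closed[OF K]) (auto simp: K)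
    have "g (Poly_Mapping.map ((*) c) x) = finsum K (\<lambda>s. c \<odot>\<^bsub>K\<^esub> (Poly_Mapping.lookup x s \<odot>\<^bsub>K\<^esub> \<phi> s)) (Poly_Mapping.keys x)"
      using x phi keys_map_mult[of c x]
      by (subst ext[of "Poly_Mapping.keys x"]) (auto intro!: vs_finsum_cong[OF K] simp: lookup_map_mult vs_mult_smult[OF K] K subset_iff)
    also have "\<dots> = c \<odot>\<^bsub>K\<^esub> g x"
      unfolding g_def using x phi
      by (intro linmap_finsum[OF K K, symmetric]) (auto simp: linmap_def K vs_smult_add[OF K] vs_mult_smult[OF K, symmetric] mult.commute subset_iff)
    finally show "g (Poly_Mapping.map ((*) c) x) = c \<odot>\<^bsub>K\<^esub> g x" .
  qed
  moreover have "g (Poly_Mapping.single s c) = c \<odot>\<^bsub>K\<^esub> \<phi> s" if "s \<in> S" for s c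
    using that phi[OF that] ext[of "{s}" "Poly_Mapping.single s c"]
      vs_finsum_insert[OF K, of "{}" s "\<lambda>s'. Poly_Mapping.lookup (Poly_Mapping.single s c) s' \<odot>\<^bsub>K\<^esub> \<phi> s'"]
    by (simp add: vs_finsum_empty[OF K] K)
  ultimately show ?thesis by blast
qed

section \<open>Vector spaces presented by generators and relations\<close>

text \<open>
  Tensor products and tensor powers are both quotients of a free space by the span of relations between
  its generators.
\<close>
context
  fixes S :: "'s set" and R :: "('s \<Rightarrow>\<^sub>0 'k::field) set"
    and F :: "('k, 's \<Rightarrow>\<^sub>0 'k) module"
    and Q :: "('k, ('s \<Rightarrow>\<^sub>0 'k) set) module" and cl :: "'s \<Rightarrow> ('s \<Rightarrow>\<^sub>0 'k) set"
  assumes R: "R \<subseteq> carrier (free_space S)"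
  defines "F \<equiv> free_space S"
    and "Q \<equiv> quot F (span_in F R)"
    and "cl \<equiv> \<lambda>s. span_in F R +>\<^bsub>F\<^esub> Poly_Mapping.single s 1"
begin

lemma subsp_rels: "subsp F (span_in F R)"
  unfolding F_def by (rule subsp_span[OF vspace_free R])

lemma vspace_presented: "vspace Q"
  unfolding Q_def F_def by (rule vspace_quot[OF vspace_free subsp_rels[unfolded F_def]])

lemma linmap_presented: "linmap F Q (\<lambda>x. span_in F R +>\<^bsub>F\<^esub> x)"
  unfolding Q_def F_def by (rule linmap_coset[OF vspace_free subsp_rels[unfolded F_def]])

lemma presented_closed: "s \<in> S \<Longrightarrow> cl s \<in> carrier Q"
  unfolding cl_def by (rule linmap_closed[OF linmap_presented]) (simp add: F_def)

lemma presented_scaled: "s \<in> S \<Longrightarrow> span_in F R +>\<^bsub>F\<^esub> Poly_Mapping.single s c = c \<odot>\<^bsub>Q\<^esub> cl s"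
  using linmap_smult[OF linmap_presented, of "Poly_Mapping.single s 1" c]
  by (simp add: cl_def F_def free_space_simps map_mult_single)

lemma presented_rel: "r \<in> R \<Longrightarrow> span_in F R +>\<^bsub>F\<^esub> r = \<zero>\<^bsub>Q\<^esub>"
  using coset_eq_zero_iff[OF vspace_free subsp_rels[unfolded F_def], of r] R span_superset[OF vspace_free R]
  unfolding Q_def F_def by blast

lemma presented_minus:
  assumes "x \<in> carrier F" "y \<in> carrier F"
  shows "span_in F R +>\<^bsub>F\<^esub> (x - y) = (span_in F R +>\<^bsub>F\<^esub> x) \<ominus>\<^bsub>Q\<^esub> (span_in F R +>\<^bsub>F\<^esub> y)"
  using linmap_minus[OF _ vspace_presented linmap_presented assms] assms
  by (simp add: F_def vspace_free minus_free)

lemma presented_span: "carrier Q \<subseteq> span_in Q (cl ` S)"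
proof
  fix X assume "X \<in> carrier Q"
  then obtain x where x: "x \<in> carrier F" "X = span_in F R +>\<^bsub>F\<^esub> x"
    unfolding Q_def F_def by (rule quot_cases[OF vspace_free subsp_rels[unfolded F_def]])
  have cl: "cl ` S \<subseteq> carrier Q" by (auto intro: presented_closed)
  have "span_in F R +>\<^bsub>F\<^esub> x \<in> span_in Q (cl ` S)"
  proof (rule linmap_span_into[OF _ vspace_presented linmap_presented subsp_span[OF vspace_presented cl]])
    show "vspace F" unfolding F_def by (rule vspace_free)
    show "x \<in> span_in F ((\<lambda>s. Poly_Mapping.single s 1) ` S)"
      using x(1) unfolding F_def by (rule span_free)
    fix r assume "r \<in> (\<lambda>s. Poly_Mapping.single s (1::'k)) ` S"
    then show "span_in F R +>\<^bsub>F\<^esub> r \<in> span_in Q (cl ` S)"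
      using span_superset[OF vspace_presented cl] by (auto simp: cl_def)
  qed (auto simp: F_def)
  then show "X \<in> span_in Q (cl ` S)" using x by simp
qed

text \<open>
  The hypothesis \<open>rels\<close> quantifies over all linear maps \<open>g\<close> with the prescribed values on generators, so
  that it can be verified by linearity alone, without reference to the construction of \<open>g\<close>.
\<close>
lemma presented_lift:
  fixes K :: "('k, 'b) module"
  assumes K: "vspace K" and phi: "\<And>s. s \<in> S \<Longrightarrow> \<phi> s \<in> carrier K"
    and rels: "\<And>g r. linmap F K g \<Longrightarrow> (\<And>s c. s \<in> S \<Longrightarrow> g (Poly_Mapping.single s c) = c \<odot>\<^bsub>K\<^esub> \<phi> s) \<Longrightarrow>
      r \<in> R \<Longrightarrow> g r = \<zero>\<^bsub>K\<^esub>"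
  shows "\<exists>h\<in>lin Q K. \<forall>s\<in>S. h (cl s) = \<phi> s"
proof -
  obtain g where g: "linmap F K g" "\<And>s c. s \<in> S \<Longrightarrow> g (Poly_Mapping.single s c) = c \<odot>\<^bsub>K\<^esub> \<phi> s"
    using free_lift[where S=S and \<phi>=\<phi>, OF K phi] unfolding F_def by blast
  have F: "vspace F" unfolding F_def by (rule vspace_free)
  have "g n = \<zero>\<^bsub>K\<^esub>" if "n \<in> span_in F R" for n
  proof -
    have "subsp K {\<zero>\<^bsub>K\<^esub>}" using K by (simp add: subsp_def)
    then have "g n \<in> {\<zero>\<^bsub>K\<^esub>}"
      by (rule linmap_span_into[OF F K g(1)]) (use R rels[OF g] that in \<open>auto simp: F_def\<close>)
    then show ?thesis by simp
  qed
  from quot_lift[OF F subsp_rels K g(1) this]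
  obtain h where "h \<in> lin Q K" "\<forall>x\<in>carrier F. h (span_in F R +>\<^bsub>F\<^esub> x) = g x"
    unfolding Q_def by blast
  then show ?thesis
    using g(2) phi by (intro bexI[of _ h]) (auto simp: cl_def F_def K)
qed

end

lemma diff_free_closed [simp]:
  "x \<in> carrier (free_space S) \<Longrightarrow> y \<in> carrier (free_space S) \<Longrightarrow> x - y \<in> carrier (free_space S)"
  for x y :: "'s \<Rightarrow>\<^sub>0 'k::field"
  using vs_minus[OF vspace_free, of x S y] by (simp add: minus_free)

text \<open>
  The relations of tensor products and tensor powers have two shapes: \<open>s - t - u\<close> expresses additivity and
  \<open>s - c t\<close> homogeneity. A linear map on the free space kills such a relation as soon as its values on the
  generators satisfy the corresponding identity.
\<close>
lemma linmap_kills_additivity: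
  fixes g :: "('s \<Rightarrow>\<^sub>0 'k::field) \<Rightarrow> 'b"
  assumes K: "vspace K" and g: "linmap (free_space S) K g"
    and v: "\<And>s c. s \<in> S \<Longrightarrow> g (Poly_Mapping.single s c) = c \<odot>\<^bsub>K\<^esub> \<phi> s"
    and phi: "\<And>s. s \<in> S \<Longrightarrow> \<phi> s \<in> carrier K"
    and s: "s \<in> S" "t \<in> S" "u \<in> S" and eq: "\<phi> s = \<phi> t \<oplus>\<^bsub>K\<^esub> \<phi> u"
  shows "g (Poly_Mapping.single s 1 - Poly_Mapping.single t 1 - Poly_Mapping.single u 1) = \<zero>\<^bsub>K\<^esub>"
proof -
  let ?F = "free_space S :: ('k, _) module"
  have 1: "Poly_Mapping.single s 1 - Poly_Mapping.single t 1 - Poly_Mapping.single u 1 =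
     (Poly_Mapping.single s 1 \<ominus>\<^bsub>?F\<^esub> Poly_Mapping.single t 1) \<ominus>\<^bsub>?F\<^esub> (Poly_Mapping.single u 1 :: 's \<Rightarrow>\<^sub>0 'k)"
    using s by (simp add: minus_free)
  have "g \<dots> = (\<phi> s \<ominus>\<^bsub>K\<^esub> \<phi> t) \<ominus>\<^bsub>K\<^esub> \<phi> u"
    using s by (simp add: linmap_minus[OF vspace_free K g] vspace_free v K phi)
  also have "\<phi> s \<ominus>\<^bsub>K\<^esub> \<phi> t = \<phi> u"
    unfolding eq using s vs_add_minus_cancel[OF K, of "\<phi> u" "\<phi> t"] by (simp add: phi vs_comm[OF K])
  finally show ?thesis unfolding 1 using s by (simp add: vs_minus_zero_iff[OF K] phi)
qed

lemma linmap_kills_homogeneity: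
  fixes g :: "('s \<Rightarrow>\<^sub>0 'k::field) \<Rightarrow> 'b"
  assumes K: "vspace K" and g: "linmap (free_space S) K g"
    and v: "\<And>s c. s \<in> S \<Longrightarrow> g (Poly_Mapping.single s c) = c \<odot>\<^bsub>K\<^esub> \<phi> s"
    and phi: "\<And>s. s \<in> S \<Longrightarrow> \<phi> s \<in> carrier K"
    and s: "s \<in> S" "t \<in> S" and eq: "\<phi> s = c \<odot>\<^bsub>K\<^esub> \<phi> t"
  shows "g (Poly_Mapping.single s 1 - Poly_Mapping.single t c) = \<zero>\<^bsub>K\<^esub>"
proof -
  let ?F = "free_space S :: ('k, _) module"
  have "Poly_Mapping.single s 1 - Poly_Mapping.single t c =
     Poly_Mapping.single s 1 \<ominus>\<^bsub>?F\<^esub> Poly_Mapping.single t c"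
    using s by (simp add: minus_free)
  then show ?thesis
    using s eq by (simp add: linmap_minus[OF vspace_free K g] v K phi vs_minus_zero_iff[OF K])
qed

text \<open>
  Conversely, in the quotient the classes of the generators satisfy the identity that a relation
  expresses; this makes pure tensors multilinear.
\<close>
lemma presented_additive:
  fixes R :: "('s \<Rightarrow>\<^sub>0 'k::field) set"
  assumes R: "R \<subseteq> carrier (free_space S)" and s: "s \<in> S" "t \<in> S" "u \<in> S"
    and r: "Poly_Mapping.single s 1 - Poly_Mapping.single t 1 - Poly_Mapping.single u 1 \<in> R"
  defines "F \<equiv> free_space S :: ('k, _) module"
  defines "cl \<equiv> \<lambda>s. span_in F R +>\<^bsub>F\<^esub> Poly_Mapping.single s 1"
  shows "cl s = cl t \<oplus>\<^bsub>quot F (span_in F R)\<^esub> cl u"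
proof -
  let ?Q = "quot F (span_in F R)"
  note Q = vspace_presented[OF R, folded F_def]
  have cl: "cl a \<in> carrier ?Q" if "a \<in> S" for a
    using presented_closed[OF R that] by (simp add: F_def cl_def)
  have "\<zero>\<^bsub>?Q\<^esub> = (cl s \<ominus>\<^bsub>?Q\<^esub> cl t) \<ominus>\<^bsub>?Q\<^esub> cl u"
    using presented_rel[OF R r] s
    by (simp add: presented_minus[OF R] F_def cl_def)
  then have "cl s \<ominus>\<^bsub>?Q\<^esub> cl t = cl u"
    using s vs_minus_zero_iff[OF Q, of "cl s \<ominus>\<^bsub>?Q\<^esub> cl t" "cl u"] by (simp add: Q cl)
  then show ?thesis
    using vs_minus_add_cancel[OF Q cl[OF s(1)] cl[OF s(2)]] s by (simp add: vs_comm[OF Q] cl)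
qed

lemma presented_homogeneous:
  fixes R :: "('s \<Rightarrow>\<^sub>0 'k::field) set"
  assumes R: "R \<subseteq> carrier (free_space S)" and s: "s \<in> S" "t \<in> S"
    and r: "Poly_Mapping.single s 1 - Poly_Mapping.single t c \<in> R"
  defines "F \<equiv> free_space S :: ('k, _) module"
  defines "cl \<equiv> \<lambda>s. span_in F R +>\<^bsub>F\<^esub> Poly_Mapping.single s 1"
  shows "cl s = c \<odot>\<^bsub>quot F (span_in F R)\<^esub> cl t"
proof -
  let ?Q = "quot F (span_in F R)"
  note Q = vspace_presented[OF R, folded F_def]
  have cl: "cl a \<in> carrier ?Q" if "a \<in> S" for a
    using presented_closed[OF R that] by (simp add: F_def cl_def)
  have "\<zero>\<^bsub>?Q\<^esub> = cl s \<ominus>\<^bsub>?Q\<^esub> (c \<odot>\<^bsub>?Q\<^esub> cl t)"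
    using presented_rel[OF R r] s presented_scaled[OF R s(2), of c]
    by (simp add: presented_minus[OF R] F_def cl_def)
  then show ?thesis
    using s vs_minus_zero_iff[OF Q, of "cl s" "c \<odot>\<^bsub>?Q\<^esub> cl t"] by (simp add: Q cl)
qed

section \<open>Bilinear maps and the tensor product\<close>

definition bilin :: "('k::field, 'a) module \<Rightarrow> ('k, 'b) module \<Rightarrow> ('k, 'c) module \<Rightarrow> ('a \<Rightarrow> 'b \<Rightarrow> 'c) \<Rightarrow> bool" where
  "bilin M N K \<beta> \<longleftrightarrow> (\<forall>y\<in>carrier N. linmap M K (\<lambda>x. \<beta> x y)) \<and> (\<forall>x\<in>carrier M. linmap N K (\<beta> x))"

context
  fixes M :: "('k::field, 'a) module" and N :: "('k, 'b) module"
  assumes M: "vspace M" and N: "vspace N"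
begin

lemma tensor_rels_free: "tensor_rels M N \<subseteq> carrier (free_space (carrier M \<times> carrier N))"
  unfolding tensor_rels_def using M N by (auto intro!: diff_free_closed)

lemma vspace_tensor: "vspace (tensor M N)"
  unfolding tensor_def by (rule vspace_presented[OF tensor_rels_free])

lemma pure_tensor_closed: "x \<in> carrier M \<Longrightarrow> y \<in> carrier N \<Longrightarrow> pure_tensor M N x y \<in> carrier (tensor M N)"
  unfolding tensor_def pure_tensor_def by (rule presented_closed[OF tensor_rels_free]) simp

lemma bilin_pure_tensor: "bilin M N (tensor M N) (pure_tensor M N)"
  unfolding bilin_def
proof (intro conjI ballI linmapI pure_tensor_closed)
  fix x x' y assume "x \<in> carrier M" "x' \<in> carrier M" "y \<in> carrier N"
  then show "pure_tensor M N (x \<oplus>\<^bsub>M\<^esub> x') y = pure_tensor M N x y \<oplus>\<^bsub>tensor M N\<^esub> pure_tensor M N x' y"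
    unfolding tensor_def pure_tensor_def
    by (intro presented_additive[OF tensor_rels_free]) (simp_all add: M N, unfold tensor_rels_def, blast)
next
  fix x y y' assume "x \<in> carrier M" "y \<in> carrier N" "y' \<in> carrier N"
  then show "pure_tensor M N x (y \<oplus>\<^bsub>N\<^esub> y') = pure_tensor M N x y \<oplus>\<^bsub>tensor M N\<^esub> pure_tensor M N x y'"
    unfolding tensor_def pure_tensor_def
    by (intro presented_additive[OF tensor_rels_free]) (simp_all add: M N, unfold tensor_rels_def, blast)
next
  fix x y c assume "x \<in> carrier M" "y \<in> carrier N"
  then show "pure_tensor M N (c \<odot>\<^bsub>M\<^esub> x) y = c \<odot>\<^bsub>tensor M N\<^esub> pure_tensor M N x y"
    "pure_tensor M N x (c \<odot>\<^bsub>N\<^esub> y) = c \<odot>\<^bsub>tensor M N\<^esub> pure_tensor M N x y"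
    unfolding tensor_def pure_tensor_def
    by (intro presented_homogeneous[OF tensor_rels_free]; auto simp: M N tensor_rels_def)+
qed

lemma tensor_span: "carrier (tensor M N) \<subseteq> span_in (tensor M N) {pure_tensor M N x y | x y. x \<in> carrier M \<and> y \<in> carrier N}"
proof -
  have *: "{pure_tensor M N x y | x y. x \<in> carrier M \<and> y \<in> carrier N} =
    (\<lambda>s. span_in (free_space (carrier M \<times> carrier N)) (tensor_rels M N)
      +>\<^bsub>free_space (carrier M \<times> carrier N) :: ('k, _) module\<^esub> Poly_Mapping.single s 1) ` (carrier M \<times> carrier N)"
    unfolding pure_tensor_def by force
  show ?thesis
    unfolding * unfolding tensor_def by (rule presented_span[OF tensor_rels_free])
qed

lemma tensor_lift:
  fixes K :: "('k, 'c) module"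
  assumes K: "vspace K" and b: "bilin M N K \<beta>"
  shows "\<exists>h\<in>lin (tensor M N) K. \<forall>x\<in>carrier M. \<forall>y\<in>carrier N. h (pure_tensor M N x y) = \<beta> x y"
proof -
  let ?S = "carrier M \<times> carrier N"
  let ?\<phi> = "\<lambda>s. \<beta> (fst s) (snd s)"
  have phi: "?\<phi> s \<in> carrier K" if "s \<in> ?S" for s
    using b that by (auto simp: bilin_def linmap_def)
  have "\<exists>h\<in>lin (tensor M N) K. \<forall>s\<in>?S. h (span_in (free_space ?S) (tensor_rels M N)
      +>\<^bsub>free_space ?S :: ('k, _) module\<^esub> Poly_Mapping.single s 1) = ?\<phi> s"
    unfolding tensor_def
  proof (rule presented_lift[OF tensor_rels_free K phi])
    fix g r assume g: "linmap (free_space ?S) K g" and v: "\<And>s c. s \<in> ?S \<Longrightarrow> g (Poly_Mapping.single s c) = c \<odot>\<^bsub>K\<^esub> ?\<phi> s"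
      and "r \<in> tensor_rels M N"
    note r3 = linmap_kills_additivity[where \<phi>="?\<phi>", OF K g v phi] and r2 = linmap_kills_homogeneity[where \<phi>="?\<phi>", OF K g v phi]
    from \<open>r \<in> tensor_rels M N\<close> show "g r = \<zero>\<^bsub>K\<^esub>"
      unfolding tensor_rels_def using b
      by (elim UnE CollectE exE conjE; simp only:; intro r3 r2) (auto simp: M N bilin_def linmap_def)
  qed
  then show ?thesis by (auto simp: pure_tensor_def)
qed

lemma tensor_span_gen:
  assumes X: "X \<subseteq> carrier M" "carrier M \<subseteq> span_in M X" and Y: "Y \<subseteq> carrier N" "carrier N \<subseteq> span_in N Y"
  shows "carrier (tensor M N) \<subseteq> span_in (tensor M N) {pure_tensor M N x y | x y. x \<in> X \<and> y \<in> Y}"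
proof -
  let ?T = "tensor M N" and ?P = "{pure_tensor M N x y | x y. x \<in> X \<and> y \<in> Y}"
  have P: "?P \<subseteq> carrier ?T" using X Y by (auto intro!: pure_tensor_closed)
  note sP = subsp_span[OF vspace_tensor P]
  have 1: "pure_tensor M N x y \<in> span_in ?T ?P" if x: "x \<in> carrier M" and y: "y \<in> Y" for x y
  proof (rule linmap_span_into[OF M vspace_tensor _ sP X(1), of "\<lambda>x. pure_tensor M N x y"])
    show "linmap M ?T (\<lambda>x. pure_tensor M N x y)" using bilin_pure_tensor y Y by (auto simp: bilin_def)
    show "x \<in> span_in M X" using x X by auto
  qed (use y in \<open>auto intro!: span_superset[OF vspace_tensor P]\<close>)
  have "pure_tensor M N x y \<in> span_in ?T ?P" if x: "x \<in> carrier M" and y: "y \<in> carrier N" for x y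
  proof (rule linmap_span_into[OF N vspace_tensor _ sP Y(1), of "pure_tensor M N x"])
    show "linmap N ?T (pure_tensor M N x)" using bilin_pure_tensor x by (auto simp: bilin_def)
    show "y \<in> span_in N Y" using y Y by auto
  qed (use x 1 in auto)
  then have "span_in ?T {pure_tensor M N x y | x y. x \<in> carrier M \<and> y \<in> carrier N} \<subseteq> span_in ?T ?P"
    by (intro span_least[OF vspace_tensor sP]) auto
  then show ?thesis using tensor_span by blast
qed

end

section \<open>Multilinear maps and tensor powers\<close>

definition multilin :: "('k::field, 'a) module \<Rightarrow> nat \<Rightarrow> ('k, 'b) module \<Rightarrow> ('a list \<Rightarrow> 'b) \<Rightarrow> bool" where
  "multilin W p K \<phi> \<longleftrightarrow> (\<forall>xs\<in>tuples W p. \<phi> xs \<in> carrier K \<and> (\<forall>j<p. linmap W K (\<lambda>x. \<phi> (xs[j := x]))))"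

lemma tuples_update [simp]: "xs \<in> tuples W p \<Longrightarrow> x \<in> carrier W \<Longrightarrow> xs[j := x] \<in> tuples W p"
  by (auto simp: tuples_def dest: set_update_subset_insert[THEN subsetD])

lemma tuples_length: "xs \<in> tuples W p \<Longrightarrow> length xs = p"
  by (simp add: tuples_def)

lemma tuples_nth: "xs \<in> tuples W p \<Longrightarrow> j < p \<Longrightarrow> xs ! j \<in> carrier W"
  by (auto simp: tuples_def)

text \<open>
  The entries are treated one at a time: linearity in slot \<open>m\<close> allows an arbitrary entry there once all
  tuples with an entry from \<open>X\<close> in this slot are settled.
\<close>
lemma multilin_span_into:
  assumes W: "vspace W" and K: "vspace K" and phi: "multilin W p K \<phi>" and S: "subsp K S"
    and X: "X \<subseteq> carrier W" "carrier W \<subseteq> span_in W X"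
    and v: "\<And>xs. set xs \<subseteq> X \<Longrightarrow> length xs = p \<Longrightarrow> \<phi> xs \<in> S" and xs: "xs \<in> tuples W p"
  shows "\<phi> xs \<in> S"
proof -
  have "\<forall>xs\<in>tuples W p. (\<forall>j<p. m \<le> j \<longrightarrow> xs ! j \<in> X) \<longrightarrow> \<phi> xs \<in> S" if "m \<le> p" for m
    using that
  proof (induction m)
    case 0
    show ?case
    proof (intro ballI impI)
      fix xs assume "xs \<in> tuples W p" "\<forall>j<p. 0 \<le> j \<longrightarrow> xs ! j \<in> X"
      then show "\<phi> xs \<in> S" by (intro v) (auto simp: tuples_def in_set_conv_nth)
    qed
  next
    case (Suc m)
    show ?case
    proof (intro ballI impI)
      fix xs assume xs: "xs \<in> tuples W p" and "\<forall>j<p. Suc m \<le> j \<longrightarrow> xs ! j \<in> X"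
      then have IH: "\<phi> (xs[m := x]) \<in> S" if "x \<in> X" for x
        using Suc that X(1) by (auto simp: nth_list_update tuples_length)
      have "\<phi> (xs[m := xs ! m]) \<in> S"
      proof (rule linmap_span_into[OF W K _ S X(1), of "\<lambda>x. \<phi> (xs[m := x])"])
        show "linmap W K (\<lambda>x. \<phi> (xs[m := x]))" using phi xs Suc.prems by (auto simp: multilin_def)
        show "xs ! m \<in> span_in W X" using X(2) tuples_nth[OF xs] Suc.prems by auto
      qed (rule IH)
      then show "\<phi> xs \<in> S" by simp
    qed
  qed
  from this[of p] show ?thesis using xs by auto
qed

context
  fixes W :: "('k::field, 'a) module"
  assumes W: "vspace W"
begin

lemma tpow_rels_free: "tpow_rels W p \<subseteq> carrier (free_space (tuples W p))"
  unfolding tpow_rels_def using W by (auto intro!: diff_free_closed)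

lemma vspace_tpow: "vspace (tpow W p)"
  unfolding tpow_def by (rule vspace_presented[OF tpow_rels_free])

lemma pure_tpow_closed: "xs \<in> tuples W p \<Longrightarrow> pure_tpow W xs \<in> carrier (tpow W p)"
  unfolding tpow_def pure_tpow_def tuples_length by (rule presented_closed[OF tpow_rels_free])

lemma multilin_pure_tpow: "multilin W p (tpow W p) (pure_tpow W)"
  unfolding multilin_def
proof (intro ballI allI conjI impI linmapI)
  fix xs assume "xs \<in> tuples W p"
  then show "pure_tpow W xs \<in> carrier (tpow W p)" by (rule pure_tpow_closed)
next
  fix xs j x assume "xs \<in> tuples W p" "x \<in> carrier W"
  then show "pure_tpow W (xs[j := x]) \<in> carrier (tpow W p)" by (intro pure_tpow_closed) simp
next
  fix xs j x y assume xs: "xs \<in> tuples W p" "j < p" "x \<in> carrier W" "y \<in> carrier W"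
  then show "pure_tpow W (xs[j := x \<oplus>\<^bsub>W\<^esub> y]) = pure_tpow W (xs[j := x]) \<oplus>\<^bsub>tpow W p\<^esub> pure_tpow W (xs[j := y])"
    unfolding tpow_def pure_tpow_def length_list_update tuples_length[OF xs(1)]
    by (intro presented_additive[OF tpow_rels_free]) (auto simp: W tpow_rels_def)
next
  fix xs j x c assume xs: "xs \<in> tuples W p" "j < p" "x \<in> carrier W"
  then show "pure_tpow W (xs[j := c \<odot>\<^bsub>W\<^esub> x]) = c \<odot>\<^bsub>tpow W p\<^esub> pure_tpow W (xs[j := x])"
    unfolding tpow_def pure_tpow_def length_list_update tuples_length[OF xs(1)]
    by (intro presented_homogeneous[OF tpow_rels_free]) (auto simp: W tpow_rels_def)
qed

lemma tpow_span: "carrier (tpow W p) \<subseteq> span_in (tpow W p) (pure_tpow W ` tuples W p)"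
proof -
  have *: "pure_tpow W ` tuples W p =
    (\<lambda>s. span_in (free_space (tuples W p)) (tpow_rels W p)
      +>\<^bsub>free_space (tuples W p) :: ('k, _) module\<^esub> Poly_Mapping.single s 1) ` tuples W p"
    unfolding pure_tpow_def by (intro image_cong refl) (simp add: tuples_length)
  show ?thesis
    unfolding * unfolding tpow_def by (rule presented_span[OF tpow_rels_free])
qed

lemma tpow_lift:
  fixes K :: "('k, 'c) module"
  assumes K: "vspace K" and m: "multilin W p K \<phi>"
  shows "\<exists>h\<in>lin (tpow W p) K. \<forall>xs\<in>tuples W p. h (pure_tpow W xs) = \<phi> xs"
proof -
  let ?S = "tuples W p"
  have phi: "\<phi> s \<in> carrier K" if "s \<in> ?S" for s
    using m that by (auto simp: multilin_def)
  have "\<exists>h\<in>lin (tpow W p) K. \<forall>s\<in>?S. h (span_in (free_space ?S) (tpow_rels W p)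
      +>\<^bsub>free_space ?S :: ('k, _) module\<^esub> Poly_Mapping.single s 1) = \<phi> s"
    unfolding tpow_def
  proof (rule presented_lift[OF tpow_rels_free K phi])
    fix g r assume g: "linmap (free_space ?S) K g" and v: "\<And>s c. s \<in> ?S \<Longrightarrow> g (Poly_Mapping.single s c) = c \<odot>\<^bsub>K\<^esub> \<phi> s"
      and "r \<in> tpow_rels W p"
    note r3 = linmap_kills_additivity[where \<phi>=\<phi>, OF K g v phi] and r2 = linmap_kills_homogeneity[where \<phi>=\<phi>, OF K g v phi]
    from \<open>r \<in> tpow_rels W p\<close> show "g r = \<zero>\<^bsub>K\<^esub>"
      unfolding tpow_rels_def using m
      by (elim UnE CollectE exE conjE; simp only:; intro r3 r2) (auto simp: W multilin_def linmap_def)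
  qed
  then show ?thesis by (auto simp: pure_tpow_def tuples_length)
qed

lemma tpow_span_gen:
  assumes X: "X \<subseteq> carrier W" "carrier W \<subseteq> span_in W X"
  shows "carrier (tpow W p) \<subseteq> span_in (tpow W p) (pure_tpow W ` {xs. set xs \<subseteq> X \<and> length xs = p})"
proof -
  let ?P = "pure_tpow W ` {xs. set xs \<subseteq> X \<and> length xs = p}"
  have P: "?P \<subseteq> carrier (tpow W p)" using X(1) by (auto intro!: pure_tpow_closed simp: tuples_def)
  have "pure_tpow W ` tuples W p \<subseteq> span_in (tpow W p) ?P"
    using multilin_span_into[OF W vspace_tpow multilin_pure_tpow subsp_span[OF vspace_tpow P] X]
      span_superset[OF vspace_tpow P] by blast
  then show ?thesis
    using tpow_span span_least[OF vspace_tpow subsp_span[OF vspace_tpow P]] by blast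
qed

end

section \<open>Perfect pairings\<close>

lemma linmap_smult_const: "vspace K \<Longrightarrow> linmap M scalars f \<Longrightarrow> k \<in> carrier K \<Longrightarrow> linmap M K (\<lambda>x. f x \<odot>\<^bsub>K\<^esub> k)"
  by (auto simp: linmap_def vs_add_smult vs_mult_smult)

lemma linmap_finsum_fun:
  assumes K: "vspace K" and f: "\<And>i. i \<in> A \<Longrightarrow> linmap M K (f i)"
  shows "linmap M K (\<lambda>x. finsum K (\<lambda>i. f i x) A)"
proof -
  have fc: "f i x \<in> carrier K" if "i \<in> A" "x \<in> carrier M" for i x
    by (rule linmap_closed[OF f[OF that(1)] that(2)])
  show ?thesis
  proof (rule linmapI)
    fix x y assume xy: "x \<in> carrier M" "y \<in> carrier M"
    have "finsum K (\<lambda>i. f i (x \<oplus>\<^bsub>M\<^esub> y)) A = finsum K (\<lambda>i. f i x \<oplus>\<^bsub>K\<^esub> f i y) A"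
      using xy fc linmap_add[OF f] by (intro vs_finsum_cong[OF K]) (auto simp: K)
    also have "\<dots> = finsum K (\<lambda>i. f i x) A \<oplus>\<^bsub>K\<^esub> finsum K (\<lambda>i. f i y) A"
      using xy fc by (intro vs_finsum_add[OF K]) auto
    finally show "finsum K (\<lambda>i. f i (x \<oplus>\<^bsub>M\<^esub> y)) A = finsum K (\<lambda>i. f i x) A \<oplus>\<^bsub>K\<^esub> finsum K (\<lambda>i. f i y) A" .
  next
    fix c x assume x: "x \<in> carrier M"
    show "finsum K (\<lambda>i. f i x) A \<in> carrier K"
      using x fc by (intro vs_finsum_closed[OF K]) auto
    have "finsum K (\<lambda>i. f i (c \<odot>\<^bsub>M\<^esub> x)) A = finsum K (\<lambda>i. c \<odot>\<^bsub>K\<^esub> f i x) A"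
      using x fc linmap_smult[OF f] by (intro vs_finsum_cong[OF K]) (auto simp: K)
    also have "\<dots> = c \<odot>\<^bsub>K\<^esub> finsum K (\<lambda>i. f i x) A"
      using x fc
      by (intro linmap_finsum[OF K K, symmetric])
        (auto simp: linmap_def K vs_smult_add[OF K] vs_mult_smult[OF K, symmetric] mult.commute)
    finally show "finsum K (\<lambda>i. f i (c \<odot>\<^bsub>M\<^esub> x)) A = c \<odot>\<^bsub>K\<^esub> finsum K (\<lambda>i. f i x) A" .
  qed
qed

lemma vs_finsum_delta:
  assumes K: "vspace K" and "finite A" "j \<in> A" and e: "\<And>i. i \<in> A \<Longrightarrow> e i \<in> carrier K"
  shows "finsum K (\<lambda>i. (if i = j then 1 else 0) \<odot>\<^bsub>K\<^esub> e i) A = e j"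
proof -
  have "finsum K (\<lambda>i. (if i = j then 1 else 0) \<odot>\<^bsub>K\<^esub> e i) {j} = finsum K (\<lambda>i. (if i = j then 1 else 0) \<odot>\<^bsub>K\<^esub> e i) A"
    using assms by (intro vs_finsum_mono[OF K]) (auto simp: K)
  then show ?thesis
    using e[OF assms(3)] vs_finsum_insert[OF K, of "{}" j "\<lambda>i. (if i = j then 1 else 0) \<odot>\<^bsub>K\<^esub> e i"]
    by (simp add: vs_finsum_empty[OF K] K)
qed

text \<open>
  The dual family reconstructs \<open>x\<close> from its image as \<open>\<Sum>\<^sub>i F x (f i) \<cdot> e i\<close>, which gives injectivity; the same
  formula with \<open>\<phi> (f i)\<close> in place of \<open>F x (f i)\<close> gives a preimage of \<open>\<phi>\<close>.
\<close>
lemma bij_betw_dual_basis: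
  assumes M: "vspace M" and N: "vspace N" and F: "linmap M (dual N) F" and I: "finite I"
    and e: "e ` I \<subseteq> carrier M" "carrier M \<subseteq> span_in M (e ` I)"
    and f: "f ` I \<subseteq> carrier N" "carrier N \<subseteq> span_in N (f ` I)"
    and ef: "\<And>i j. i \<in> I \<Longrightarrow> j \<in> I \<Longrightarrow> F (e i) (f j) = (if i = j then 1 else 0)"
  shows "bij_betw F (carrier M) (carrier (dual N))"
proof -
  have Fx: "F x \<in> lin N scalars" if "x \<in> carrier M" for x
    using linmap_closed[OF F that] by (simp add: dual_simps)
  have ei: "e i \<in> carrier M" "f i \<in> carrier N" if "i \<in> I" for i using e f that by auto
  define G where "G x = finsum M (\<lambda>i. F x (f i) \<odot>\<^bsub>M\<^esub> e i) I" for x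
  have lG: "linmap M M G"
    unfolding G_def using ei by (intro linmap_finsum_fun[OF M] linmap_smult_const[OF M] linmap_dual_eval[OF F])
  have Ge: "G (e j) = e j" if j: "j \<in> I" for j
  proof -
    have "G (e j) = finsum M (\<lambda>i. (if i = j then 1 else 0) \<odot>\<^bsub>M\<^esub> e i) I"
      unfolding G_def using ei ef j by (intro vs_finsum_cong[OF M]) (auto simp: M)
    then show ?thesis using vs_finsum_delta[OF M I j, of e] ei by simp
  qed
  have id: "linmap M M (\<lambda>x. x)" by (simp add: linmap_def)
  have G: "G x = x" if "x \<in> carrier M" for x
    by (rule linmap_eq_on_span[OF M M lG id e(1)]) (use that e(2) Ge in auto)
  show ?thesis
  proof (intro bij_betwI' iffI)
    fix x y assume "x \<in> carrier M" "y \<in> carrier M" "F x = F y"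
    then show "x = y" using G[of x] G[of y] by (simp add: G_def)
  next
    fix x assume "x \<in> carrier M" then show "F x \<in> carrier (dual N)" using Fx by (simp add: dual_simps)
  next
    fix \<phi> assume "\<phi> \<in> carrier (dual N)"
    then have phi: "\<phi> \<in> lin N scalars" by (simp add: dual_simps)
    define x where "x = finsum M (\<lambda>i. \<phi> (f i) \<odot>\<^bsub>M\<^esub> e i) I"
    have x: "x \<in> carrier M" unfolding x_def using ei M by (intro vs_finsum_closed[OF M]) auto
    have "\<phi> = F x"
    proof (rule lin_eqI[OF N vspace_scalars phi Fx[OF x] f])
      fix s assume "s \<in> f ` I"
      then obtain j where j: "j \<in> I" "s = f j" by auto
      have "F x (f j) = (\<Sum>i\<in>I. F (\<phi> (f i) \<odot>\<^bsub>M\<^esub> e i) (f j))"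
        unfolding x_def using ei j M by (intro linmap_sum[OF M linmap_dual_eval[OF F]]) auto
      also have "\<dots> = (\<Sum>i\<in>I. \<phi> (f i) * F (e i) (f j))"
        using linmap_smult[OF linmap_dual_eval[OF F]] ei j by (intro sum.cong) auto
      also have "\<dots> = (\<Sum>i\<in>I. if i = j then \<phi> (f i) else 0)"
        using ef j by (intro sum.cong) auto
      also have "\<dots> = \<phi> (f j)" using I j by simp
      finally show "\<phi> s = F x s" using j by simp
    qed
    then show "\<exists>x\<in>carrier M. \<phi> = F x" using x by blast
  qed simp
qed

text \<open>
  Linearity in \<open>x\<close> of a functional \<open>F x\<close> only has to be tested at a spanning set of arguments.
\<close>
lemma linmap_into_dual_on_span:
  assumes M: "vspace M" and N: "vspace N" and F: "\<And>x. x \<in> carrier M \<Longrightarrow> F x \<in> lin N scalars"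
    and S: "S \<subseteq> carrier N" "carrier N \<subseteq> span_in N S"
    and FS: "\<And>s. s \<in> S \<Longrightarrow> linmap M scalars (\<lambda>x. F x s)"
  shows "linmap M (dual N) F"
proof (rule linmapI)
  note D = vspace_dual[OF N]
  fix x y assume x: "x \<in> carrier M" and y: "y \<in> carrier M"
  have 1: "F (x \<oplus>\<^bsub>M\<^esub> y) \<in> lin N scalars" using F x y M by simp
  have 2: "F x \<oplus>\<^bsub>dual N\<^esub> F y \<in> lin N scalars" using F[OF x] F[OF y] vs_add[OF D, of "F x" "F y"] by (simp add: dual_simps)
  show "F (x \<oplus>\<^bsub>M\<^esub> y) = F x \<oplus>\<^bsub>dual N\<^esub> F y"
    by (rule lin_eqI[OF N vspace_scalars 1 2 S]) (use linmap_add[OF FS x y] S in \<open>auto simp: dual_simps\<close>)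
next
  note D = vspace_dual[OF N]
  fix c x assume x: "x \<in> carrier M"
  have 1: "F (c \<odot>\<^bsub>M\<^esub> x) \<in> lin N scalars" using F x M by simp
  have 2: "c \<odot>\<^bsub>dual N\<^esub> F x \<in> lin N scalars" using F[OF x] vs_smult[OF D, of "F x" c] by (simp add: dual_simps)
  show "F (c \<odot>\<^bsub>M\<^esub> x) = c \<odot>\<^bsub>dual N\<^esub> F x"
    by (rule lin_eqI[OF N vspace_scalars 1 2 S]) (use linmap_smult[OF FS x] S in \<open>auto simp: dual_simps\<close>)
  show "F x \<in> carrier (dual N)" using F x by (simp add: dual_simps)
qed

lemma prod_lessThan_split: "i < p \<Longrightarrow> (\<Prod>j<p. g j) = g i * (\<Prod>j\<in>{..<p} - {i}. g j)"
  for g :: "nat \<Rightarrow> 'k::field"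
  by (simp add: prod.remove)

lemma linmap_scale: "linmap M scalars f \<Longrightarrow> linmap M scalars (\<lambda>x. f x * c)"
  by (auto simp: linmap_def algebra_simps)

lemma multilin_prod:
  assumes h: "\<And>j. j < p \<Longrightarrow> linmap W scalars (h j)"
  shows "multilin W p scalars (\<lambda>xs. \<Prod>j<p. h j (xs ! j))"
  unfolding multilin_def
proof (intro ballI allI impI conjI)
  fix xs i assume xs: "xs \<in> tuples W p" and i: "i < p"
  have "(\<lambda>x. \<Prod>j<p. h j (xs[i := x] ! j)) = (\<lambda>x. h i x * (\<Prod>j\<in>{..<p} - {i}. h j (xs ! j)))"
    using xs by (simp add: prod_lessThan_split[OF i] tuples_length i)
  then show "linmap W scalars (\<lambda>x. \<Prod>j<p. h j (xs[i := x] ! j))"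
    using linmap_scale[OF h[OF i]] by simp
qed simp

text \<open>
  The universal property is used twice: for fixed \<open>as\<close> the product is multilinear in \<open>ls\<close>, and the
  functional on the tensor power of \<open>N\<close> obtained from this is multilinear in \<open>as\<close>.
\<close>
lemma tpow_pairing_exists:
  assumes M: "vspace M" and N: "vspace N" and F: "linmap M (dual N) F"
  shows "\<exists>G\<in>lin (tpow M p) (dual (tpow N p)). \<forall>as\<in>tuples M p. \<forall>ls\<in>tuples N p.
     G (pure_tpow M as) (pure_tpow N ls) = (\<Prod>j<p. F (as ! j) (ls ! j))"
proof -
  have "\<exists>\<phi>\<in>lin (tpow N p) scalars. \<forall>ls\<in>tuples N p. \<phi> (pure_tpow N ls) = (\<Prod>j<p. F (as ! j) (ls ! j))"
    if as: "as \<in> tuples M p" for as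
    using linmap_closed[OF F] tuples_nth[OF as]
    by (intro tpow_lift[OF N vspace_scalars] multilin_prod) (auto simp: dual_simps lin_iff)
  then obtain \<Phi> where Phi: "\<And>as. as \<in> tuples M p \<Longrightarrow> \<Phi> as \<in> lin (tpow N p) scalars"
     "\<And>as ls. as \<in> tuples M p \<Longrightarrow> ls \<in> tuples N p \<Longrightarrow> \<Phi> as (pure_tpow N ls) = (\<Prod>j<p. F (as ! j) (ls ! j))"
    by metis
  have "multilin M p (dual (tpow N p)) \<Phi>"
    unfolding multilin_def
  proof (intro ballI allI impI conjI)
    fix as i assume as: "as \<in> tuples M p"
    then show "\<Phi> as \<in> carrier (dual (tpow N p))" using Phi by (simp add: dual_simps)
    assume i: "i < p"
    show "linmap M (dual (tpow N p)) (\<lambda>x. \<Phi> (as[i := x]))"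
    proof (rule linmap_into_dual_on_span[OF M vspace_tpow[OF N] _ _ tpow_span[OF N]])
      fix x assume "x \<in> carrier M"
      then show "\<Phi> (as[i := x]) \<in> lin (tpow N p) scalars" using as by (intro Phi) simp
    next
      show "pure_tpow N ` tuples N p \<subseteq> carrier (tpow N p)" by (auto intro: pure_tpow_closed[OF N])
    next
      fix s assume "s \<in> pure_tpow N ` tuples N p"
      then obtain ls where ls: "ls \<in> tuples N p" "s = pure_tpow N ls" by auto
      have "linmap M scalars (\<lambda>x. F x (ls ! i) * (\<Prod>j\<in>{..<p} - {i}. F (as ! j) (ls ! j)))"
        using ls i by (intro linmap_scale linmap_dual_eval[OF F]) (simp add: tuples_nth)
      moreover have "\<Phi> (as[i := x]) s = F x (ls ! i) * (\<Prod>j\<in>{..<p} - {i}. F (as ! j) (ls ! j))" if "x \<in> carrier M" for x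
        using as ls that i by (simp add: Phi prod_lessThan_split[OF i] tuples_length)
      ultimately show "linmap M scalars (\<lambda>x. \<Phi> (as[i := x]) s)"
        by (subst linmap_cong[OF M]) auto
    qed
  qed
  from tpow_lift[OF M vspace_dual[OF vspace_tpow[OF N]] this]
  obtain G where "G \<in> lin (tpow M p) (dual (tpow N p))" "\<forall>as\<in>tuples M p. G (pure_tpow M as) = \<Phi> as" by blast
  then show ?thesis using Phi(2) by (intro bexI[of _ G]) simp_all
qed

lemma tpow_pairing_unique:
  assumes M: "vspace M" and N: "vspace N"
    and G: "G \<in> lin (tpow M p) (dual (tpow N p))" and H: "H \<in> lin (tpow M p) (dual (tpow N p))"
    and eq: "\<And>as ls. as \<in> tuples M p \<Longrightarrow> ls \<in> tuples N p \<Longrightarrow>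
      G (pure_tpow M as) (pure_tpow N ls) = H (pure_tpow M as) (pure_tpow N ls)"
  shows "G = H"
proof (rule lin_eqI[OF vspace_tpow[OF M] vspace_dual[OF vspace_tpow[OF N]] G H _ tpow_span[OF M]])
  show "pure_tpow M ` tuples M p \<subseteq> carrier (tpow M p)" by (auto intro: pure_tpow_closed[OF M])
  fix s assume "s \<in> pure_tpow M ` tuples M p"
  then obtain as where as: "as \<in> tuples M p" "s = pure_tpow M as" by auto
  have s: "s \<in> carrier (tpow M p)" using as by (simp add: pure_tpow_closed[OF M])
  show "G s = H s"
  proof (rule lin_eqI[OF vspace_tpow[OF N] vspace_scalars _ _ _ tpow_span[OF N]])
    show "pure_tpow N ` tuples N p \<subseteq> carrier (tpow N p)" by (auto intro: pure_tpow_closed[OF N])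
    show "G s \<in> lin (tpow N p) scalars" "H s \<in> lin (tpow N p) scalars"
      using linmap_closed[OF lin_linmap[OF G] s] linmap_closed[OF lin_linmap[OF H] s] by (simp_all add: dual_simps)
  qed (use as eq in auto)
qed

lemma image_map_lists: "map g ` {is. set is \<subseteq> I \<and> length is = p} = {xs. set xs \<subseteq> g ` I \<and> length xs = p}"
proof (intro equalityI subsetI)
  fix xs assume "xs \<in> {xs. set xs \<subseteq> g ` I \<and> length xs = p}"
  then have xs: "\<forall>x\<in>set xs. \<exists>i. i \<in> I \<and> x = g i" "length xs = p" by auto
  from xs(1) obtain h where "\<forall>x\<in>set xs. h x \<in> I \<and> x = g (h x)" by (rule bchoice[THEN exE])
  then show "xs \<in> map g ` {is. set is \<subseteq> I \<and> length is = p}"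
    using xs(2) by (intro image_eqI[of _ _ "map h xs"]) (auto simp: map_idI)
qed (auto simp: subset_iff)

text \<open>
  Pure tensors of dual bases are again dual bases, indexed by lists: the product of the Kronecker deltas
  of the entries is the Kronecker delta of the lists.
\<close>
lemma tpow_pairing_bij:
  assumes M: "vspace M" and N: "vspace N" and F: "linmap M (dual N) F" and I: "finite I"
    and e: "e ` I \<subseteq> carrier M" "carrier M \<subseteq> span_in M (e ` I)"
    and f: "f ` I \<subseteq> carrier N" "carrier N \<subseteq> span_in N (f ` I)"
    and ef: "\<And>i j. i \<in> I \<Longrightarrow> j \<in> I \<Longrightarrow> F (e i) (f j) = (if i = j then 1 else 0)"
    and G: "G \<in> lin (tpow M p) (dual (tpow N p))"
    and GF: "\<And>as ls. as \<in> tuples M p \<Longrightarrow> ls \<in> tuples N p \<Longrightarrow>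
      G (pure_tpow M as) (pure_tpow N ls) = (\<Prod>j<p. F (as ! j) (ls ! j))"
  shows "bij_betw G (carrier (tpow M p)) (carrier (dual (tpow N p)))"
proof -
  let ?I = "{is. set is \<subseteq> I \<and> length is = p}"
  have im: "(\<lambda>is. pure_tpow M (map e is)) ` ?I = pure_tpow M ` {xs. set xs \<subseteq> e ` I \<and> length xs = p}"
    "(\<lambda>is. pure_tpow N (map f is)) ` ?I = pure_tpow N ` {xs. set xs \<subseteq> f ` I \<and> length xs = p}"
    unfolding image_map_lists[symmetric] image_image by simp_all
  have tup: "map e is \<in> tuples M p" "map f is \<in> tuples N p" if "is \<in> ?I" for "is"
    using e(1) f(1) that by (auto simp: tuples_def image_subset_iff subset_iff)
  show ?thesis
  proof (rule bij_betw_dual_basis[OF vspace_tpow[OF M] vspace_tpow[OF N] lin_linmap[OF G]])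
    show "finite ?I" using finite_lists_length_eq[OF I] by simp
    show "carrier (tpow M p) \<subseteq> span_in (tpow M p) ((\<lambda>is. pure_tpow M (map e is)) ` ?I)"
      unfolding im by (rule tpow_span_gen[OF M e])
    show "carrier (tpow N p) \<subseteq> span_in (tpow N p) ((\<lambda>is. pure_tpow N (map f is)) ` ?I)"
      unfolding im by (rule tpow_span_gen[OF N f])
    show "(\<lambda>is. pure_tpow M (map e is)) ` ?I \<subseteq> carrier (tpow M p)"
      "(\<lambda>is. pure_tpow N (map f is)) ` ?I \<subseteq> carrier (tpow N p)"
      using tup by (auto intro!: pure_tpow_closed[OF M] pure_tpow_closed[OF N])
    fix "is" js assume ij: "is \<in> ?I" "js \<in> ?I"
    have "is ! j \<in> I" "js ! j \<in> I" if "j < p" for j using ij that by (auto intro: nth_mem)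
    then have "(\<Prod>j<p. F (map e is ! j) (map f js ! j)) = (\<Prod>j<p. if is ! j = js ! j then 1 else 0)"
      using ij by (intro prod.cong) (auto simp: ef)
    also have "\<dots> = (if is = js then 1 else 0)"
      using ij by (auto simp: list_eq_iff_nth_eq)
    finally show "G (pure_tpow M (map e is)) (pure_tpow N (map f js)) = (if is = js then 1 else 0)"
      using GF tup ij by simp
  qed
qed

section \<open>The normalized bar resolution of an augmented algebra\<close>

lemma linmap_smult_fun: "vspace K \<Longrightarrow> linmap M K f \<Longrightarrow> linmap M K (\<lambda>x. c \<odot>\<^bsub>K\<^esub> f x)"
  by (auto simp: linmap_def vs_smult_add vs_mult_smult[symmetric] mult.commute)

lemma linmap_add_fun: "vspace K \<Longrightarrow> linmap M K f \<Longrightarrow> linmap M K g \<Longrightarrow> linmap M K (\<lambda>x. f x \<oplus>\<^bsub>K\<^esub> g x)"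
  by (auto simp: linmap_def vs_smult_add vs_assoc vs_lcomm)

lemma multilin_linmap: "multilin W p K \<phi> \<Longrightarrow> xs \<in> tuples W p \<Longrightarrow> j < p \<Longrightarrow> linmap W K (\<lambda>x. \<phi> (xs[j := x]))"
  by (simp add: multilin_def)

lemma multilin_closed: "multilin W p K \<phi> \<Longrightarrow> xs \<in> tuples W p \<Longrightarrow> \<phi> xs \<in> carrier K"
  by (simp add: multilin_def)

lemma multilin_comp: "multilin W p K \<phi> \<Longrightarrow> linmap K K' h \<Longrightarrow> multilin W p K' (\<lambda>xs. h (\<phi> xs))"
  unfolding multilin_def
  by (blast intro: linmap_comp[where f="\<lambda>x. \<phi> (xs[j := x])" and g=h for xs j] linmap_closed)

lemma linmap_pure_tpow_singleton:
  assumes W: "vspace W"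
  shows "linmap W (tpow W 1) (\<lambda>x. pure_tpow W [x])"
proof -
  have "[\<zero>\<^bsub>W\<^esub>] \<in> tuples W 1" using W by (simp add: tuples_def)
  from multilin_linmap[OF multilin_pure_tpow[OF W] this, of 0] show ?thesis by simp
qed

lemma multilin_cong:
  assumes W: "vspace W" and e: "\<And>xs. xs \<in> tuples W p \<Longrightarrow> \<phi> xs = \<psi> xs"
  shows "multilin W p K \<phi> \<longleftrightarrow> multilin W p K \<psi>"
proof -
  have "linmap W K (\<lambda>x. \<phi> (xs[j := x])) \<longleftrightarrow> linmap W K (\<lambda>x. \<psi> (xs[j := x]))" if "xs \<in> tuples W p" for xs j
    by (rule linmap_cong[OF W]) (simp add: e that)
  then show ?thesis unfolding multilin_def using e by simp
qed

lemma multilin_finsum: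
  assumes K: "vspace K" and "\<And>i. i \<in> A \<Longrightarrow> multilin W p K (\<phi> i)"
  shows "multilin W p K (\<lambda>xs. finsum K (\<lambda>i. \<phi> i xs) A)"
  using assms unfolding multilin_def by (auto intro!: linmap_finsum_fun vs_finsum_closed)

lemma multilin_smult: "vspace K \<Longrightarrow> multilin W p K \<phi> \<Longrightarrow> multilin W p K (\<lambda>xs. c \<odot>\<^bsub>K\<^esub> \<phi> xs)"
  unfolding multilin_def by (auto intro!: linmap_smult_fun)

text \<open>
  Precomposition with a list operation \<open>\<psi>\<close> keeps multilinearity if a change of one entry of \<open>xs\<close> is felt in
  a single entry of \<open>\<psi> xs\<close>, and there through a linear map.
\<close>
lemma multilin_slot:
  assumes W: "vspace W" and phi: "multilin W' q K \<phi>"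
    and psi: "\<And>xs. xs \<in> tuples W p \<Longrightarrow> \<psi> xs \<in> tuples W' q"
    and slot: "\<And>xs i. xs \<in> tuples W p \<Longrightarrow> i < p \<Longrightarrow>
      \<exists>i'<q. \<exists>h. linmap W W' h \<and> (\<forall>x\<in>carrier W. \<psi> (xs[i := x]) = (\<psi> xs)[i' := h x])"
  shows "multilin W p K (\<lambda>xs. \<phi> (\<psi> xs))"
  unfolding multilin_def
proof (intro ballI conjI allI impI)
  fix xs i assume xs: "xs \<in> tuples W p"
  show "\<phi> (\<psi> xs) \<in> carrier K" by (rule multilin_closed[OF phi psi[OF xs]])
  assume "i < p"
  from slot[OF xs this] obtain i' h where h: "i' < q" "linmap W W' h" "\<And>x. x \<in> carrier W \<Longrightarrow> \<psi> (xs[i := x]) = (\<psi> xs)[i' := h x]"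
    by blast
  have "linmap W K (\<lambda>x. \<phi> ((\<psi> xs)[i' := h x]))"
    by (rule linmap_comp[OF h(2) multilin_linmap[OF phi psi[OF xs] h(1)]])
  then show "linmap W K (\<lambda>x. \<phi> (\<psi> (xs[i := x])))"
    using h(3) by (subst linmap_cong[OF W]) auto
qed

lemma multilin_map:
  assumes W: "vspace W" and phi: "multilin W' p K \<phi>" and f: "linmap W W' f"
  shows "multilin W p K (\<lambda>xs. \<phi> (map f xs))"
proof (rule multilin_slot[OF W phi])
  show "map f xs \<in> tuples W' p" if "xs \<in> tuples W p" for xs
    using that linmap_closed[OF f] by (auto simp: tuples_def)
qed (use f in \<open>auto simp: map_update\<close>)

lemma multilin_zero:
  assumes W: "vspace W" and K: "vspace K" and phi: "multilin W p K \<phi>"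
    and xs: "xs \<in> tuples W p" "j < p" "xs ! j = \<zero>\<^bsub>W\<^esub>"
  shows "\<phi> xs = \<zero>\<^bsub>K\<^esub>"
  using linmap_zero[OF W K multilin_linmap[OF phi xs(1,2)]] xs(3) by (metis list_update_id)

text \<open>
  Representatives in \<open>L\<close> are exchanged one at a time; each exchange changes \<open>\<phi>\<close> by its value at a tuple with
  an entry in \<open>N\<close>, which is zero.
\<close>
lemma multilin_descend:
  assumes L: "vspace L" and N: "subsp L N" and K: "vspace K" and phi: "multilin L p K \<phi>"
    and van: "\<And>xs j. xs \<in> tuples L p \<Longrightarrow> j < p \<Longrightarrow> xs ! j \<in> N \<Longrightarrow> \<phi> xs = \<zero>\<^bsub>K\<^esub>"
  shows "\<exists>\<phi>'. multilin (quot L N) p K \<phi>' \<and> (\<forall>xs\<in>tuples L p. \<phi>' (map (\<lambda>x. N +>\<^bsub>L\<^esub> x) xs) = \<phi> xs)"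
proof -
  let ?Q = "quot L N" and ?c = "\<lambda>x. N +>\<^bsub>L\<^esub> x"
  define \<sigma> where "\<sigma> C = (SOME x. x \<in> carrier L \<and> ?c x = C)" for C
  have sig: "\<sigma> C \<in> carrier L \<and> ?c (\<sigma> C) = C" if C: "C \<in> carrier ?Q" for C
  proof -
    have "\<exists>x. x \<in> carrier L \<and> ?c x = C" using C by (auto simp: quot_simps)
    then show ?thesis unfolding \<sigma>_def by (rule someI_ex)
  qed
  have upd: "\<phi> (xs[j := x]) = \<phi> (xs[j := y])"
    if xs: "xs \<in> tuples L p" and j: "j < p" and x: "x \<in> carrier L" and y: "y \<in> carrier L" and e: "?c x = ?c y" for xs j x y
  proof -
    have d: "x \<ominus>\<^bsub>L\<^esub> y \<in> N" using coset_eq_iff[OF L N x y] e by simp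
    have "\<phi> (xs[j := x]) \<ominus>\<^bsub>K\<^esub> \<phi> (xs[j := y]) = \<phi> (xs[j := x \<ominus>\<^bsub>L\<^esub> y])"
      using linmap_minus[OF L K multilin_linmap[OF phi xs j] x y] by simp
    also have "\<dots> = \<zero>\<^bsub>K\<^esub>"
      using xs j x y d L by (intro van[of _ j]) (auto simp: tuples_length)
    finally show ?thesis
      using xs x y by (subst (asm) vs_minus_zero_iff[OF K]) (auto intro: multilin_closed[OF phi])
  qed
  have key: "\<phi> xs = \<phi> ys" if xs: "xs \<in> tuples L p" and ys: "ys \<in> tuples L p" and e: "map ?c xs = map ?c ys" for xs ys
  proof -
    have "\<phi> (take m ys @ drop m xs) = \<phi> xs" if "m \<le> p" for m
      using that
    proof (induction m)
      case (Suc m)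
      let ?w = "take m ys @ drop m xs"
      have w: "?w \<in> tuples L p" using xs ys Suc.prems
        by (auto simp: tuples_def dest: in_set_takeD in_set_dropD)
      have "drop m xs = xs ! m # drop (Suc m) xs" "take (Suc m) ys = take m ys @ [ys ! m]"
        using xs ys Suc.prems by (simp_all add: tuples_length Cons_nth_drop_Suc take_Suc_conv_app_nth)
      then have "take (Suc m) ys @ drop (Suc m) xs = ?w[m := ys ! m]" "?w = ?w[m := xs ! m]"
        using ys Suc.prems by (simp_all add: tuples_length list_update_append)
      moreover have "\<phi> (?w[m := ys ! m]) = \<phi> (?w[m := xs ! m])"
        using Suc.prems tuples_nth[OF xs] tuples_nth[OF ys] arg_cong[OF e, of "\<lambda>l. l ! m"] xs ys
        by (intro upd[OF w]) (simp_all add: tuples_length)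
      ultimately show ?case using Suc by simp
    qed simp
    from this[of p] show ?thesis using xs ys by (simp add: tuples_length)
  qed
  have sc: "map ?c (map \<sigma> cs) = cs" "map \<sigma> cs \<in> tuples L p" if "cs \<in> tuples ?Q p" for cs
    using sig that by (auto simp: tuples_def map_idI subset_iff)
  define \<phi>' where "\<phi>' cs = \<phi> (map \<sigma> cs)" for cs
  have val: "\<phi>' (map ?c xs) = \<phi> xs" if xs: "xs \<in> tuples L p" for xs
  proof -
    have "map ?c xs \<in> tuples ?Q p" using xs by (auto simp: tuples_def quot_simps)
    then show ?thesis unfolding \<phi>'_def by (intro key sc xs)
  qed
  have "multilin ?Q p K \<phi>'"
    unfolding multilin_def
  proof (intro ballI conjI allI impI)
    fix cs j assume cs: "cs \<in> tuples ?Q p"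
    show "\<phi>' cs \<in> carrier K" unfolding \<phi>'_def by (rule multilin_closed[OF phi sc(2)[OF cs]])
    assume j: "j < p"
    note lm = multilin_linmap[OF phi sc(2)[OF cs] j]
    have v: "\<phi>' (cs[j := ?c x]) = \<phi> ((map \<sigma> cs)[j := x])" if x: "x \<in> carrier L" for x
      unfolding \<phi>'_def map_update using x sig[of "?c x"]
      by (intro upd sc cs j) (auto simp: quot_simps)
    show "linmap ?Q K (\<lambda>C. \<phi>' (cs[j := C]))"
    proof (rule linmapI)
      fix C D c assume "C \<in> carrier ?Q" "D \<in> carrier ?Q"
      then obtain x y where xy: "x \<in> carrier L" "C = ?c x" "y \<in> carrier L" "D = ?c y" by (auto simp: quot_simps)
      show "\<phi>' (cs[j := C \<oplus>\<^bsub>?Q\<^esub> D]) = \<phi>' (cs[j := C]) \<oplus>\<^bsub>K\<^esub> \<phi>' (cs[j := D])"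
        using xy linmap_add[OF lm, of x y] by (simp add: coset_add[OF L N] v L)
    next
      fix C c assume "C \<in> carrier ?Q"
      then obtain x where x: "x \<in> carrier L" "C = ?c x" by (auto simp: quot_simps)
      show "\<phi>' (cs[j := C]) \<in> carrier K" using x linmap_closed[OF lm, of x] by (simp add: v)
      show "\<phi>' (cs[j := c \<odot>\<^bsub>?Q\<^esub> C]) = c \<odot>\<^bsub>K\<^esub> \<phi>' (cs[j := C])"
        using x linmap_smult[OF lm, of x c] by (simp add: coset_smult[OF L N] v L)
    qed
  qed
  then show ?thesis using val by blast
qed

locale augmented_algebra =
  fixes L :: "('k::field, 'l) module" and \<epsilon> :: "'l \<Rightarrow> 'k"
  assumes L: "vspace L"
    and bilin_mult: "bilin L L L (\<lambda>x y. x \<otimes>\<^bsub>L\<^esub> y)"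
    and one_closed [simp]: "\<one>\<^bsub>L\<^esub> \<in> carrier L"
    and one_mult [simp]: "x \<in> carrier L \<Longrightarrow> \<one>\<^bsub>L\<^esub> \<otimes>\<^bsub>L\<^esub> x = x"
    and mult_one [simp]: "x \<in> carrier L \<Longrightarrow> x \<otimes>\<^bsub>L\<^esub> \<one>\<^bsub>L\<^esub> = x"
    and eps: "linmap L scalars \<epsilon>"
    and eps_one [simp]: "\<epsilon> \<one>\<^bsub>L\<^esub> = 1"
    and eps_mult: "x \<in> carrier L \<Longrightarrow> y \<in> carrier L \<Longrightarrow> \<epsilon> (x \<otimes>\<^bsub>L\<^esub> y) = \<epsilon> x * \<epsilon> y"
begin

abbreviation "B \<equiv> reduced L"
abbreviation "cls \<equiv> reduced_class L"
abbreviation "gen \<equiv> bar_gen L"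

lemma mult_closed [simp]: "x \<in> carrier L \<Longrightarrow> y \<in> carrier L \<Longrightarrow> x \<otimes>\<^bsub>L\<^esub> y \<in> carrier L"
  using bilin_mult by (auto simp: bilin_def linmap_def)

lemma linmap_mult_left: "y \<in> carrier L \<Longrightarrow> linmap L L (\<lambda>x. x \<otimes>\<^bsub>L\<^esub> y)"
  and linmap_mult_right: "x \<in> carrier L \<Longrightarrow> linmap L L (\<lambda>y. x \<otimes>\<^bsub>L\<^esub> y)"
  using bilin_mult by (simp_all add: bilin_def)

lemma subsp_unit_line: "subsp L (unit_line L)"
  unfolding subsp_def unit_line_def
proof (intro conjI ballI allI)
  show "\<zero>\<^bsub>L\<^esub> \<in> {c \<odot>\<^bsub>L\<^esub> \<one>\<^bsub>L\<^esub> |c. True}" using vs_zero_smult[OF L one_closed] by (metis (mono_tags) mem_Collect_eq)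
qed (auto simp: L vs_add_smult[OF L, symmetric] vs_mult_smult[OF L, symmetric])

lemma vspace_B: "vspace B"
  unfolding reduced_def by (rule vspace_quot[OF L subsp_unit_line])

lemma linmap_cls: "linmap L B cls"
  unfolding reduced_def reduced_class_def by (rule linmap_coset[OF L subsp_unit_line])

text \<open>
  The representative of the class of \<open>y\<close> in the augmentation ideal is \<open>y - \<epsilon>(y) \<cdot> 1\<close>.
\<close>
lemma B_cases: "C \<in> carrier B \<Longrightarrow> \<exists>x\<in>carrier L. \<epsilon> x = 0 \<and> C = cls x"
proof -
  assume "C \<in> carrier B"
  then obtain y where y: "y \<in> carrier L" "C = cls y"
    unfolding reduced_def reduced_class_def by (rule quot_cases[OF L subsp_unit_line])
  let ?x = "y \<ominus>\<^bsub>L\<^esub> \<epsilon> y \<odot>\<^bsub>L\<^esub> \<one>\<^bsub>L\<^esub>"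
  have x: "?x \<in> carrier L" using y L by simp
  have "\<epsilon> ?x = 0"
    using y by (simp add: linmap_minus[OF L vspace_scalars eps] L linmap_smult[OF eps])
  moreover have "y \<ominus>\<^bsub>L\<^esub> ?x = \<epsilon> y \<odot>\<^bsub>L\<^esub> \<one>\<^bsub>L\<^esub>"
    using y L vs_minus_add_cancel[OF L, of y "\<epsilon> y \<odot>\<^bsub>L\<^esub> \<one>\<^bsub>L\<^esub>"] x
      vs_add_minus_cancel[OF L, of "\<epsilon> y \<odot>\<^bsub>L\<^esub> \<one>\<^bsub>L\<^esub>" ?x] by (simp add: vs_comm[OF L])
  then have "y \<ominus>\<^bsub>L\<^esub> ?x \<in> unit_line L" by (auto simp: unit_line_def)
  then have "cls y = cls ?x"
    unfolding reduced_class_def using coset_eq_iff[OF L subsp_unit_line y(1) x] by simp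
  ultimately show ?thesis using x y by blast
qed

lemma cls_one: "cls \<one>\<^bsub>L\<^esub> = \<zero>\<^bsub>B\<^esub>"
  unfolding reduced_def reduced_class_def
  by (subst coset_eq_zero_iff[OF L subsp_unit_line]) (auto simp: unit_line_def intro: exI[of _ 1] simp: L)

lemma map_cls_tuples: "ys \<in> tuples L p \<Longrightarrow> map cls ys \<in> tuples B p"
  using linmap_closed[OF linmap_cls] by (auto simp: tuples_def)

lemma tuples_B_cases:
  assumes "cs \<in> tuples B p"
  shows "\<exists>ys\<in>tuples L p. (\<forall>y\<in>set ys. \<epsilon> y = 0) \<and> cs = map cls ys"
proof -
  have "\<forall>C\<in>set cs. \<exists>x. x \<in> carrier L \<and> \<epsilon> x = 0 \<and> C = cls x" using assms B_cases by (force simp: tuples_def)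
  then obtain h where "\<forall>C\<in>set cs. h C \<in> carrier L \<and> \<epsilon> (h C) = 0 \<and> C = cls (h C)" by (rule bchoice[THEN exE])
  then show ?thesis using assms
    by (intro bexI[of _ "map h cs"]) (auto simp: tuples_def map_idI comp_def)
qed

lemmas vspace_Bp = vspace_tpow[OF vspace_B]

lemma vspace_bar: "vspace (bar L p)"
  unfolding bar_def by (rule vspace_tensor[OF L vspace_Bp])

lemma bilin_bar: "bilin L (tpow B p) (bar L p) (pure_tensor L (tpow B p))"
  unfolding bar_def by (rule bilin_pure_tensor[OF L vspace_Bp])

lemma gen_eq: "ys \<in> tuples L p \<Longrightarrow> gen x ys = pure_tensor L (tpow B p) x (pure_tpow B (map cls ys))"
  by (simp add: bar_gen_def tuples_length)

lemma pure_cls_closed: "ys \<in> tuples L p \<Longrightarrow> pure_tpow B (map cls ys) \<in> carrier (tpow B p)"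
  by (intro pure_tpow_closed[OF vspace_B] map_cls_tuples)

lemma tpow_B_span: "carrier (tpow B p) \<subseteq> span_in (tpow B p) ((\<lambda>ys. pure_tpow B (map cls ys)) ` {ys \<in> tuples L p. \<forall>y\<in>set ys. \<epsilon> y = 0})"
proof -
  have "pure_tpow B ` tuples B p \<subseteq> (\<lambda>ys. pure_tpow B (map cls ys)) ` {ys \<in> tuples L p. \<forall>y\<in>set ys. \<epsilon> y = 0}"
    using tuples_B_cases by fastforce
  then have "span_in (tpow B p) (pure_tpow B ` tuples B p) \<subseteq> span_in (tpow B p) ((\<lambda>ys. pure_tpow B (map cls ys)) ` {ys \<in> tuples L p. \<forall>y\<in>set ys. \<epsilon> y = 0})"
    by (intro span_mono[OF vspace_Bp]) (auto intro: pure_cls_closed)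
  then show ?thesis using tpow_span[OF vspace_B] by blast
qed

lemma gen_closed: "x \<in> carrier L \<Longrightarrow> ys \<in> tuples L p \<Longrightarrow> gen x ys \<in> carrier (bar L p)"
  unfolding bar_def by (simp add: gen_eq pure_tensor_closed[OF L vspace_Bp] pure_cls_closed)

lemma linmap_gen: "ys \<in> tuples L p \<Longrightarrow> linmap L (bar L p) (\<lambda>x. gen x ys)"
  using bilin_bar pure_cls_closed by (simp add: gen_eq bilin_def)

lemma multilin_gen: "x \<in> carrier L \<Longrightarrow> multilin L p (bar L p) (gen x)"
proof -
  assume x: "x \<in> carrier L"
  have "linmap (tpow B p) (bar L p) (pure_tensor L (tpow B p) x)" using bilin_bar x by (simp add: bilin_def)
  from multilin_comp[OF multilin_map[OF L multilin_pure_tpow[OF vspace_B] linmap_cls] this]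
  show ?thesis by (subst multilin_cong[OF L]) (simp_all add: gen_eq)
qed

lemma bar_span: "carrier (bar L p) \<subseteq> span_in (bar L p) {gen x ys | x ys. x \<in> carrier L \<and> ys \<in> tuples L p}"
proof -
  have LL: "carrier L \<subseteq> span_in L (carrier L)" using span_superset[OF L] by blast
  let ?Y = "(\<lambda>ys. pure_tpow B (map cls ys)) ` {ys \<in> tuples L p. \<forall>y\<in>set ys. \<epsilon> y = 0}"
  have "?Y \<subseteq> carrier (tpow B p)" by (auto intro: pure_cls_closed)
  from tensor_span_gen[OF L vspace_Bp subset_refl LL this tpow_B_span]
  have "carrier (bar L p) \<subseteq> span_in (bar L p) {pure_tensor L (tpow B p) x y | x y. x \<in> carrier L \<and> y \<in> ?Y}"
    unfolding bar_def .
  also have "\<dots> \<subseteq> span_in (bar L p) {gen x ys | x ys. x \<in> carrier L \<and> ys \<in> tuples L p}"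
  proof (intro span_mono[OF vspace_bar] subsetI)
    fix s assume "s \<in> {pure_tensor L (tpow B p) x y | x y. x \<in> carrier L \<and> y \<in> ?Y}"
    then obtain x ys where "x \<in> carrier L" "ys \<in> tuples L p" "s = pure_tensor L (tpow B p) x (pure_tpow B (map cls ys))"
      by blast
    then show "s \<in> {gen x ys | x ys. x \<in> carrier L \<and> ys \<in> tuples L p}"
      using gen_eq by blast
  qed (auto intro: gen_closed)
  finally show ?thesis .
qed

lemma lin_bar_eqI:
  assumes "vspace K" "f \<in> lin (bar L p) K" "g \<in> lin (bar L p) K"
    and "\<And>x ys. x \<in> carrier L \<Longrightarrow> ys \<in> tuples L p \<Longrightarrow> f (gen x ys) = g (gen x ys)"
  shows "f = g"
  by (rule lin_eqI[OF vspace_bar assms(1-3) _ bar_span]) (use assms(4) gen_closed in auto)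

subsection \<open>Homomorphisms from the bar resolution to the ground field\<close>

lemma bar_act_props:
  assumes a: "a \<in> carrier L"
  shows "linmap (bar L p) (bar L p) (bar_act L p a)"
    and "\<And>x y. x \<in> carrier L \<Longrightarrow> y \<in> carrier (tpow B p) \<Longrightarrow>
      bar_act L p a (pure_tensor L (tpow B p) x y) = pure_tensor L (tpow B p) (a \<otimes>\<^bsub>L\<^esub> x) y"
proof -
  have "bilin L (tpow B p) (bar L p) (\<lambda>x y. pure_tensor L (tpow B p) (a \<otimes>\<^bsub>L\<^esub> x) y)"
    unfolding bilin_def
  proof (intro conjI ballI)
    fix y assume "y \<in> carrier (tpow B p)"
    then have "linmap L (bar L p) (\<lambda>x. pure_tensor L (tpow B p) x y)" using bilin_bar by (simp add: bilin_def)
    from linmap_comp[OF linmap_mult_right[OF a] this]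
    show "linmap L (bar L p) (\<lambda>x. pure_tensor L (tpow B p) (a \<otimes>\<^bsub>L\<^esub> x) y)" .
  next
    fix x assume "x \<in> carrier L"
    then have "a \<otimes>\<^bsub>L\<^esub> x \<in> carrier L" using a by simp
    then show "linmap (tpow B p) (bar L p) (pure_tensor L (tpow B p) (a \<otimes>\<^bsub>L\<^esub> x))"
      using bilin_bar unfolding bilin_def by blast
  qed
  then have "\<exists>h\<in>lin (bar L p) (bar L p). \<forall>x\<in>carrier L. \<forall>y\<in>carrier (tpow B p).
      h (pure_tensor L (tpow B p) x y) = pure_tensor L (tpow B p) (a \<otimes>\<^bsub>L\<^esub> x) y"
    by (rule tensor_lift[OF L vspace_Bp vspace_bar, folded bar_def])
  then obtain h where
    h: "h \<in> lin (bar L p) (bar L p)" "\<forall>x\<in>carrier L. \<forall>y\<in>carrier (tpow B p). h (pure_tensor L (tpow B p) x y) = pure_tensor L (tpow B p) (a \<otimes>\<^bsub>L\<^esub> x) y"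
    by blast
  have "bar_act L p a = h"
    unfolding bar_act_def
  proof (rule the_lin_eqI)
    show "h \<in> lin (bar L p) (bar L p)" by (rule h(1))
    show "\<forall>x\<in>carrier L. \<forall>y\<in>carrier (tpow B p).
      h (pure_tensor L (tpow B p) x y) = pure_tensor L (tpow B p) (a \<otimes>\<^bsub>L\<^esub> x) y" by (rule h(2))
    fix f assume f: "f \<in> lin (bar L p) (bar L p)" and fv: "\<forall>x\<in>carrier L. \<forall>y\<in>carrier (tpow B p).
      f (pure_tensor L (tpow B p) x y) = pure_tensor L (tpow B p) (a \<otimes>\<^bsub>L\<^esub> x) y"
    show "f = h"
      by (rule lin_bar_eqI[OF vspace_bar f h(1)]) (simp add: gen_eq pure_cls_closed fv h(2))
  qed
  then show "linmap (bar L p) (bar L p) (bar_act L p a)"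
    "\<And>x y. x \<in> carrier L \<Longrightarrow> y \<in> carrier (tpow B p) \<Longrightarrow>
      bar_act L p a (pure_tensor L (tpow B p) x y) = pure_tensor L (tpow B p) (a \<otimes>\<^bsub>L\<^esub> x) y"
    using h by (auto simp: lin_iff)
qed

lemma bar_homI:
  assumes f: "f \<in> lin (bar L p) scalars"
    and v: "\<And>x ys. x \<in> carrier L \<Longrightarrow> ys \<in> tuples L p \<Longrightarrow> f (gen x ys) = \<epsilon> x * f (gen \<one>\<^bsub>L\<^esub> ys)"
  shows "f \<in> bar_hom L \<epsilon> p"
  unfolding bar_hom_def
proof (intro CollectI conjI f ballI)
  fix a b assume a: "a \<in> carrier L" and b: "b \<in> carrier (bar L p)"
  show "f (bar_act L p a b) = \<epsilon> a * f b"
  proof (rule linmap_eq_on_span[OF vspace_bar vspace_scalars, of p "\<lambda>b. f (bar_act L p a b)" "\<lambda>b. \<epsilon> a * f b" "{gen x ys | x ys. x \<in> carrier L \<and> ys \<in> tuples L p}" b])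
    show "linmap (bar L p) scalars (\<lambda>b. f (bar_act L p a b))"
      by (rule linmap_comp[OF bar_act_props(1)[OF a] lin_linmap[OF f]])
    show "linmap (bar L p) scalars (\<lambda>b. \<epsilon> a * f b)"
      using linmap_smult_fun[OF vspace_scalars lin_linmap[OF f], of "\<epsilon> a"] by simp
    show "b \<in> span_in (bar L p) {gen x ys |x ys. x \<in> carrier L \<and> ys \<in> tuples L p}"
      using bar_span b by blast
    fix s assume "s \<in> {gen x ys |x ys. x \<in> carrier L \<and> ys \<in> tuples L p}"
    then obtain x ys where s: "s = gen x ys" "x \<in> carrier L" "ys \<in> tuples L p" by blast
    have "bar_act L p a s = gen (a \<otimes>\<^bsub>L\<^esub> x) ys"
      using s by (simp add: gen_eq bar_act_props(2)[OF a] pure_cls_closed)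
    then show "f (bar_act L p a s) = \<epsilon> a * f s"
      using s a v[of "a \<otimes>\<^bsub>L\<^esub> x" ys] v[of x ys] by (simp add: eps_mult)
  qed (auto intro: gen_closed)
qed

lemma bar_hom_pure:
  assumes f: "f \<in> bar_hom L \<epsilon> p" and x: "x \<in> carrier L" and y: "y \<in> carrier (tpow B p)"
  shows "f (pure_tensor L (tpow B p) x y) = \<epsilon> x * f (pure_tensor L (tpow B p) \<one>\<^bsub>L\<^esub> y)"
proof -
  have "pure_tensor L (tpow B p) \<one>\<^bsub>L\<^esub> y \<in> carrier (bar L p)"
    unfolding bar_def using y by (simp add: pure_tensor_closed[OF L vspace_Bp])
  then have "f (bar_act L p x (pure_tensor L (tpow B p) \<one>\<^bsub>L\<^esub> y)) = \<epsilon> x * f (pure_tensor L (tpow B p) \<one>\<^bsub>L\<^esub> y)"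
    using f x by (auto simp: bar_hom_def)
  then show ?thesis using x y by (simp add: bar_act_props(2)[OF x])
qed

lemma bar_hom_gen:
  "f \<in> bar_hom L \<epsilon> p \<Longrightarrow> x \<in> carrier L \<Longrightarrow> ys \<in> tuples L p \<Longrightarrow> f (gen x ys) = \<epsilon> x * f (gen \<one>\<^bsub>L\<^esub> ys)"
  using bar_hom_pure[of f p x] by (simp add: gen_eq pure_cls_closed)

lemma bar_hom_lin: "f \<in> bar_hom L \<epsilon> p \<Longrightarrow> f \<in> lin (bar L p) scalars"
  by (simp add: bar_hom_def)

lemma bar_restrict_gen:
  "ys \<in> tuples L p \<Longrightarrow> bar_restrict L p f (pure_tpow B (map cls ys)) = f (gen \<one>\<^bsub>L\<^esub> ys)"
  by (simp add: bar_restrict_def pure_cls_closed gen_eq)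

text \<open>
  The inverse sends a functional \<open>g\<close> to the homomorphism \<open>x \<otimes> m \<mapsto> \<epsilon>(x) g(m)\<close>.
\<close>
lemma bij_bar_restrict: "bij_betw (bar_restrict L p) (bar_hom L \<epsilon> p) (carrier (dual (tpow B p)))"
proof (rule bij_betwI')
  fix f g assume f: "f \<in> bar_hom L \<epsilon> p" and g: "g \<in> bar_hom L \<epsilon> p"
  show "bar_restrict L p f = bar_restrict L p g \<longleftrightarrow> f = g"
  proof
    assume e: "bar_restrict L p f = bar_restrict L p g"
    show "f = g"
      by (rule lin_bar_eqI[OF vspace_scalars bar_hom_lin[OF f] bar_hom_lin[OF g]])
        (metis bar_hom_gen[OF f] bar_hom_gen[OF g] bar_restrict_gen e)
  qed simp
next
  fix f assume f: "f \<in> bar_hom L \<epsilon> p"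
  have "linmap (tpow B p) scalars (\<lambda>m. f (pure_tensor L (tpow B p) \<one>\<^bsub>L\<^esub> m))"
    by (rule linmap_comp[OF _ lin_linmap[OF bar_hom_lin[OF f]]]) (use bilin_bar in \<open>simp add: bilin_def\<close>)
  then show "bar_restrict L p f \<in> carrier (dual (tpow B p))"
    unfolding bar_restrict_def dual_simps by (rule lin_restrict[OF vspace_Bp])
next
  fix g assume "g \<in> carrier (dual (tpow B p))"
  then have g: "g \<in> lin (tpow B p) scalars" by (simp add: dual_simps)
  have "bilin L (tpow B p) scalars (\<lambda>x m. \<epsilon> x * g m)"
    using linmap_scale[OF eps] linmap_smult_fun[OF vspace_scalars lin_linmap[OF g]] by (auto simp: bilin_def)
  then have "\<exists>f\<in>lin (bar L p) scalars. \<forall>x\<in>carrier L. \<forall>m\<in>carrier (tpow B p).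
      f (pure_tensor L (tpow B p) x m) = \<epsilon> x * g m"
    by (rule tensor_lift[OF L vspace_Bp vspace_scalars, folded bar_def])
  then obtain f where
    f: "f \<in> lin (bar L p) scalars" "\<And>x m. x \<in> carrier L \<Longrightarrow> m \<in> carrier (tpow B p) \<Longrightarrow> f (pure_tensor L (tpow B p) x m) = \<epsilon> x * g m"
    by blast
  have "f \<in> bar_hom L \<epsilon> p"
    by (rule bar_homI[OF f(1)]) (simp add: gen_eq f(2) pure_cls_closed)
  moreover have "g = bar_restrict L p f"
    using g f(2) by (auto simp: bar_restrict_def fun_eq_iff restrict_def lin_iff extensional_def)
  ultimately show "\<exists>f\<in>bar_hom L \<epsilon> p. g = bar_restrict L p f" by blast
qed

end

subsection \<open>The differential\<close>

lemma contract_Suc: "contract L (Suc j) ys = take j ys @ (ys ! j \<otimes>\<^bsub>L\<^esub> ys ! Suc j) # drop (Suc (Suc j)) ys"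
  by (simp add: contract_def)

lemma contract_length: "Suc j < length ys \<Longrightarrow> length (contract L (Suc j) ys) = length ys - 1"
  by (simp add: contract_Suc)

lemma contract_nth:
  assumes "Suc j < length ys" "m < length ys - 1"
  shows "contract L (Suc j) ys ! m =
    (if m < j then ys ! m else if m = j then ys ! j \<otimes>\<^bsub>L\<^esub> ys ! Suc j else ys ! Suc m)"
  using assms by (auto simp: contract_Suc nth_append nth_Cons' Suc_diff_Suc)

text \<open>
  A change of the entry \<open>i\<close> changes a single entry of the contracted list, which is one of the two factors
  of the product if \<open>i\<close> is \<open>j\<close> or \<open>j + 1\<close>. This is the situation of \<open>multilin_slot\<close>.
\<close>
lemma contract_update:
  assumes j: "Suc j < length ys" and i: "i < length ys"
  shows "contract L (Suc j) (ys[i := y]) = (contract L (Suc j) ys)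
    [(if i \<le> j then i else i - 1) :=
     (if i = j then y \<otimes>\<^bsub>L\<^esub> ys ! Suc j else if i = Suc j then ys ! j \<otimes>\<^bsub>L\<^esub> y else y)]"
proof (rule nth_equalityI)
  fix m assume "m < length (contract L (Suc j) (ys[i := y]))"
  then have m: "m < length ys - 1" using j by (simp add: contract_length)
  consider "i < j" | "i = j" | "i = Suc j" | "i > Suc j" by linarith
  then show "contract L (Suc j) (ys[i := y]) ! m = (contract L (Suc j) ys)
    [(if i \<le> j then i else i - 1) :=
     (if i = j then y \<otimes>\<^bsub>L\<^esub> ys ! Suc j else if i = Suc j then ys ! j \<otimes>\<^bsub>L\<^esub> y else y)] ! m"
    using j i m by cases (auto simp: contract_length contract_nth nth_list_update)
qed (use j in \<open>simp add: contract_length\<close>)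

context augmented_algebra
begin

lemma gen_unit_zero:
  assumes "x \<in> carrier L" "ys \<in> tuples L p" "i < p" "ys ! i = \<one>\<^bsub>L\<^esub>"
  shows "gen x ys = \<zero>\<^bsub>bar L p\<^esub>"
proof -
  have m: "multilin B p (bar L p) (\<lambda>cs. pure_tensor L (tpow B p) x (pure_tpow B cs))"
    using bilin_bar assms(1)
    by (intro multilin_comp[OF multilin_pure_tpow[OF vspace_B]]) (simp add: bilin_def)
  show ?thesis
    using multilin_zero[OF vspace_B vspace_bar m map_cls_tuples[OF assms(2)] assms(3)] assms
    by (simp add: gen_eq tuples_length cls_one)
qed

text \<open>The summands of the bar differential, indexed from \<open>0\<close> to \<open>p + 1\<close>.\<close>
definition face :: "nat \<Rightarrow> 'l \<Rightarrow> nat \<Rightarrow> 'l list \<Rightarrow> ('l \<times> ('l set list \<Rightarrow>\<^sub>0 'k) set \<Rightarrow>\<^sub>0 'k) set" where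
  "face p x j ys =
     (if j = 0 then gen (x \<otimes>\<^bsub>L\<^esub> hd ys) (tl ys)
      else if j \<le> p then (- 1) ^ j \<odot>\<^bsub>bar L p\<^esub> gen x (contract L j ys)
      else ((- 1) ^ Suc p * \<epsilon> (last ys)) \<odot>\<^bsub>bar L p\<^esub> gen x (butlast ys))"

lemma contract_tuples:
  assumes "ys \<in> tuples L (Suc p)" "0 < j" "j \<le> p"
  shows "contract L j ys \<in> tuples L p"
proof -
  obtain i where i: "j = Suc i" using assms(2) by (cases j) auto
  then have "ys ! i \<in> carrier L" "ys ! Suc i \<in> carrier L" using assms by (auto intro: tuples_nth)
  then show ?thesis using assms i by (auto simp: tuples_def contract_Suc dest: in_set_takeD in_set_dropD)
qed

lemma hd_closed: "ys \<in> tuples L (Suc p) \<Longrightarrow> hd ys \<in> carrier L"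
  and tl_tuples: "ys \<in> tuples L (Suc p) \<Longrightarrow> tl ys \<in> tuples L p"
  and butlast_tuples: "ys \<in> tuples L (Suc p) \<Longrightarrow> butlast ys \<in> tuples L p"
  by (cases ys; auto simp: tuples_def dest: in_set_butlastD)+

lemma face_closed:
  assumes "x \<in> carrier L" "ys \<in> tuples L (Suc p)"
  shows "face p x j ys \<in> carrier (bar L p)"
  using assms hd_closed[OF assms(2)]
  by (simp add: face_def gen_closed tl_tuples butlast_tuples contract_tuples vspace_bar)

lemma linmap_face:
  assumes ys: "ys \<in> tuples L (Suc p)"
  shows "linmap L (bar L p) (\<lambda>x. face p x j ys)"
proof -
  have "linmap L (bar L p) (\<lambda>x. gen (x \<otimes>\<^bsub>L\<^esub> hd ys) (tl ys))"
    by (rule linmap_comp[OF linmap_mult_left[OF hd_closed[OF ys]] linmap_gen[OF tl_tuples[OF ys]]])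
  moreover have "linmap L (bar L p) (\<lambda>x. c \<odot>\<^bsub>bar L p\<^esub> gen x (butlast ys))" for c
    by (intro linmap_smult_fun[OF vspace_bar] linmap_gen butlast_tuples ys)
  moreover have "linmap L (bar L p) (\<lambda>x. c \<odot>\<^bsub>bar L p\<^esub> gen x (contract L j ys))" if "0 < j" "j \<le> p" for c
    by (intro linmap_smult_fun[OF vspace_bar] linmap_gen contract_tuples ys that)
  ultimately show ?thesis unfolding face_def by (cases "j = 0"; cases "j \<le> p") simp_all
qed

lemma multilin_face:
  assumes x: "x \<in> carrier L"
  shows "multilin L (Suc p) (bar L p) (face p x j)"
proof -
  consider "j = 0" | i where "j = Suc i" "i < p" | "p < j" by (cases j) (auto, linarith)
  then show ?thesis
  proof cases
    case 1
    have "multilin L (Suc p) (bar L p) (\<lambda>ys. gen (x \<otimes>\<^bsub>L\<^esub> hd ys) (tl ys))"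
      unfolding multilin_def
    proof (intro ballI conjI allI impI)
      fix ys i assume ys: "ys \<in> tuples L (Suc p)"
      then show "gen (x \<otimes>\<^bsub>L\<^esub> hd ys) (tl ys) \<in> carrier (bar L p)"
        using x hd_closed[OF ys] by (simp add: gen_closed tl_tuples)
      assume i: "i < Suc p"
      obtain z zs where yz: "ys = z # zs" using ys by (cases ys) (auto simp: tuples_def)
      show "linmap L (bar L p) (\<lambda>y. gen (x \<otimes>\<^bsub>L\<^esub> hd (ys[i := y])) (tl (ys[i := y])))"
      proof (cases i)
        case 0
        then show ?thesis
          using linmap_comp[OF linmap_mult_right[OF x] linmap_gen[OF tl_tuples[OF ys]]] yz by simp
      next
        case (Suc i')
        have "x \<otimes>\<^bsub>L\<^esub> z \<in> carrier L" "zs \<in> tuples L p" "i' < p" using x yz ys i Suc by (auto simp: tuples_def)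
        then show ?thesis
          using multilin_linmap[OF multilin_gen[of "x \<otimes>\<^bsub>L\<^esub> z" p]] yz Suc by simp
      qed
    qed
    then show ?thesis using 1 by (simp add: face_def[abs_def])
  next
    case (2 k)
    have "multilin L (Suc p) (bar L p) (\<lambda>ys. gen x (contract L (Suc k) ys))"
    proof (rule multilin_slot[OF L multilin_gen[OF x]])
      show "contract L (Suc k) ys \<in> tuples L p" if "ys \<in> tuples L (Suc p)" for ys
        using that 2 by (intro contract_tuples) auto
      fix ys i assume ys: "ys \<in> tuples L (Suc p)" and i: "i < Suc p"
      have c: "ys ! Suc k \<in> carrier L" "ys ! k \<in> carrier L" using ys 2 by (auto intro: tuples_nth)
      let ?h = "\<lambda>y. if i = k then y \<otimes>\<^bsub>L\<^esub> ys ! Suc k else if i = Suc k then ys ! k \<otimes>\<^bsub>L\<^esub> y else y"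
      have "linmap L L ?h"
        using linmap_mult_left[OF c(1)] linmap_mult_right[OF c(2)] by (auto simp: linmap_def)
      moreover have "(if i \<le> k then i else i - 1) < p" using 2 i by auto
      ultimately show "\<exists>i'<p. \<exists>h. linmap L L h \<and>
          (\<forall>y\<in>carrier L. contract L (Suc k) (ys[i := y]) = (contract L (Suc k) ys)[i' := h y])"
        using ys i 2 by (intro exI[of _ "if i \<le> k then i else i - 1"] exI[of _ ?h] conjI ballI contract_update)
          (auto simp: tuples_length)
    qed
    then have "multilin L (Suc p) (bar L p) (\<lambda>ys. (- 1) ^ Suc k \<odot>\<^bsub>bar L p\<^esub> gen x (contract L (Suc k) ys))"
      by (rule multilin_smult[OF vspace_bar])
    then show ?thesis using 2 by (simp add: face_def[abs_def])
  next
    case 3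
    have "multilin L (Suc p) (bar L p) (\<lambda>ys. ((- 1) ^ Suc p * \<epsilon> (last ys)) \<odot>\<^bsub>bar L p\<^esub> gen x (butlast ys))"
      unfolding multilin_def
    proof (intro ballI conjI allI impI)
      fix ys i assume ys: "ys \<in> tuples L (Suc p)"
      then show "((- 1) ^ Suc p * \<epsilon> (last ys)) \<odot>\<^bsub>bar L p\<^esub> gen x (butlast ys) \<in> carrier (bar L p)"
        using x by (intro vs_smult[OF vspace_bar] gen_closed butlast_tuples)
      assume i: "i < Suc p"
      obtain z zs where yz: "ys = zs @ [z]" using ys by (cases ys rule: rev_cases) (auto simp: tuples_def)
      have zs: "zs \<in> tuples L p" "length zs = p" using ys yz by (auto simp: tuples_def)
      show "linmap L (bar L p) (\<lambda>y. ((- 1) ^ Suc p * \<epsilon> (last (ys[i := y]))) \<odot>\<^bsub>bar L p\<^esub> gen x (butlast (ys[i := y])))"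
      proof (cases "i = p")
        case True
        have "linmap L (bar L p) (\<lambda>y. ((- 1) ^ Suc p * \<epsilon> y) \<odot>\<^bsub>bar L p\<^esub> gen x zs)"
          using linmap_smult_fun[OF vspace_scalars eps, of "(- 1) ^ Suc p"] x zs
          by (intro linmap_smult_const[OF vspace_bar]) (simp_all add: gen_closed)
        then show ?thesis using True yz zs by (simp add: list_update_append)
      next
        case False
        then have ip: "i < p" using i by simp
        have "linmap L (bar L p) (\<lambda>y. ((- 1) ^ Suc p * \<epsilon> z) \<odot>\<^bsub>bar L p\<^esub> gen x (zs[i := y]))"
          by (rule linmap_smult_fun[OF vspace_bar multilin_linmap[OF multilin_gen[OF x] zs(1) ip]])
        then show ?thesis using ip yz zs(2) by (simp add: list_update_append)
      qed
    qed
    then show ?thesis using 3 by (simp add: face_def[abs_def])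
  qed
qed

text \<open>
  Unless a face merges or drops the entry \<open>1\<close> at position \<open>i\<close>, this entry survives as a tensor factor
  whose class in \<open>\<Lambda>/k\<close> is zero.
\<close>
lemma face_unit_other:
  assumes x: "x \<in> carrier L" and ys: "ys \<in> tuples L (Suc p)" and i: "i \<le> p" "ys ! i = \<one>\<^bsub>L\<^esub>"
    and j: "j \<le> Suc p" "j \<noteq> i" "j \<noteq> Suc i"
  shows "face p x j ys = \<zero>\<^bsub>bar L p\<^esub>"
proof -
  have l: "length ys = Suc p" using ys by (rule tuples_length)
  consider "j = 0" | k where "j = Suc k" "k < p" "i < k" | k where "j = Suc k" "k < p" "i > Suc k" | "j = Suc p"
    using j by (cases j) (auto, linarith)
  then show ?thesis
  proof cases
    case 1
    then have "tl ys ! (i - 1) = \<one>\<^bsub>L\<^esub>" using l i j by (simp add: nth_tl)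
    moreover have "x \<otimes>\<^bsub>L\<^esub> hd ys \<in> carrier L" "i - 1 < p" using x hd_closed[OF ys] i j 1 by auto
    ultimately show ?thesis
      using 1 gen_unit_zero[OF _ tl_tuples[OF ys]] by (simp add: face_def)
  next
    case (2 k)
    have "contract L j ys \<in> tuples L p" using 2 ys by (intro contract_tuples) auto
    moreover have "contract L j ys ! i = \<one>\<^bsub>L\<^esub>" using 2 i l by (simp add: contract_nth)
    ultimately have "gen x (contract L j ys) = \<zero>\<^bsub>bar L p\<^esub>" using 2 by (intro gen_unit_zero[OF x]) auto
    then show ?thesis using 2 by (simp add: face_def vspace_bar)
  next
    case (3 k)
    have "contract L j ys \<in> tuples L p" using 3 ys by (intro contract_tuples) auto
    moreover have "contract L j ys ! (i - 1) = \<one>\<^bsub>L\<^esub>" using 3 i l by (auto simp: contract_nth)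
    ultimately have "gen x (contract L j ys) = \<zero>\<^bsub>bar L p\<^esub>"
      using 3 i by (intro gen_unit_zero[OF x, of _ _ "i - 1"]) auto
    then show ?thesis using 3 by (simp add: face_def vspace_bar)
  next
    case 4
    have "butlast ys ! i = \<one>\<^bsub>L\<^esub>" using 4 i j l by (simp add: nth_butlast)
    then have "gen x (butlast ys) = \<zero>\<^bsub>bar L p\<^esub>"
      using 4 i j by (intro gen_unit_zero[OF x butlast_tuples[OF ys], of i]) auto
    then show ?thesis using 4 by (simp add: face_def vspace_bar)
  qed
qed

text \<open>
  The faces \<open>i\<close> and \<open>i + 1\<close> absorb the entry \<open>1\<close> at position \<open>i\<close> into its left and its right neighbour; both
  delete it from the list, and they differ in sign only. At the ends of the list the neighbours are the
  module factor \<open>x\<close> and the ground field.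
\<close>
lemma face_unit_left:
  assumes x: "x \<in> carrier L" and ys: "ys \<in> tuples L (Suc p)" and i: "i \<le> p" "ys ! i = \<one>\<^bsub>L\<^esub>"
  shows "face p x i ys = (- 1) ^ i \<odot>\<^bsub>bar L p\<^esub> gen x (take i ys @ drop (Suc i) ys)"
proof (cases i)
  case 0
  obtain z zs where yz: "ys = z # zs" using ys by (cases ys) (auto simp: tuples_def)
  then have "zs \<in> tuples L p" using ys by (auto simp: tuples_def)
  then show ?thesis using 0 i x yz by (simp add: face_def vspace_bar gen_closed)
next
  case (Suc i')
  have "contract L i ys = take i ys @ drop (Suc i) ys"
    using Suc i ys tuples_nth[OF ys, of i'] by (simp add: contract_Suc take_Suc_conv_app_nth tuples_length)
  then show ?thesis using Suc i by (simp add: face_def)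
qed

lemma face_unit_right:
  assumes x: "x \<in> carrier L" and ys: "ys \<in> tuples L (Suc p)" and i: "i \<le> p" "ys ! i = \<one>\<^bsub>L\<^esub>"
  shows "face p x (Suc i) ys = (- 1) ^ Suc i \<odot>\<^bsub>bar L p\<^esub> gen x (take i ys @ drop (Suc i) ys)"
proof (cases "i = p")
  case True
  have l: "length ys = Suc p" using ys by (rule tuples_length)
  then have "ys \<noteq> []" by auto
  then have "last ys = \<one>\<^bsub>L\<^esub>" "butlast ys = take i ys @ drop (Suc i) ys"
    using True l i by (auto simp: last_conv_nth butlast_conv_take)
  then show ?thesis using True by (simp add: face_def)
next
  case False
  then have "contract L (Suc i) ys = take i ys @ drop (Suc i) ys"
    using i ys tuples_nth[OF ys, of "Suc i"] by (simp add: contract_Suc Cons_nth_drop_Suc tuples_length)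
  then show ?thesis using False i by (simp add: face_def)
qed

text \<open>
  This is why the sum of the faces depends only on the classes modulo \<open>k\<close> of the entries. By linearity
  a scalar entry may be taken to be \<open>1\<close>, and then the two faces next to it cancel while all others vanish.
\<close>
lemma sum_faces_unit_line:
  assumes x: "x \<in> carrier L" and ys: "ys \<in> tuples L (Suc p)" and i: "i < Suc p" and u: "ys ! i \<in> unit_line L"
  shows "finsum (bar L p) (\<lambda>j. face p x j ys) {0..Suc p} = \<zero>\<^bsub>bar L p\<^esub>"
proof -
  let ?K = "bar L p" and ?f = "\<lambda>ys. finsum (bar L p) (\<lambda>j. face p x j ys) {0..Suc p}"
  have m: "multilin L (Suc p) ?K ?f" by (intro multilin_finsum vspace_bar multilin_face x)
  obtain c where c: "ys ! i = c \<odot>\<^bsub>L\<^esub> \<one>\<^bsub>L\<^esub>" using u by (auto simp: unit_line_def)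
  define zs where "zs = ys[i := \<one>\<^bsub>L\<^esub>]"
  have z: "zs \<in> tuples L (Suc p)" "zs ! i = \<one>\<^bsub>L\<^esub>" "i \<le> p" using ys i by (auto simp: tuples_length zs_def)
  let ?g = "gen x (take i zs @ drop (Suc i) zs)"
  have "take i zs @ drop (Suc i) zs \<in> tuples L p"
    using z by (auto simp: tuples_def dest!: in_set_takeD in_set_dropD)
  then have g: "?g \<in> carrier ?K" by (rule gen_closed[OF x])
  have fc: "face p x j zs \<in> carrier ?K" for j by (rule face_closed[OF x z(1)])
  have "finsum ?K (\<lambda>j. face p x j zs) {i, Suc i} = ?f zs"
    using face_unit_other[OF x z(1) z(3,2)] i fc by (intro vs_finsum_mono[OF vspace_bar]) auto
  also have "finsum ?K (\<lambda>j. face p x j zs) {i, Suc i} = face p x i zs \<oplus>\<^bsub>?K\<^esub> face p x (Suc i) zs"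
    using fc by (simp add: vs_finsum_insert[OF vspace_bar] vs_finsum_empty[OF vspace_bar] vspace_bar)
  also have "\<dots> = ((- 1) ^ i + (- 1) ^ Suc i) \<odot>\<^bsub>?K\<^esub> ?g"
    unfolding face_unit_left[OF x z(1) z(3,2)] face_unit_right[OF x z(1) z(3,2)]
    by (rule vs_add_smult[OF vspace_bar g, symmetric])
  also have "\<dots> = \<zero>\<^bsub>?K\<^esub>" using g by (simp add: vspace_bar)
  finally have 1: "?f zs = \<zero>\<^bsub>?K\<^esub>" by (rule sym)
  have 2: "?f (ys[i := c \<odot>\<^bsub>L\<^esub> \<one>\<^bsub>L\<^esub>]) = c \<odot>\<^bsub>?K\<^esub> ?f zs"
    unfolding zs_def by (rule linmap_smult[OF multilin_linmap[OF m ys i]]) simp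
  show ?thesis
    using 2 unfolding 1 c[symmetric] list_update_id vs_smult_zero[OF vspace_bar] .
qed

lemma sum_faces:
  assumes "x \<in> carrier L" "ys \<in> tuples L (Suc p)"
  shows "gen (x \<otimes>\<^bsub>L\<^esub> hd ys) (tl ys)
         \<oplus>\<^bsub>bar L p\<^esub> (\<Oplus>\<^bsub>bar L p\<^esub> j\<in>{1..p}. (- 1) ^ j \<odot>\<^bsub>bar L p\<^esub> gen x (contract L j ys))
         \<oplus>\<^bsub>bar L p\<^esub> ((- 1) ^ Suc p * \<epsilon> (last ys)) \<odot>\<^bsub>bar L p\<^esub> gen x (butlast ys) =
         finsum (bar L p) (\<lambda>j. face p x j ys) {0..Suc p}"
proof -
  let ?K = "bar L p" and ?f = "\<lambda>j. face p x j ys"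
  note K = vspace_bar[of p]
  have fc: "?f j \<in> carrier ?K" for j by (rule face_closed[OF assms])
  have sc: "finsum ?K ?f A \<in> carrier ?K" for A by (intro vs_finsum_closed[OF K] fc)
  have "{0..Suc p} = insert 0 (insert (Suc p) {1..p})" by auto
  then have "finsum ?K ?f {0..Suc p} = ?f 0 \<oplus>\<^bsub>?K\<^esub> (?f (Suc p) \<oplus>\<^bsub>?K\<^esub> finsum ?K ?f {1..p})"
    using fc sc by (simp add: vs_finsum_insert[OF K] K)
  also have "\<dots> = ?f 0 \<oplus>\<^bsub>?K\<^esub> finsum ?K ?f {1..p} \<oplus>\<^bsub>?K\<^esub> ?f (Suc p)"
    unfolding vs_comm[OF K fc[of "Suc p"] sc] by (rule vs_assoc[OF K fc sc fc, symmetric])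
  also have "finsum ?K ?f {1..p} = finsum ?K (\<lambda>j. (- 1) ^ j \<odot>\<^bsub>?K\<^esub> gen x (contract L j ys)) {1..p}"
  proof (rule vs_finsum_cong[OF K])
    fix j assume j: "j \<in> {1..p}"
    show e: "?f j = (- 1) ^ j \<odot>\<^bsub>?K\<^esub> gen x (contract L j ys)" using j by (auto simp: face_def)
    show "(- 1) ^ j \<odot>\<^bsub>?K\<^esub> gen x (contract L j ys) \<in> carrier ?K" using fc[of j] e by simp
  qed
  finally show ?thesis by (simp add: face_def)
qed

text \<open>
  For fixed \<open>x\<close> the sum of the faces descends to the tensor power of \<open>\<Lambda>/k\<close>; the map so obtained is also
  linear in \<open>x\<close> and therefore factors through the tensor product with \<open>\<Lambda>\<close>.
\<close>
lemma bar_diff_props: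
  shows bar_diff_lin: "bar_diff L \<epsilon> (Suc p) \<in> lin (bar L (Suc p)) (bar L p)"
    and bar_diff_gen: "\<And>x ys. x \<in> carrier L \<Longrightarrow> ys \<in> tuples L (Suc p) \<Longrightarrow>
      bar_diff L \<epsilon> (Suc p) (gen x ys) = finsum (bar L p) (\<lambda>j. face p x j ys) {0..Suc p}"
proof -
  let ?K = "bar L p" and ?f = "\<lambda>x ys. finsum (bar L p) (\<lambda>j. face p x j ys) {0..Suc p}"
  let ?q = "Suc p"
  note K = vspace_bar[of p]
  have "\<exists>h\<in>lin (tpow B ?q) ?K. \<forall>ys\<in>tuples L ?q. h (pure_tpow B (map cls ys)) = ?f x ys" if x: "x \<in> carrier L" for x
  proof -
    have m: "multilin L ?q ?K (?f x)" by (intro multilin_finsum K multilin_face x)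
    have "\<exists>\<phi>. multilin B ?q ?K \<phi> \<and> (\<forall>ys\<in>tuples L ?q. \<phi> (map (\<lambda>x. unit_line L +>\<^bsub>L\<^esub> x) ys) = ?f x ys)"
      unfolding reduced_def
      by (rule multilin_descend[OF L subsp_unit_line K m sum_faces_unit_line[OF x]])
    then obtain \<phi> where phi: "multilin B ?q ?K \<phi>" "\<And>ys. ys \<in> tuples L ?q \<Longrightarrow> \<phi> (map cls ys) = ?f x ys"
      unfolding reduced_class_def[abs_def] by blast
    from tpow_lift[OF vspace_B K phi(1)] obtain h where "h \<in> lin (tpow B ?q) ?K" "\<forall>cs\<in>tuples B ?q. h (pure_tpow B cs) = \<phi> cs"
      by blast
    then show ?thesis using phi(2) map_cls_tuples by (intro bexI[of _ h]) auto
  qed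
  then obtain \<Psi> where Psi: "\<And>x. x \<in> carrier L \<Longrightarrow> \<Psi> x \<in> lin (tpow B ?q) ?K"
    "\<And>x ys. x \<in> carrier L \<Longrightarrow> ys \<in> tuples L ?q \<Longrightarrow> \<Psi> x (pure_tpow B (map cls ys)) = ?f x ys"
    by metis
  note Pl = lin_linmap[OF Psi(1)]
  let ?Y = "(\<lambda>ys. pure_tpow B (map cls ys)) ` {ys \<in> tuples L ?q. \<forall>y\<in>set ys. \<epsilon> y = 0}"
  have Y: "?Y \<subseteq> carrier (tpow B ?q)" by (auto intro: pure_cls_closed)
  have f: "linmap L ?K (\<lambda>x. ?f x ys)" if "ys \<in> tuples L ?q" for ys
    by (intro linmap_finsum_fun K linmap_face that)
  \<comment> \<open>Linearity in \<open>x\<close> is inherited from the faces, as it can be checked at tensors of classes.\<close>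
  have "bilin L (tpow B ?q) ?K \<Psi>"
    unfolding bilin_def
  proof (intro conjI ballI Pl linmapI)
    fix x y m assume x: "x \<in> carrier L" and y: "y \<in> carrier L" and m: "m \<in> carrier (tpow B ?q)"
    show "\<Psi> (x \<oplus>\<^bsub>L\<^esub> y) m = \<Psi> x m \<oplus>\<^bsub>?K\<^esub> \<Psi> y m"
    proof (rule linmap_eq_on_span[OF vspace_Bp K Pl linmap_add_fun[OF K Pl[OF x] Pl[OF y]] Y])
      show "x \<oplus>\<^bsub>L\<^esub> y \<in> carrier L" using x y L by simp
      show "m \<in> span_in (tpow B ?q) ?Y" using m tpow_B_span by blast
      fix s assume "s \<in> ?Y"
      then show "\<Psi> (x \<oplus>\<^bsub>L\<^esub> y) s = \<Psi> x s \<oplus>\<^bsub>?K\<^esub> \<Psi> y s"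
        using linmap_add[OF f x y] x y L by (auto simp: Psi)
    qed
  next
    fix x c m assume x: "x \<in> carrier L" and m: "m \<in> carrier (tpow B ?q)"
    show "\<Psi> x m \<in> carrier ?K" by (rule linmap_closed[OF Pl[OF x] m])
    show "\<Psi> (c \<odot>\<^bsub>L\<^esub> x) m = c \<odot>\<^bsub>?K\<^esub> \<Psi> x m"
    proof (rule linmap_eq_on_span[OF vspace_Bp K Pl linmap_smult_fun[OF K Pl[OF x]] Y])
      show "c \<odot>\<^bsub>L\<^esub> x \<in> carrier L" using x L by simp
      show "m \<in> span_in (tpow B ?q) ?Y" using m tpow_B_span by blast
      fix s assume "s \<in> ?Y"
      then show "\<Psi> (c \<odot>\<^bsub>L\<^esub> x) s = c \<odot>\<^bsub>?K\<^esub> \<Psi> x s"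
        using linmap_smult[OF f x] x L by (auto simp: Psi)
    qed
  qed
  then have "\<exists>d\<in>lin (bar L ?q) ?K. \<forall>x\<in>carrier L. \<forall>m\<in>carrier (tpow B ?q). d (pure_tensor L (tpow B ?q) x m) = \<Psi> x m"
    unfolding bar_def[of L ?q] by (rule tensor_lift[OF L vspace_Bp K])
  then obtain d where d: "d \<in> lin (bar L ?q) ?K"
    "\<And>x m. x \<in> carrier L \<Longrightarrow> m \<in> carrier (tpow B ?q) \<Longrightarrow> d (pure_tensor L (tpow B ?q) x m) = \<Psi> x m"
    by blast
  have dg: "d (gen x ys) = ?f x ys" if "x \<in> carrier L" "ys \<in> tuples L ?q" for x ys
    using that by (simp only: gen_eq d(2) pure_cls_closed Psi)
  have "bar_diff L \<epsilon> ?q = d"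
    unfolding bar_diff_def diff_Suc_1
  proof (rule the_lin_eqI, rule d(1))
    show "\<forall>x\<in>carrier L. \<forall>ys\<in>tuples L ?q. d (gen x ys) = gen (x \<otimes>\<^bsub>L\<^esub> hd ys) (tl ys)
         \<oplus>\<^bsub>?K\<^esub> (\<Oplus>\<^bsub>?K\<^esub> j\<in>{1..p}. (- 1) ^ j \<odot>\<^bsub>?K\<^esub> gen x (contract L j ys))
         \<oplus>\<^bsub>?K\<^esub> ((- 1) ^ ?q * \<epsilon> (last ys)) \<odot>\<^bsub>?K\<^esub> gen x (butlast ys)"
      by (intro ballI) (simp only: dg sum_faces)
    fix d' assume d': "d' \<in> lin (bar L ?q) ?K"
      and v: "\<forall>x\<in>carrier L. \<forall>ys\<in>tuples L ?q. d' (gen x ys) = gen (x \<otimes>\<^bsub>L\<^esub> hd ys) (tl ys)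
         \<oplus>\<^bsub>?K\<^esub> (\<Oplus>\<^bsub>?K\<^esub> j\<in>{1..p}. (- 1) ^ j \<odot>\<^bsub>?K\<^esub> gen x (contract L j ys))
         \<oplus>\<^bsub>?K\<^esub> ((- 1) ^ ?q * \<epsilon> (last ys)) \<odot>\<^bsub>?K\<^esub> gen x (butlast ys)"
    show "d' = d"
      by (rule lin_bar_eqI[OF K d' d(1)]) (simp only: dg sum_faces v)
  qed
  then show "bar_diff L \<epsilon> ?q \<in> lin (bar L ?q) ?K"
    "\<And>x ys. x \<in> carrier L \<Longrightarrow> ys \<in> tuples L ?q \<Longrightarrow> bar_diff L \<epsilon> ?q (gen x ys) = ?f x ys"
    using d(1) dg by simp_all
qed

lemma bar_hom_face:
  assumes f: "f \<in> bar_hom L \<epsilon> p" and x: "x \<in> carrier L" and ys: "ys \<in> tuples L (Suc p)"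
  shows "f (face p x j ys) = \<epsilon> x *
    (if j = 0 then \<epsilon> (hd ys) * f (gen \<one>\<^bsub>L\<^esub> (tl ys))
     else if j \<le> p then (- 1) ^ j * f (gen \<one>\<^bsub>L\<^esub> (contract L j ys))
     else (- 1) ^ Suc p * \<epsilon> (last ys) * f (gen \<one>\<^bsub>L\<^esub> (butlast ys)))"
proof -
  note fl = lin_linmap[OF bar_hom_lin[OF f]]
  note 1 = tl_tuples[OF ys] butlast_tuples[OF ys] contract_tuples[OF ys] hd_closed[OF ys]
  have "x \<otimes>\<^bsub>L\<^esub> hd ys \<in> carrier L" using x 1 by simp
  then show ?thesis
    using x 1 bar_hom_gen[OF f, of x] bar_hom_gen[OF f, of "x \<otimes>\<^bsub>L\<^esub> hd ys"]
    by (auto simp: face_def linmap_smult[OF fl] gen_closed eps_mult)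
qed

lemma bar_codiff_gen:
  assumes f: "f \<in> bar_hom L \<epsilon> p" and x: "x \<in> carrier L" and ys: "ys \<in> tuples L (Suc p)"
  shows "bar_codiff L \<epsilon> (Suc p) f (gen x ys) = (\<Sum>j\<in>{0..Suc p}. f (face p x j ys))"
proof -
  have "gen x ys \<in> carrier (bar L (Suc p))" by (rule gen_closed[OF x ys])
  then have "bar_codiff L \<epsilon> (Suc p) f (gen x ys) = f (finsum (bar L p) (\<lambda>j. face p x j ys) {0..Suc p})"
    using bar_diff_gen[OF x ys] by (simp only: bar_codiff_def compose_eq)
  also have "\<dots> = (\<Sum>j\<in>{0..Suc p}. f (face p x j ys))"
    using face_closed[OF x ys] by (intro linmap_sum[OF vspace_bar lin_linmap[OF bar_hom_lin[OF f]]]) simp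
  finally show ?thesis .
qed

lemma bar_codiff_hom:
  assumes f: "f \<in> bar_hom L \<epsilon> p"
  shows "bar_codiff L \<epsilon> (Suc p) f \<in> bar_hom L \<epsilon> (Suc p)"
proof (rule bar_homI)
  have "linmap (bar L (Suc p)) scalars (\<lambda>b. f (bar_diff L \<epsilon> (Suc p) b))"
    by (rule linmap_comp[OF lin_linmap[OF bar_diff_lin] lin_linmap[OF bar_hom_lin[OF f]]])
  then show "bar_codiff L \<epsilon> (Suc p) f \<in> lin (bar L (Suc p)) scalars"
    unfolding bar_codiff_def compose_def by (rule lin_restrict[OF vspace_bar])
  fix x ys assume x: "x \<in> carrier L" and ys: "ys \<in> tuples L (Suc p)"
  show "bar_codiff L \<epsilon> (Suc p) f (gen x ys) = \<epsilon> x * bar_codiff L \<epsilon> (Suc p) f (gen \<one>\<^bsub>L\<^esub> ys)"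
    unfolding bar_codiff_gen[OF f x ys] bar_codiff_gen[OF f one_closed ys] sum_distrib_left
    by (intro sum.cong) (simp_all only: bar_hom_face[OF f x ys] bar_hom_face[OF f one_closed ys] eps_one mult_1_left)
qed

text \<open>
  The outer faces carry the factors \<open>\<epsilon>(y\<^sub>1)\<close> and \<open>\<epsilon>(y\<^sub>p\<^sub>+\<^sub>1)\<close>: the first because a homomorphism sees the module
  factor only through \<open>\<epsilon>\<close>, the last by definition.
\<close>
lemma bar_codiff_aug_ideal:
  assumes f: "f \<in> bar_hom L \<epsilon> p" and ys: "ys \<in> tuples L (Suc p)" and e: "\<And>y. y \<in> set ys \<Longrightarrow> \<epsilon> y = 0"
  shows "bar_codiff L \<epsilon> (Suc p) f (gen \<one>\<^bsub>L\<^esub> ys) = (\<Sum>j\<in>{1..p}. (- 1) ^ j * f (gen \<one>\<^bsub>L\<^esub> (contract L j ys)))"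
proof -
  have "ys \<noteq> []" using ys by (auto simp: tuples_def)
  then have 0: "\<epsilon> (hd ys) = 0" "\<epsilon> (last ys) = 0" using e by simp_all
  have "{0..Suc p} = insert 0 (insert (Suc p) {1..p})" by auto
  then show ?thesis
    unfolding bar_codiff_gen[OF f one_closed ys] bar_hom_face[OF f one_closed ys]
    using 0 by simp
qed

end

section \<open>The free algebra\<close>

text \<open>
  The multiplication of the free algebra on its own: as a total operation it satisfies the algebra laws
  without conditions on carriers.
\<close>
definition word_mult :: "('s list \<Rightarrow>\<^sub>0 'k::field) \<Rightarrow> ('s list \<Rightarrow>\<^sub>0 'k) \<Rightarrow> ('s list \<Rightarrow>\<^sub>0 'k)" where
  "word_mult x y = (\<Sum>u\<in>Poly_Mapping.keys x. \<Sum>v\<in>Poly_Mapping.keys y.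
     Poly_Mapping.single (u @ v) (Poly_Mapping.lookup x u * Poly_Mapping.lookup y v))"

lemma word_mult_superset:
  assumes "finite U" "finite V" "Poly_Mapping.keys x \<subseteq> U" "Poly_Mapping.keys y \<subseteq> V"
  shows "word_mult x y = (\<Sum>u\<in>U. \<Sum>v\<in>V. Poly_Mapping.single (u @ v) (Poly_Mapping.lookup x u * Poly_Mapping.lookup y v))"
proof -
  have "(\<Sum>v\<in>Poly_Mapping.keys y. Poly_Mapping.single (u @ v) (Poly_Mapping.lookup x u * Poly_Mapping.lookup y v)) =
    (\<Sum>v\<in>V. Poly_Mapping.single (u @ v) (Poly_Mapping.lookup x u * Poly_Mapping.lookup y v))" for u
    using assms by (intro sum.mono_neutral_left) (auto simp: in_keys_iff)
  then show ?thesis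
    unfolding word_mult_def using assms by (simp, intro sum.mono_neutral_left) (auto simp: in_keys_iff)
qed

lemma word_mult_add_left: "word_mult (x + x') y = word_mult x y + word_mult x' y"
  using keys_add[of x x']
    word_mult_superset[of "Poly_Mapping.keys x \<union> Poly_Mapping.keys x'" "Poly_Mapping.keys y" _ y]
  by (simp add: lookup_add algebra_simps single_add sum.distrib)

lemma word_mult_add_right: "word_mult x (y + y') = word_mult x y + word_mult x y'"
  using keys_add[of y y']
    word_mult_superset[of "Poly_Mapping.keys x" "Poly_Mapping.keys y \<union> Poly_Mapping.keys y'" x]
  by (simp add: lookup_add algebra_simps single_add sum.distrib)

lemma word_mult_zero [simp]: "word_mult 0 y = 0" "word_mult x 0 = 0"
  by (simp_all add: word_mult_def)

lemma word_mult_single: "word_mult (Poly_Mapping.single u a) (Poly_Mapping.single v b) = Poly_Mapping.single (u @ v) (a * b)"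
  using word_mult_superset[of "{u}" "{v}" "Poly_Mapping.single u a" "Poly_Mapping.single v b"] by simp

lemma poly_mapping_single_induct:
  fixes x :: "'s \<Rightarrow>\<^sub>0 'k::field"
  assumes "P 0" "\<And>s c. s \<in> Poly_Mapping.keys x \<Longrightarrow> P (Poly_Mapping.single s c)" "\<And>x y. P x \<Longrightarrow> P y \<Longrightarrow> P (x + y)"
  shows "P x"
proof -
  have "P (\<Sum>s\<in>A. Poly_Mapping.single s (Poly_Mapping.lookup x s))" if "A \<subseteq> Poly_Mapping.keys x" for A
    using finite_subset[OF that finite_keys] that
    by (induction A rule: finite_induct) (auto intro: assms)
  then show ?thesis using poly_mapping_sum_singles[of x] by (metis subset_refl)
qed

lemma word_mult_assoc: "word_mult (word_mult x y) z = word_mult x (word_mult y z)"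
proof -
  have 1: "word_mult (word_mult (Poly_Mapping.single u a) (Poly_Mapping.single v b)) z =
      word_mult (Poly_Mapping.single u a) (word_mult (Poly_Mapping.single v b) z)" for u a v b
    by (rule poly_mapping_single_induct[of _ z]) (simp_all add: word_mult_add_right word_mult_single mult.assoc)
  have 2: "word_mult (word_mult (Poly_Mapping.single u a) y) z = word_mult (Poly_Mapping.single u a) (word_mult y z)" for u a
    by (rule poly_mapping_single_induct[of _ y]) (simp_all add: word_mult_add_right word_mult_add_left 1)
  show ?thesis
    by (rule poly_mapping_single_induct[of _ x]) (simp_all add: word_mult_add_left 2)
qed

lemma word_mult_scale_left:
  "word_mult (Poly_Mapping.map ((*) c) x) y = Poly_Mapping.map ((*) c) (word_mult x y)" for c :: "'k::field"
proof -
  have 0: "Poly_Mapping.map ((*) c) 0 = (0 :: 's list \<Rightarrow>\<^sub>0 'k)"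
    by (rule poly_mapping_eqI) (simp add: lookup_map_mult)
  have 1: "word_mult (Poly_Mapping.map ((*) c) (Poly_Mapping.single u a)) y = Poly_Mapping.map ((*) c) (word_mult (Poly_Mapping.single u a) y)" for u a
    by (rule poly_mapping_single_induct[of _ y]) (simp_all add: word_mult_add_right word_mult_single map_mult_single map_mult_add 0 mult.assoc)
  show ?thesis
    by (rule poly_mapping_single_induct[of _ x]) (simp_all add: word_mult_add_left map_mult_add 1[unfolded map_mult_single] map_mult_single 0)
qed

lemma scale_eq_word_mult: "Poly_Mapping.map ((*) c) x = word_mult (Poly_Mapping.single [] c) x"
  and word_mult_one: "word_mult x (Poly_Mapping.single [] 1) = x"
  for x :: "'s list \<Rightarrow>\<^sub>0 'k::field"
proof -
  have 0: "Poly_Mapping.map ((*) c) 0 = (0 :: 's list \<Rightarrow>\<^sub>0 'k)"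
    by (rule poly_mapping_eqI) (simp add: lookup_map_mult)
  show "Poly_Mapping.map ((*) c) x = word_mult (Poly_Mapping.single [] c) x"
    by (rule poly_mapping_single_induct[of _ x]) (simp_all add: word_mult_add_right word_mult_single map_mult_single map_mult_add 0)
  show "word_mult x (Poly_Mapping.single [] 1) = x"
    by (rule poly_mapping_single_induct[of _ x]) (simp_all add: word_mult_add_left word_mult_single)
qed

lemma word_mult_scale_right:
  "word_mult x (Poly_Mapping.map ((*) c) y) = Poly_Mapping.map ((*) c) (word_mult x y)" for c :: "'k::field"
proof -
  have 0: "Poly_Mapping.map ((*) c) 0 = (0 :: 's list \<Rightarrow>\<^sub>0 'k)"
    by (rule poly_mapping_eqI) (simp add: lookup_map_mult)
  have 1: "word_mult (Poly_Mapping.single u a) (Poly_Mapping.map ((*) c) y) = Poly_Mapping.map ((*) c) (word_mult (Poly_Mapping.single u a) y)" for u a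
    by (rule poly_mapping_single_induct[of _ y]) (simp_all add: word_mult_add_right word_mult_single map_mult_single map_mult_add 0 mult.left_commute)
  show ?thesis
    by (rule poly_mapping_single_induct[of _ x]) (simp_all add: word_mult_add_left map_mult_add 1[unfolded map_mult_single] map_mult_single 0)
qed

lemma keys_word_mult:
  assumes "Poly_Mapping.keys x \<subseteq> lists S" "Poly_Mapping.keys y \<subseteq> lists S"
  shows "Poly_Mapping.keys (word_mult x y) \<subseteq> lists S"
proof -
  have add: "Poly_Mapping.keys (p + q) \<subseteq> lists S"
    if "Poly_Mapping.keys p \<subseteq> lists S" "Poly_Mapping.keys q \<subseteq> lists S" for p q :: "'a list \<Rightarrow>\<^sub>0 'b"
    using that keys_add[of p q] by blast
  have 1: "Poly_Mapping.keys (word_mult (Poly_Mapping.single u a) y) \<subseteq> lists S" if "u \<in> lists S" for u a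
  proof (rule poly_mapping_single_induct[of _ y])
    fix v b assume "v \<in> Poly_Mapping.keys y"
    then have "u @ v \<in> lists S" using assms(2) that by auto
    then show "Poly_Mapping.keys (word_mult (Poly_Mapping.single u a) (Poly_Mapping.single v b)) \<subseteq> lists S"
      by (simp add: word_mult_single)
  qed (simp, simp only: word_mult_add_right add)
  show ?thesis
  proof (rule poly_mapping_single_induct[of _ x])
    fix u a assume "u \<in> Poly_Mapping.keys x"
    then have "u \<in> lists S" using assms(1) by blast
    then show "Poly_Mapping.keys (word_mult (Poly_Mapping.single u a) y) \<subseteq> lists S" by (rule 1)
  qed (simp, simp only: word_mult_add_left add)
qed

lemma free_algebra_simps:
  "carrier (free_algebra S :: ('k::field, _) module) = {x. Poly_Mapping.keys x \<subseteq> lists S}"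
  "x \<oplus>\<^bsub>free_algebra S :: ('k, _) module\<^esub> y = x + y"
  "x \<otimes>\<^bsub>free_algebra S :: ('k, _) module\<^esub> y = word_mult x y"
  "c \<odot>\<^bsub>free_algebra S :: ('k, _) module\<^esub> x = Poly_Mapping.map ((*) c) x"
  "\<zero>\<^bsub>free_algebra S :: ('k, _) module\<^esub> = 0"
  "\<one>\<^bsub>free_algebra S :: ('k, _) module\<^esub> = Poly_Mapping.single [] 1"
  by (simp_all add: free_algebra_def word_mult_def)

lemma vspace_free_algebra: "vspace (free_algebra S :: ('k::field, _) module)"
proof (rule vspaceI)
  let ?A = "free_algebra S :: ('k::field, _) module" and ?F = "free_space (lists S) :: ('k::field, _) module"
  note F = vspace_free[of "lists S"]
  note simps = free_algebra_simps free_space_simps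
  fix x assume x: "x \<in> carrier ?A"
  then have "- x \<in> carrier ?A" "x + - x = 0" by (simp_all add: simps)
  then show "\<exists>y\<in>carrier ?A. x \<oplus>\<^bsub>?A\<^esub> y = \<zero>\<^bsub>?A\<^esub>" unfolding simps by blast
qed (use vs_add[OF vspace_free[of "lists S"]] vs_smult[OF vspace_free[of "lists S"]]
      vs_mult_smult[OF vspace_free[of "lists S"]] vs_add_smult[OF vspace_free[of "lists S"]]
      vs_smult_add[OF vspace_free[of "lists S"]] vs_one_smult[OF vspace_free[of "lists S"]]
      in \<open>simp_all add: free_algebra_simps free_space_simps add_ac\<close>)

lemma ring_free_algebra: "ring (free_algebra S :: ('k::field, _) module)"
proof -
  let ?A = "free_algebra S :: ('k::field, _) module"
  interpret vectorspace class_ring ?A by (rule vspace_free_algebra)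
  show ?thesis
  proof (rule ringI)
    show "abelian_group ?A" by unfold_locales
    show "Group.monoid ?A"
    proof (rule monoidI)
      show "\<And>x. x \<in> carrier ?A \<Longrightarrow> \<one>\<^bsub>?A\<^esub> \<otimes>\<^bsub>?A\<^esub> x = x"
        using vs_one_smult[OF vspace_free_algebra, of _ S]
        by (simp only: free_algebra_simps scale_eq_word_mult)
    qed (simp_all only: free_algebra_simps mem_Collect_eq keys_word_mult word_mult_assoc word_mult_one, simp)
  qed (simp_all add: free_algebra_simps word_mult_add_left word_mult_add_right)
qed

section \<open>The exterior algebra\<close>

text \<open>
  A family of alternating multilinear maps, one for each number of arguments, given as one function on lists.
  Only adjacent equal entries are asked to give zero, as in the relations of the exterior algebra.
\<close>
definition alternating :: "('k::field, 'a) module \<Rightarrow> ('k, 'b) module \<Rightarrow> ('a list \<Rightarrow> 'b) \<Rightarrow> bool" where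
  "alternating W K \<phi> \<longleftrightarrow> (\<forall>ws\<in>lists (carrier W). \<phi> ws \<in> carrier K) \<and>
     (\<forall>us\<in>lists (carrier W). \<forall>vs\<in>lists (carrier W). linmap W K (\<lambda>x. \<phi> (us @ x # vs)) \<and>
        (\<forall>x\<in>carrier W. \<phi> (us @ x # x # vs) = \<zero>\<^bsub>K\<^esub>))"

context
  fixes W :: "('k::field, 'a) module"
  assumes W: "vspace W"
begin

abbreviation (input) FA :: "('k, 'a list \<Rightarrow>\<^sub>0 'k) module" where "FA \<equiv> free_algebra (carrier W)"
abbreviation (input) EI :: "('a list \<Rightarrow>\<^sub>0 'k) set" where "EI \<equiv> Idl\<^bsub>FA\<^esub> (ext_rels W)"

lemma single_FA [simp]: "ws \<in> lists (carrier W) \<Longrightarrow> Poly_Mapping.single ws c \<in> carrier FA"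
  by (auto simp: free_algebra_simps)

lemma minus_FA [simp]: "x \<in> carrier FA \<Longrightarrow> y \<in> carrier FA \<Longrightarrow> x - y \<in> carrier FA"
  using diff_free_closed[of x "lists (carrier W)" y] by (simp add: free_algebra_simps free_space_simps)

lemma ext_rels_FA: "ext_rels W \<subseteq> carrier FA"
proof -
  have "Poly_Mapping.single [x] c \<in> carrier FA" "Poly_Mapping.single [x, x] c \<in> carrier FA" if "x \<in> carrier W" for x c
    using that by (auto intro!: single_FA)
  then show ?thesis unfolding ext_rels_def using W by (auto intro!: minus_FA)
qed

lemma ideal_EI: "ideal EI FA"
  by (rule ring.genideal_ideal[OF ring_free_algebra ext_rels_FA])

lemma rels_EI: "r \<in> ext_rels W \<Longrightarrow> r \<in> EI"
  using ring.genideal_self[OF ring_free_algebra ext_rels_FA] by blast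

lemma subsp_EI: "subsp FA EI"
  unfolding subsp_def
proof (intro conjI ballI allI)
  interpret I: ideal EI FA by (rule ideal_EI)
  show "EI \<subseteq> carrier FA" by (rule I.a_subset)
  show "\<zero>\<^bsub>FA\<^esub> \<in> EI" by simp
  fix x assume x: "x \<in> EI"
  show "x \<oplus>\<^bsub>FA\<^esub> y \<in> EI" if "y \<in> EI" for y using x that by simp
  have "Poly_Mapping.single [] c \<otimes>\<^bsub>FA\<^esub> x \<in> EI" for c
    by (rule I.I_l_closed[OF x]) (simp add: single_FA)
  then show "c \<odot>\<^bsub>FA\<^esub> x \<in> EI" for c
    by (simp add: free_algebra_simps scale_eq_word_mult)
qed

lemma vspace_ext: "vspace (ext W)"
  unfolding ext_def by (rule vspace_quot[OF vspace_free_algebra subsp_EI])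

lemma linmap_ext_coset: "linmap FA (ext W) (\<lambda>x. EI +>\<^bsub>FA\<^esub> x)"
  unfolding ext_def by (rule linmap_coset[OF vspace_free_algebra subsp_EI])

lemma ext_cases:
  assumes "X \<in> carrier (ext W)"
  obtains x where "x \<in> carrier FA" "X = EI +>\<^bsub>FA\<^esub> x"
  using assms unfolding ext_def by (rule quot_cases[OF vspace_free_algebra subsp_EI])

lemma ext_mult_coset: "x \<in> carrier FA \<Longrightarrow> y \<in> carrier FA \<Longrightarrow>
    (EI +>\<^bsub>FA\<^esub> x) \<otimes>\<^bsub>ext W\<^esub> (EI +>\<^bsub>FA\<^esub> y) = EI +>\<^bsub>FA\<^esub> (x \<otimes>\<^bsub>FA\<^esub> y)"
  unfolding ext_def quot_simps by (rule ideal.rcoset_mult_add[OF ideal_EI])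

lemma FA_mult_closed: "x \<in> carrier FA \<Longrightarrow> y \<in> carrier FA \<Longrightarrow> x \<otimes>\<^bsub>FA\<^esub> y \<in> carrier FA"
  by (simp add: free_algebra_simps keys_word_mult)

lemma bilin_ext_mult: "bilin (ext W) (ext W) (ext W) (\<lambda>x y. x \<otimes>\<^bsub>ext W\<^esub> y)"
  unfolding bilin_def
proof (intro conjI ballI linmapI)
  note cs = linmap_closed[OF linmap_ext_coset] linmap_add[OF linmap_ext_coset, symmetric]
    linmap_smult[OF linmap_ext_coset, symmetric] ext_mult_coset FA_mult_closed
    vs_add[OF vspace_free_algebra] vs_smult[OF vspace_free_algebra]
  fix X Y Z c
  assume "X \<in> carrier (ext W)" "Y \<in> carrier (ext W)"
  then obtain x y where x: "x \<in> carrier FA" "X = EI +>\<^bsub>FA\<^esub> x" and y: "y \<in> carrier FA" "Y = EI +>\<^bsub>FA\<^esub> y"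
    by (metis ext_cases)
  show "X \<otimes>\<^bsub>ext W\<^esub> Y \<in> carrier (ext W)" "X \<otimes>\<^bsub>ext W\<^esub> Y \<in> carrier (ext W)" using x y by (simp_all only: cs)
  show "(c \<odot>\<^bsub>ext W\<^esub> X) \<otimes>\<^bsub>ext W\<^esub> Y = c \<odot>\<^bsub>ext W\<^esub> (X \<otimes>\<^bsub>ext W\<^esub> Y)"
    "X \<otimes>\<^bsub>ext W\<^esub> (c \<odot>\<^bsub>ext W\<^esub> Y) = c \<odot>\<^bsub>ext W\<^esub> (X \<otimes>\<^bsub>ext W\<^esub> Y)"
    using x y by (simp_all only: cs) (simp_all only: free_algebra_simps word_mult_scale_left word_mult_scale_right)
  assume "Z \<in> carrier (ext W)"
  then obtain z where z: "z \<in> carrier FA" "Z = EI +>\<^bsub>FA\<^esub> z" by (metis ext_cases)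
  show "(X \<oplus>\<^bsub>ext W\<^esub> Z) \<otimes>\<^bsub>ext W\<^esub> Y = (X \<otimes>\<^bsub>ext W\<^esub> Y) \<oplus>\<^bsub>ext W\<^esub> (Z \<otimes>\<^bsub>ext W\<^esub> Y)"
    "X \<otimes>\<^bsub>ext W\<^esub> (Y \<oplus>\<^bsub>ext W\<^esub> Z) = (X \<otimes>\<^bsub>ext W\<^esub> Y) \<oplus>\<^bsub>ext W\<^esub> (X \<otimes>\<^bsub>ext W\<^esub> Z)"
    using x y z by (simp_all only: cs) (simp_all only: free_algebra_simps word_mult_add_left word_mult_add_right)
qed

lemma wedge_closed: "ws \<in> lists (carrier W) \<Longrightarrow> wedge W ws \<in> carrier (ext W)"
  unfolding wedge_def by (rule linmap_closed[OF linmap_ext_coset]) simp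

lemma ext_one: "\<one>\<^bsub>ext W\<^esub> = wedge W []"
  by (simp add: ext_def quot_simps wedge_def free_algebra_simps)

lemma wedge_append: "us \<in> lists (carrier W) \<Longrightarrow> vs \<in> lists (carrier W) \<Longrightarrow>
    wedge W (us @ vs) = wedge W us \<otimes>\<^bsub>ext W\<^esub> wedge W vs"
  unfolding wedge_def by (subst ext_mult_coset) (auto simp: free_algebra_simps word_mult_single)

lemma ext_one_mult: "X \<in> carrier (ext W) \<Longrightarrow> \<one>\<^bsub>ext W\<^esub> \<otimes>\<^bsub>ext W\<^esub> X = X"
  and ext_mult_one: "X \<in> carrier (ext W) \<Longrightarrow> X \<otimes>\<^bsub>ext W\<^esub> \<one>\<^bsub>ext W\<^esub> = X"
proof -
  assume "X \<in> carrier (ext W)"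
  then obtain x where x: "x \<in> carrier FA" "X = EI +>\<^bsub>FA\<^esub> x" by (rule ext_cases)
  interpret ring FA by (rule ring_free_algebra)
  have o: "\<one>\<^bsub>ext W\<^esub> = EI +>\<^bsub>FA\<^esub> \<one>\<^bsub>FA\<^esub>" by (simp add: ext_def quot_simps)
  show "\<one>\<^bsub>ext W\<^esub> \<otimes>\<^bsub>ext W\<^esub> X = X" "X \<otimes>\<^bsub>ext W\<^esub> \<one>\<^bsub>ext W\<^esub> = X"
    unfolding o x(2) using x(1) by (simp_all only: ext_mult_coset one_closed l_one r_one)
qed

lemma ext_span: "carrier (ext W) \<subseteq> span_in (ext W) (wedge W ` lists (carrier W))"
proof
  fix X assume "X \<in> carrier (ext W)"
  then obtain x where x: "x \<in> carrier FA" "X = EI +>\<^bsub>FA\<^esub> x" by (rule ext_cases)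
  let ?S = "span_in (ext W) (wedge W ` lists (carrier W))"
  have sub: "wedge W ` lists (carrier W) \<subseteq> carrier (ext W)" by (auto intro: wedge_closed)
  note S = subsp_span[OF vspace_ext sub]
  have single: "EI +>\<^bsub>FA\<^esub> Poly_Mapping.single ws c \<in> ?S" if ws: "ws \<in> lists (carrier W)" for ws c
  proof -
    have "EI +>\<^bsub>FA\<^esub> Poly_Mapping.single ws c = c \<odot>\<^bsub>ext W\<^esub> wedge W ws"
      unfolding wedge_def linmap_smult[OF linmap_ext_coset single_FA[OF ws], symmetric]
      by (simp add: free_algebra_simps map_mult_single)
    then show ?thesis using S span_superset[OF vspace_ext sub, of "wedge W ws"] ws unfolding subsp_def by auto
  qed
  have "x \<in> carrier FA \<and> EI +>\<^bsub>FA\<^esub> x \<in> ?S"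
  proof (rule poly_mapping_single_induct[of _ x])
    show "0 \<in> carrier FA \<and> EI +>\<^bsub>FA\<^esub> 0 \<in> ?S"
      using single[of "[]" 0] by (simp add: free_algebra_simps)
    show "Poly_Mapping.single ws c \<in> carrier FA \<and> EI +>\<^bsub>FA\<^esub> Poly_Mapping.single ws c \<in> ?S"
      if "ws \<in> Poly_Mapping.keys x" for ws c
    proof -
      have "ws \<in> lists (carrier W)" using that x(1) unfolding free_algebra_simps by blast
      then show ?thesis using single by simp
    qed
    fix y z assume "y \<in> carrier FA \<and> EI +>\<^bsub>FA\<^esub> y \<in> ?S" "z \<in> carrier FA \<and> EI +>\<^bsub>FA\<^esub> z \<in> ?S"
    then have yz: "y \<in> carrier FA" "z \<in> carrier FA" "EI +>\<^bsub>FA\<^esub> y \<in> ?S" "EI +>\<^bsub>FA\<^esub> z \<in> ?S" by auto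
    have e: "y + z = y \<oplus>\<^bsub>FA\<^esub> z" by (simp add: free_algebra_simps)
    show "y + z \<in> carrier FA \<and> EI +>\<^bsub>FA\<^esub> (y + z) \<in> ?S"
      unfolding e linmap_add[OF linmap_ext_coset yz(1,2)]
      using S yz vs_add[OF vspace_free_algebra yz(1,2)] unfolding subsp_def by blast
  qed
  then show "X \<in> ?S" using x by simp
qed

lemma alternating_wedge: "alternating W (ext W) (wedge W)"
proof -
  have rel0: "EI +>\<^bsub>FA\<^esub> r = \<zero>\<^bsub>ext W\<^esub>" if "r \<in> ext_rels W" for r
    using coset_eq_zero_iff[OF vspace_free_algebra subsp_EI, of r] rels_EI[OF that] ext_rels_FA that
    unfolding ext_def by blast
  have minus: "EI +>\<^bsub>FA\<^esub> (x - y) = (EI +>\<^bsub>FA\<^esub> x) \<ominus>\<^bsub>ext W\<^esub> (EI +>\<^bsub>FA\<^esub> y)"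
    if "x \<in> carrier FA" "y \<in> carrier FA" for x y
  proof -
    have "x \<ominus>\<^bsub>FA\<^esub> y = x - y"
      using that vs_minus_add_cancel[OF vspace_free_algebra that] by (simp add: free_algebra_simps eq_diff_eq)
    then show ?thesis using linmap_minus[OF vspace_free_algebra vspace_ext linmap_ext_coset that] by simp
  qed
  note E = vspace_ext
  have c1: "wedge W [x] \<in> carrier (ext W)" if "x \<in> carrier W" for x using that by (intro wedge_closed) auto
  have s1: "Poly_Mapping.single [x] c \<in> carrier FA" if "x \<in> carrier W" for x c using that by (intro single_FA) auto
  have lin1: "linmap W (ext W) (\<lambda>x. wedge W [x])"
  proof (rule linmapI, rule c1)
    fix x y assume xy: "x \<in> carrier W" "y \<in> carrier W"
    have "Poly_Mapping.single [x \<oplus>\<^bsub>W\<^esub> y] 1 - Poly_Mapping.single [x] 1 - Poly_Mapping.single [y] 1 \<in> ext_rels W"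
      unfolding ext_rels_def using xy by blast
    from rel0[OF this] have "(wedge W [x \<oplus>\<^bsub>W\<^esub> y] \<ominus>\<^bsub>ext W\<^esub> wedge W [x]) \<ominus>\<^bsub>ext W\<^esub> wedge W [y] = \<zero>\<^bsub>ext W\<^esub>"
      unfolding wedge_def using xy W by (simp only: minus minus_FA s1 vs_add)
    then have "wedge W [x \<oplus>\<^bsub>W\<^esub> y] \<ominus>\<^bsub>ext W\<^esub> wedge W [x] = wedge W [y]"
      using xy W by (subst (asm) vs_minus_zero_iff[OF E]) (auto simp: E c1)
    then show "wedge W [x \<oplus>\<^bsub>W\<^esub> y] = wedge W [x] \<oplus>\<^bsub>ext W\<^esub> wedge W [y]"
      using vs_minus_add_cancel[OF E c1[of "x \<oplus>\<^bsub>W\<^esub> y"] c1[of x]] xy W vs_comm[OF E] c1 by simp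
  next
    fix c x assume x: "x \<in> carrier W"
    have "Poly_Mapping.single [c \<odot>\<^bsub>W\<^esub> x] 1 - Poly_Mapping.single [x] c \<in> ext_rels W"
      unfolding ext_rels_def using x by blast
    from rel0[OF this] have "wedge W [c \<odot>\<^bsub>W\<^esub> x] \<ominus>\<^bsub>ext W\<^esub> (EI +>\<^bsub>FA\<^esub> Poly_Mapping.single [x] c) = \<zero>\<^bsub>ext W\<^esub>"
      unfolding wedge_def using x W by (simp only: minus s1 vs_smult)
    moreover have "EI +>\<^bsub>FA\<^esub> Poly_Mapping.single [x] c = c \<odot>\<^bsub>ext W\<^esub> wedge W [x]"
      unfolding wedge_def linmap_smult[OF linmap_ext_coset s1[OF x], symmetric]
      by (simp add: free_algebra_simps map_mult_single)
    ultimately show "wedge W [c \<odot>\<^bsub>W\<^esub> x] = c \<odot>\<^bsub>ext W\<^esub> wedge W [x]"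
      using x W by (simp add: vs_minus_zero_iff[OF E] E c1)
  qed
  show ?thesis
    unfolding alternating_def
  proof (intro conjI ballI wedge_closed)
    fix us vs assume us: "us \<in> lists (carrier W)" and vs: "vs \<in> lists (carrier W)"
    note u = wedge_closed[OF us] and v = wedge_closed[OF vs]
    have "linmap W (ext W) (\<lambda>x. wedge W us \<otimes>\<^bsub>ext W\<^esub> (wedge W [x] \<otimes>\<^bsub>ext W\<^esub> wedge W vs))"
      using bilin_ext_mult u v unfolding bilin_def
      by (intro linmap_comp[OF linmap_comp[OF lin1, of "ext W" "\<lambda>z. z \<otimes>\<^bsub>ext W\<^esub> wedge W vs"], of "ext W" "\<lambda>z. wedge W us \<otimes>\<^bsub>ext W\<^esub> z"]) auto
    moreover have "wedge W us \<otimes>\<^bsub>ext W\<^esub> (wedge W [x] \<otimes>\<^bsub>ext W\<^esub> wedge W vs) = wedge W (us @ x # vs)" if "x \<in> carrier W" for x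
      using that us vs wedge_append[of us "[x] @ vs"] wedge_append[of "[x]" vs] by simp
    ultimately show "linmap W (ext W) (\<lambda>x. wedge W (us @ x # vs))"
      by (subst linmap_cong[OF W, symmetric]) auto
    fix x assume x: "x \<in> carrier W"
    have "Poly_Mapping.single [x, x] 1 \<in> ext_rels W" unfolding ext_rels_def using x by blast
    from rel0[OF this] have xx: "wedge W [x, x] = \<zero>\<^bsub>ext W\<^esub>" by (simp add: wedge_def)
    have "wedge W (us @ [x, x] @ vs) = wedge W us \<otimes>\<^bsub>ext W\<^esub> (wedge W [x, x] \<otimes>\<^bsub>ext W\<^esub> wedge W vs)"
      using x us vs wedge_append[of us "[x, x] @ vs"] wedge_append[of "[x, x]" vs] by simp
    also have "\<dots> = \<zero>\<^bsub>ext W\<^esub>"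
      unfolding xx using bilin_ext_mult u v unfolding bilin_def
      by (simp add: linmap_zero[OF E E, of "\<lambda>z. z \<otimes>\<^bsub>ext W\<^esub> wedge W vs"] linmap_zero[OF E E, of "\<lambda>z. wedge W us \<otimes>\<^bsub>ext W\<^esub> z"])
    finally show "wedge W (us @ x # x # vs) = \<zero>\<^bsub>ext W\<^esub>" by simp
  qed
qed

text \<open>
  The kernel of a linear map need not be an ideal; but the elements that it kills together with
  all their two-sided multiples by words do form one.
\<close>
lemma ext_lift:
  fixes K :: "('k, 'b) module"
  assumes K: "vspace K" and alt: "alternating W K \<phi>"
  shows "\<exists>h\<in>lin (ext W) K. \<forall>ws\<in>lists (carrier W). h (wedge W ws) = \<phi> ws"
proof -
  let ?L = "lists (carrier W)"
  let ?s = "\<lambda>u. Poly_Mapping.single u (1::'k)"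
  have phi: "\<phi> ws \<in> carrier K" if "ws \<in> ?L" for ws using alt that by (auto simp: alternating_def)
  obtain g where g0: "linmap (free_space ?L) K g" and gs: "\<And>s c. s \<in> ?L \<Longrightarrow> g (Poly_Mapping.single s c) = c \<odot>\<^bsub>K\<^esub> \<phi> s"
    using free_lift[where S="?L" and \<phi>=\<phi>, OF K phi] by blast
  have g: "linmap FA K g" using g0 by (simp add: linmap_def free_algebra_simps free_space_simps)
  \<comment> \<open>The largest two-sided ideal on which \<open>g\<close> vanishes.\<close>
  define J where "J = {x \<in> carrier FA. \<forall>u\<in>?L. \<forall>v\<in>?L. g (word_mult (?s u) (word_mult x (?s v))) = \<zero>\<^bsub>K\<^esub>}"
  have gadd: "g (x + y) = g x \<oplus>\<^bsub>K\<^esub> g y" if "x \<in> carrier FA" "y \<in> carrier FA" for x y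
    using linmap_add[OF g that] by (simp add: free_algebra_simps)
  have gscale: "g (Poly_Mapping.map ((*) c) x) = c \<odot>\<^bsub>K\<^esub> g x" if "x \<in> carrier FA" for x c
    using linmap_smult[OF g that] by (simp add: free_algebra_simps)
  have cl: "word_mult x y \<in> carrier FA" if "x \<in> carrier FA" "y \<in> carrier FA" for x y
    using FA_mult_closed[OF that] by (simp add: free_algebra_simps)
  have J0: "0 \<in> J" using gs[of "[]" 0] phi[of "[]"] by (auto simp: J_def free_algebra_simps K)
  have Jadd: "x + y \<in> J" if "x \<in> J" "y \<in> J" for x y
  proof -
    have "x + y \<in> carrier FA" using that vs_add[OF vspace_free_algebra, of x "carrier W" y] by (simp add: J_def free_algebra_simps)
    then show ?thesis using that
      by (auto simp: J_def word_mult_add_left word_mult_add_right gadd cl K simp del: in_lists_conv_set)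
  qed
  have Jmul: "word_mult (Poly_Mapping.single w c) x \<in> J" "word_mult x (Poly_Mapping.single w c) \<in> J"
    if x: "x \<in> J" and w: "w \<in> ?L" for x w c
  proof -
    have xc: "x \<in> carrier FA" using x by (simp add: J_def)
    have sw: "Poly_Mapping.single w c = Poly_Mapping.map ((*) c) (?s w)" by (simp add: map_mult_single)
    have "word_mult (?s u) (word_mult (word_mult (Poly_Mapping.single w c) x) (?s v)) =
      Poly_Mapping.map ((*) c) (word_mult (?s (u @ w)) (word_mult x (?s v)))" for u v
      unfolding sw word_mult_scale_left word_mult_scale_right
      by (simp add: word_mult_assoc[symmetric] word_mult_single)
    then show "word_mult (Poly_Mapping.single w c) x \<in> J"
      using x w xc cl by (auto simp: J_def gscale K simp del: in_lists_conv_set)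
    have "word_mult (?s u) (word_mult (word_mult x (Poly_Mapping.single w c)) (?s v)) =
      Poly_Mapping.map ((*) c) (word_mult (?s u) (word_mult x (?s (w @ v))))" for u v
      unfolding sw word_mult_scale_left word_mult_scale_right
      by (simp add: word_mult_assoc word_mult_single)
    then show "word_mult x (Poly_Mapping.single w c) \<in> J"
      using x w xc cl by (auto simp: J_def gscale K simp del: in_lists_conv_set)
  qed
  have "ideal J FA"
  proof (rule idealI[OF ring_free_algebra])
    interpret vectorspace class_ring FA by (rule vspace_free_algebra)
    show "subgroup J (add_monoid FA)"
    proof (rule M.add.subgroupI)
      show "J \<subseteq> carrier FA" by (auto simp: J_def)
      show "J \<noteq> {}" using J0 by blast
      fix a assume a: "a \<in> J"
      have "\<ominus>\<^bsub>FA\<^esub> a = word_mult (Poly_Mapping.single [] (- 1)) a"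
        using a by (subst vs_neg_eq[OF vspace_free_algebra]) (auto simp: J_def free_algebra_simps scale_eq_word_mult)
      then show "\<ominus>\<^bsub>FA\<^esub> a \<in> J" using Jmul(1)[OF a, of "[]" "- 1"] by simp
      fix b assume "b \<in> J"
      then show "a \<oplus>\<^bsub>FA\<^esub> b \<in> J" using Jadd[OF a] by (simp add: free_algebra_simps)
    qed
    fix a x assume a: "a \<in> J" and x: "x \<in> carrier FA"
    have k: "s \<in> ?L" if "s \<in> Poly_Mapping.keys x" for s using x that unfolding free_algebra_simps by blast
    show "x \<otimes>\<^bsub>FA\<^esub> a \<in> J"
      unfolding free_algebra_simps by (rule poly_mapping_single_induct[of _ x]) (simp_all add: J0 Jmul[OF a k] word_mult_add_left Jadd)
    show "a \<otimes>\<^bsub>FA\<^esub> x \<in> J"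
      unfolding free_algebra_simps by (rule poly_mapping_single_induct[of _ x]) (simp_all add: J0 Jmul[OF a k] word_mult_add_right Jadd)
  qed
  moreover have "ext_rels W \<subseteq> J"
  proof
    fix r assume r: "r \<in> ext_rels W"
    have "g (word_mult (?s u) (word_mult r (?s v))) = \<zero>\<^bsub>K\<^esub>" if u: "u \<in> ?L" and v: "v \<in> ?L" for u v
    proof -
      have lm: "linmap W K (\<lambda>x. \<phi> (u @ x # v))" and xx: "\<And>x. x \<in> carrier W \<Longrightarrow> \<phi> (u @ x # x # v) = \<zero>\<^bsub>K\<^esub>"
        using alt u v by (auto simp: alternating_def simp del: in_lists_conv_set)
      have diff: "word_mult (?s u) (word_mult (x - y) (?s v)) = word_mult (?s u) (word_mult x (?s v)) - word_mult (?s u) (word_mult y (?s v))" for x y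
        using word_mult_add_left[of "x - y" y "?s v"] word_mult_add_right[of "?s u" "word_mult (x - y) (?s v)" "word_mult y (?s v)"]
        by (simp add: eq_diff_eq)
      have in_L: "u @ x # v \<in> ?L" "u @ x # y # v \<in> ?L" if "x \<in> carrier W" "y \<in> carrier W" for x y using u v that by auto
      from r consider x y where "x \<in> carrier W" "y \<in> carrier W" "r = ?s [x \<oplus>\<^bsub>W\<^esub> y] - ?s [x] - ?s [y]"
        | c x where "x \<in> carrier W" "r = ?s [c \<odot>\<^bsub>W\<^esub> x] - Poly_Mapping.single [x] c"
        | x where "x \<in> carrier W" "r = ?s [x, x]"
        unfolding ext_rels_def by blast
      then show ?thesis
      proof cases
        case (1 x y)
        then show ?thesis
          using linmap_kills_additivity[OF K g0 gs phi, of "u @ (x \<oplus>\<^bsub>W\<^esub> y) # v" "u @ x # v" "u @ y # v"] in_L W linmap_add[OF lm]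
          by (simp add: diff word_mult_single)
      next
        case (2 c x)
        then show ?thesis
          using linmap_kills_homogeneity[OF K g0 gs phi, of "u @ (c \<odot>\<^bsub>W\<^esub> x) # v" "u @ x # v" c] in_L W linmap_smult[OF lm]
          by (simp add: diff word_mult_single)
      next
        case (3 x)
        then show ?thesis using gs[of "u @ x # x # v" 1] in_L xx by (simp add: word_mult_single K)
      qed
    qed
    then show "r \<in> J" using r ext_rels_FA by (auto simp: J_def)
  qed
  ultimately have "EI \<subseteq> J" by (rule ring.genideal_minimal[OF ring_free_algebra])
  have van: "g n = \<zero>\<^bsub>K\<^esub>" if n: "n \<in> EI" for n
  proof -
    have "g (word_mult (?s []) (word_mult n (?s []))) = \<zero>\<^bsub>K\<^esub>" using n \<open>EI \<subseteq> J\<close> by (auto simp: J_def)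
    moreover have "Poly_Mapping.map ((*) 1) n = n" by (rule poly_mapping_eqI) (simp add: lookup_map_mult)
    ultimately show ?thesis by (simp add: word_mult_one scale_eq_word_mult[symmetric])
  qed
  from quot_lift[OF vspace_free_algebra subsp_EI K g van]
  obtain h where h: "h \<in> lin (ext W) K" "\<forall>x\<in>carrier FA. h (EI +>\<^bsub>FA\<^esub> x) = g x"
    unfolding ext_def by blast
  show ?thesis
  proof (intro bexI[of _ h] ballI)
    fix ws assume ws: "ws \<in> ?L"
    show "h (wedge W ws) = \<phi> ws"
      unfolding wedge_def using h(2) single_FA[OF ws] gs[OF ws] phi[OF ws] K by simp
  qed (rule h)
qed

end

section \<open>A basis of the dual space\<close>

text \<open>The functionals are the coordinate functions with respect to a basis.\<close>
lemma dual_basis_exists: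
  fixes V :: "('k::field, 'v) module"
  assumes V: "vspace V" and fd: "vectorspace.fin_dim class_ring V"
  shows "\<exists>(n::nat) e f. e ` {..<n} \<subseteq> carrier V \<and> carrier V \<subseteq> span_in V (e ` {..<n}) \<and>
     f ` {..<n} \<subseteq> carrier (dual V) \<and> carrier (dual V) \<subseteq> span_in (dual V) (f ` {..<n}) \<and>
     (\<forall>i<n. \<forall>j<n. f i (e j) = (if i = j then 1 else 0))"
proof -
  interpret vectorspace class_ring V by (rule V)
  obtain A where A: "finite A" "basis A" using finite_basis_exists[OF fd] by blast
  have AV: "A \<subseteq> carrier V" "span_in V A = carrier V" using A(2) by (auto simp: basis_def)
  have AM: "b \<in> carrier V" if "b \<in> A" for b using AV(1) that by blast
  have uniq: "\<exists>!a. a \<in> A \<rightarrow>\<^sub>E UNIV \<and> lincomb a A = v" if "v \<in> carrier V" for v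
    using basis_criterion[OF A(1) AV(1)] A(2) that by simp
  define c where "c v = (THE a. a \<in> A \<rightarrow>\<^sub>E UNIV \<and> lincomb a A = v)" for v
  have c: "c v \<in> A \<rightarrow>\<^sub>E UNIV \<and> lincomb (c v) A = v" if "v \<in> carrier V" for v
    unfolding c_def by (rule theI'[OF uniq[OF that]])
  have c_eq: "c v b = a b" if "v \<in> carrier V" "lincomb a A = v" "b \<in> A" for v a b
  proof -
    have "lincomb (restrict a A) A = lincomb a A"
      unfolding lincomb_def by (intro vs_finsum_cong[OF V]) (simp_all add: AM V)
    then have "c v = restrict a A"
      unfolding c_def using that by (intro the1_equality[OF uniq]) auto
    then show ?thesis using that by simp
  qed
  have lin: "linmap V scalars (\<lambda>v. c v b)" if b: "b \<in> A" for b
  proof (rule linmapI)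
    fix v w assume v: "v \<in> carrier V" and w: "w \<in> carrier V"
    have "lincomb (\<lambda>b. c v b + c w b) A = finsum V (\<lambda>b. c v b \<odot>\<^bsub>V\<^esub> b \<oplus>\<^bsub>V\<^esub> c w b \<odot>\<^bsub>V\<^esub> b) A"
      unfolding lincomb_def by (intro vs_finsum_cong[OF V]) (simp_all add: AM V vs_add_smult[OF V])
    also have "\<dots> = lincomb (c v) A \<oplus>\<^bsub>V\<^esub> lincomb (c w) A"
      unfolding lincomb_def by (intro vs_finsum_add[OF V]) (simp_all add: AM V)
    also have "\<dots> = v \<oplus>\<^bsub>V\<^esub> w" using c[OF v] c[OF w] by simp
    finally have "lincomb (\<lambda>b. c v b + c w b) A = v \<oplus>\<^bsub>V\<^esub> w" .
    from c_eq[OF vs_add[OF V v w] this b] show "c (v \<oplus>\<^bsub>V\<^esub> w) b = c v b \<oplus>\<^bsub>scalars\<^esub> c w b"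
      by simp
  next
    fix r v assume v: "v \<in> carrier V"
    have "lincomb (\<lambda>b. r * c v b) A = finsum V (\<lambda>b. r \<odot>\<^bsub>V\<^esub> (c v b \<odot>\<^bsub>V\<^esub> b)) A"
      unfolding lincomb_def by (intro vs_finsum_cong[OF V]) (simp_all add: AM V vs_mult_smult[OF V])
    also have "\<dots> = r \<odot>\<^bsub>V\<^esub> lincomb (c v) A"
      unfolding lincomb_def
      by (intro linmap_finsum[OF V V, symmetric])
        (simp_all add: AM V linmap_def vs_smult_add[OF V] vs_mult_smult[OF V, symmetric] mult.commute)
    also have "\<dots> = r \<odot>\<^bsub>V\<^esub> v" using c[OF v] by simp
    finally have "lincomb (\<lambda>b. r * c v b) A = r \<odot>\<^bsub>V\<^esub> v" .
    from c_eq[OF vs_smult[OF V v] this b] show "c (r \<odot>\<^bsub>V\<^esub> v) b = r \<odot>\<^bsub>scalars\<^esub> c v b"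
      by simp
  qed simp
  have delta: "c b' b = (if b = b' then 1 else 0)" if "b \<in> A" "b' \<in> A" for b b'
  proof -
    have "lincomb (\<lambda>b. if b = b' then 1 else 0) A = b'"
      unfolding lincomb_def using that by (intro vs_finsum_delta[OF V A(1)]) (simp_all add: AM)
    then show ?thesis using AV that by (subst c_eq) auto
  qed
  obtain bs where bs: "set bs = A" "distinct bs" using finite_distinct_list[OF A(1)] by blast
  define e where "e i = bs ! i" for i
  define f where "f i = restrict (\<lambda>v. c v (bs ! i)) (carrier V)" for i
  let ?n = "length bs"
  have e: "e ` {..<?n} = A" using bs by (auto simp: e_def in_set_conv_nth)
  have f: "f i \<in> lin V scalars" if "i < ?n" for i
    unfolding f_def using that bs nth_mem by (intro lin_restrict[OF V] lin) blast
  have fe: "f i (e j) = (if i = j then 1 else 0)" if "i < ?n" "j < ?n" for i j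
  proof -
    have A2: "bs ! i \<in> A" "bs ! j \<in> A" using that bs nth_mem by blast+
    have "bs ! j \<in> carrier V" using A2(2) AV(1) by blast
    then have "f i (e j) = (if bs ! i = bs ! j then 1 else 0)" by (simp add: f_def e_def delta[OF A2])
    then show ?thesis using that nth_eq_iff_index_eq[OF bs(2), of i j] by auto
  qed
  note D = vspace_dual[OF V]
  have fD: "f ` {..<?n} \<subseteq> carrier (dual V)" using f by (auto simp: dual_simps)
  have "\<phi> \<in> span_in (dual V) (f ` {..<?n})" if phi: "\<phi> \<in> carrier (dual V)" for \<phi>
  proof -
    let ?s = "finsum (dual V) (\<lambda>i. \<phi> (e i) \<odot>\<^bsub>dual V\<^esub> f i) {..<?n}"
    have s: "?s \<in> span_in (dual V) (f ` {..<?n})"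
    proof (rule finsum_in_subsp[OF D subsp_span[OF D fD]])
      fix i assume "i \<in> {..<?n}"
      then show "\<phi> (e i) \<odot>\<^bsub>dual V\<^esub> f i \<in> span_in (dual V) (f ` {..<?n})"
        using subsp_span[OF D fD] span_superset[OF D fD, of "f i"] unfolding subsp_def by blast
    qed
    have "\<phi> = ?s"
    proof (rule lin_eqI[OF V vspace_scalars])
      show "\<phi> \<in> lin V scalars" using phi by (simp add: dual_simps)
      show "?s \<in> lin V scalars" using span_subset_carrier[OF D fD] s by (auto simp: dual_simps)
      show "A \<subseteq> carrier V" "carrier V \<subseteq> span_in V A" using AV by auto
      fix b assume b: "b \<in> A"
      then obtain j where j: "j < ?n" "b = e j" using e by auto
      have bV: "b \<in> carrier V" using b AV by auto
      have "linmap (dual V) scalars (\<lambda>\<phi>. \<phi> b)" using bV by (auto simp: linmap_def dual_simps)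
      then have "?s b = (\<Sum>i<?n. (\<phi> (e i) \<odot>\<^bsub>dual V\<^esub> f i) b)"
        using fD by (intro linmap_sum[OF D]) (auto simp: D)
      also have "\<dots> = (\<Sum>i<?n. if i = j then \<phi> (e i) else 0)"
        using bV j fe by (intro sum.cong) (auto simp: dual_simps)
      finally show "\<phi> b = ?s b" using j by simp
    qed
    then show ?thesis using s by simp
  qed
  then show ?thesis
    using AV e fD fe by (intro exI[of _ ?n] exI[of _ e] exI[of _ f]) auto
qed

section \<open>Spanning sets of the exterior algebra\<close>

lemma alternating_linmap: "alternating W K \<phi> \<Longrightarrow> us \<in> lists (carrier W) \<Longrightarrow> vs \<in> lists (carrier W) \<Longrightarrow>
    linmap W K (\<lambda>x. \<phi> (us @ x # vs))"
  and alternating_zero: "alternating W K \<phi> \<Longrightarrow> us \<in> lists (carrier W) \<Longrightarrow> vs \<in> lists (carrier W) \<Longrightarrow>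
    x \<in> carrier W \<Longrightarrow> \<phi> (us @ x # x # vs) = \<zero>\<^bsub>K\<^esub>"
  by (simp_all add: alternating_def del: in_lists_conv_set)

text \<open>Expand \<open>\<phi>\<close> at \<open>x + y, x + y\<close>, where it vanishes.\<close>
lemma alternating_swap:
  assumes W: "vspace W" and K: "vspace K" and alt: "alternating W K \<phi>"
    and x: "x \<in> carrier W" and y: "y \<in> carrier W" and vs: "vs \<in> lists (carrier W)"
  shows "\<phi> (x # y # vs) = (- 1) \<odot>\<^bsub>K\<^esub> \<phi> (y # x # vs)"
proof -
  have z: "\<phi> (u # u # vs) = \<zero>\<^bsub>K\<^esub>" if "u \<in> carrier W" for u
    using alt vs that unfolding alternating_def by (metis append_Nil lists.Nil)
  have l: "linmap W K (\<lambda>u. \<phi> (u # w # vs))" if "w \<in> carrier W" for w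
  proof -
    have "[] \<in> lists (carrier W)" "w # vs \<in> lists (carrier W)" using vs that by auto
    then have "linmap W K (\<lambda>u. \<phi> ([] @ u # w # vs))" using alt unfolding alternating_def by blast
    then show ?thesis by simp
  qed
  have r: "linmap W K (\<lambda>u. \<phi> (w # u # vs))" if "w \<in> carrier W" for w
  proof -
    have "[w] \<in> lists (carrier W)" using that by auto
    then have "linmap W K (\<lambda>u. \<phi> ([w] @ u # vs))" using alt vs unfolding alternating_def by blast
    then show ?thesis by simp
  qed
  have c: "\<phi> (x # y # vs) \<in> carrier K" "\<phi> (y # x # vs) \<in> carrier K"
    using linmap_closed[OF l[OF y] x] linmap_closed[OF l[OF x] y] .
  have xy: "x \<oplus>\<^bsub>W\<^esub> y \<in> carrier W" using x y W by simp
  have "\<zero>\<^bsub>K\<^esub> = \<phi> (x # (x \<oplus>\<^bsub>W\<^esub> y) # vs) \<oplus>\<^bsub>K\<^esub> \<phi> (y # (x \<oplus>\<^bsub>W\<^esub> y) # vs)"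
    using z[OF xy] linmap_add[OF l[OF xy] x y] by simp
  also have "\<dots> = \<phi> (x # y # vs) \<oplus>\<^bsub>K\<^esub> \<phi> (y # x # vs)"
    using linmap_add[OF r[OF x] x y] linmap_add[OF r[OF y] x y] z x y c by (simp add: K)
  finally have "\<ominus>\<^bsub>K\<^esub> \<phi> (y # x # vs) = \<phi> (x # y # vs)" by (intro vs_neg_unique[OF K c(2,1)]) simp
  then show ?thesis using c by (simp add: vs_neg_eq[OF K])
qed

text \<open>
  Subsets of \<open>{0..<n}\<close>, encoded by their increasing enumerations; they index the standard basis of the
  exterior algebra.
\<close>
definition increasing_words :: "nat \<Rightarrow> nat list set" where
  "increasing_words n = {xs. sorted_wrt (<) xs \<and> set xs \<subseteq> {..<n}}"

lemma finite_increasing_words: "finite (increasing_words n)"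
  by (rule finite_subset[OF _ finite_subset_distinct[of "{..<n}"]])
    (auto simp: increasing_words_def strict_sorted_iff)

lemma increasing_words_eq:
  assumes "xs \<in> increasing_words n" "ys \<in> increasing_words n" "length xs = length ys" "set xs \<subseteq> set ys"
  shows "xs = ys"
proof -
  have s: "sorted xs" "distinct xs" "sorted ys" "distinct ys"
    using assms(1,2) by (auto simp: increasing_words_def strict_sorted_iff)
  then have "set xs = set ys"
    using assms(3,4) by (intro card_subset_eq) (auto simp: distinct_card)
  then show ?thesis using s by (intro sorted_distinct_set_unique)
qed

lemma insort_increasing_words:
  "xs \<in> increasing_words n \<Longrightarrow> j < n \<Longrightarrow> j \<notin> set xs \<Longrightarrow> insort j xs \<in> increasing_words n"
  by (auto simp: increasing_words_def strict_sorted_iff sorted_insort set_insort_key distinct_insort)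

context
  fixes W :: "('k::field, 'a) module" and e :: "nat \<Rightarrow> 'a" and n :: nat
  assumes W: "vspace W" and e: "e ` {..<n} \<subseteq> carrier W" and span: "carrier W \<subseteq> span_in W (e ` {..<n})"
begin

text \<open>
  The new factor moves to the right past the smaller ones, at the cost of a sign for each, until it meets
  an equal factor or its place in the increasing order.
\<close>
lemma wedge_insort:
  assumes "xs \<in> increasing_words n" "j < n"
  shows "if j \<in> set xs then wedge W (map e (j # xs)) = \<zero>\<^bsub>ext W\<^esub>
    else \<exists>c. wedge W (map e (j # xs)) = c \<odot>\<^bsub>ext W\<^esub> wedge W (map e (insort j xs))"
  using assms
proof (induction xs)
  case Nil
  have "wedge W [e j] = 1 \<odot>\<^bsub>ext W\<^esub> wedge W [e j]"
    using e Nil by (intro vs_one_smult[OF vspace_ext[OF W], symmetric] wedge_closed[OF W]) auto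
  then show ?case by auto
next
  case (Cons x xs)
  note E = vspace_ext[OF W]
  have mem: "map e zs \<in> lists (carrier W)" if "set zs \<subseteq> {..<n}" for zs
    using e that by (auto simp: image_subset_iff subset_iff)
  have xs: "xs \<in> increasing_words n" "x < n" "set xs \<subseteq> {..<n}" using Cons.prems by (auto simp: increasing_words_def)
  have xj: "e x \<in> carrier W" "e j \<in> carrier W" using e xs Cons.prems by auto
  have exs: "map e xs \<in> lists (carrier W)" by (rule mem[OF xs(3)])
  note alt = alternating_wedge[OF W]
  consider "j < x" | "j = x" | "x < j" by linarith
  then show ?case
  proof cases
    case 1
    then have n: "j \<notin> set (x # xs)" using Cons.prems by (auto simp: increasing_words_def)
    have "wedge W (map e (j # x # xs)) = 1 \<odot>\<^bsub>ext W\<^esub> wedge W (map e (insort j (x # xs)))"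
      using 1 xj exs by (simp, intro vs_one_smult[OF E, symmetric] wedge_closed[OF W]) auto
    then show ?thesis unfolding if_not_P[OF n] by blast
  next
    case 2
    have "wedge W ([] @ e x # e x # map e xs) = \<zero>\<^bsub>ext W\<^esub>"
      by (rule alternating_zero[OF alt lists.Nil exs xj(1)])
    then show ?thesis using 2 by simp
  next
    case 3
    have lm: "linmap (ext W) (ext W) (\<lambda>z. wedge W [e x] \<otimes>\<^bsub>ext W\<^esub> z)"
      using bilin_ext_mult[OF W] wedge_closed[OF W, of "[e x]"] xj by (auto simp: bilin_def)
    have ap: "wedge W [e x] \<otimes>\<^bsub>ext W\<^esub> wedge W (map e zs) = wedge W (map e (x # zs))" if "set zs \<subseteq> {..<n}" for zs
      using wedge_append[OF W, of "[e x]" "map e zs"] mem[OF that] xj by simp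
    have sw: "wedge W (map e (j # x # xs)) = (- 1) \<odot>\<^bsub>ext W\<^esub> (wedge W [e x] \<otimes>\<^bsub>ext W\<^esub> wedge W (map e (j # xs)))"
      using alternating_swap[OF W E alt xj(2,1) exs] ap[of "j # xs"] xs Cons.prems by simp
    show ?thesis
    proof (cases "j \<in> set xs")
      case True
      then have "wedge W (map e (j # xs)) = \<zero>\<^bsub>ext W\<^esub>" using Cons.IH xs Cons.prems by auto
      then show ?thesis using True sw linmap_zero[OF E E lm] by (simp add: E)
    next
      case False
      then obtain c where c: "wedge W (map e (j # xs)) = c \<odot>\<^bsub>ext W\<^esub> wedge W (map e (insort j xs))"
        using Cons.IH xs Cons.prems by auto
      have i: "set (insort j xs) \<subseteq> {..<n}" using xs Cons.prems by (auto simp: set_insort_key)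
      have "wedge W (map e (j # x # xs)) = (- 1) \<odot>\<^bsub>ext W\<^esub> (c \<odot>\<^bsub>ext W\<^esub> wedge W (map e (x # insort j xs)))"
        unfolding sw c linmap_smult[OF lm wedge_closed[OF W mem[OF i]]] ap[OF i] ..
      also have "\<dots> = (- 1 * c) \<odot>\<^bsub>ext W\<^esub> wedge W (map e (x # insort j xs))"
        using i xs by (intro vs_mult_smult[OF E, symmetric] wedge_closed[OF W] mem) auto
      finally show ?thesis using 3 False by auto
    qed
  qed
qed

lemma wedge_in_span_increasing:
  assumes "ws \<in> lists (carrier W)"
  shows "wedge W ws \<in> span_in (ext W) {wedge W (map e xs) | xs. xs \<in> increasing_words n \<and> length xs = length ws}"
    (is "_ \<in> span_in _ (?S (length ws))")
proof -
  note E = vspace_ext[OF W]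
  have mem: "map e zs \<in> lists (carrier W)" if "zs \<in> increasing_words n" for zs
    using e that by (auto simp: increasing_words_def image_subset_iff subset_iff)
  have S: "?S m \<subseteq> carrier (ext W)" for m using mem by (auto intro!: wedge_closed[OF W])
  show ?thesis using assms
  proof (induction ws rule: list.induct)
    case Nil
    have "wedge W (map e []) \<in> ?S 0" by (auto simp: increasing_words_def intro!: exI[of _ "[]"])
    from span_superset[OF E S this] show ?case by simp
  next
    case (Cons w ws)
    note sp = subsp_span[OF E S[of "Suc (length ws)"]]
    have w: "w \<in> carrier W" and ws: "ws \<in> lists (carrier W)" using Cons.prems by auto
    have step: "wedge W [w] \<otimes>\<^bsub>ext W\<^esub> z \<in> span_in (ext W) (?S (Suc (length ws)))" if z: "z \<in> ?S (length ws)" for z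
    proof -
      obtain xs where xs: "xs \<in> increasing_words n" "length xs = length ws" "z = wedge W (map e xs)" using z by blast
      have zc: "z \<in> carrier (ext W)" using z S by blast
      have e1: "wedge W [x] \<otimes>\<^bsub>ext W\<^esub> z = wedge W (x # map e xs)" if "x \<in> carrier W" for x
        using wedge_append[OF W, of "[x]" "map e xs"] mem[OF xs(1)] that xs by simp
      have "linmap W (ext W) (\<lambda>x. wedge W ([] @ x # map e xs))"
        using alternating_wedge[OF W] mem[OF xs(1)] unfolding alternating_def by blast
      then have lm: "linmap W (ext W) (\<lambda>x. wedge W (x # map e xs))" by simp
      have "wedge W (w # map e xs) \<in> span_in (ext W) (?S (Suc (length ws)))"
      proof (rule linmap_span_into[OF W E lm sp e])
        show "w \<in> span_in W (e ` {..<n})" using w span by blast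
        fix s assume "s \<in> e ` {..<n}"
        then obtain j where j: "j < n" "s = e j" by auto
        show "wedge W (s # map e xs) \<in> span_in (ext W) (?S (Suc (length ws)))"
        proof (cases "j \<in> set xs")
          case True
          then show ?thesis using wedge_insort[OF xs(1) j(1)] j sp by (simp add: subsp_def)
        next
          case False
          then obtain c where c: "wedge W (map e (j # xs)) = c \<odot>\<^bsub>ext W\<^esub> wedge W (map e (insort j xs))"
            using wedge_insort[OF xs(1) j(1)] by auto
          have "wedge W (map e (insort j xs)) \<in> ?S (Suc (length ws))"
            using insort_increasing_words[OF xs(1) j(1) False] xs(2) by auto
          then show ?thesis using c j sp span_superset[OF E S] unfolding subsp_def by simp
        qed
      qed
      then show ?thesis using e1[OF w] by simp
    qed
    have lm: "linmap (ext W) (ext W) (\<lambda>z. wedge W [w] \<otimes>\<^bsub>ext W\<^esub> z)"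
      using bilin_ext_mult[OF W] wedge_closed[OF W, of "[w]"] w by (auto simp: bilin_def)
    have "wedge W [w] \<otimes>\<^bsub>ext W\<^esub> wedge W ws \<in> span_in (ext W) (?S (Suc (length ws)))"
      by (rule linmap_span_into[OF E E lm sp S step Cons.IH[OF ws]])
    then show ?case using wedge_append[OF W, of "[w]" ws] w ws by simp
  qed
qed

end

section \<open>The part of positive degree and the augmentation\<close>

context
  fixes W :: "('k::field, 'a) module"
  assumes W: "vspace W"
begin

lemma tuples_lists: "ws \<in> tuples W i \<longleftrightarrow> ws \<in> lists (carrier W) \<and> length ws = i"
  by (auto simp: tuples_def)

lemma wedge_tuples_subset: "wedge W ` tuples W i \<subseteq> carrier (ext W)"
  using wedge_closed[OF W] by (auto simp: tuples_def)

lemma subsp_ext_pow: "subsp (ext W) (carrier (ext_pow W i))"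
  unfolding ext_pow_def using subsp_span[OF vspace_ext[OF W] wedge_tuples_subset] by simp

lemma vspace_ext_pow: "vspace (ext_pow W i)"
  using vspace_subsp[OF vspace_ext[OF W] subsp_ext_pow[of i]] by (simp add: ext_pow_def)

lemma wedge_in_ext_pow: "ws \<in> tuples W i \<Longrightarrow> wedge W ws \<in> carrier (ext_pow W i)"
  unfolding ext_pow_def using span_superset[OF vspace_ext[OF W] wedge_tuples_subset] by auto

lemma ext_pow_span: "carrier (ext_pow W i) \<subseteq> span_in (ext_pow W i) (wedge W ` tuples W i)"
proof -
  have "span_in (ext_pow W i) (wedge W ` tuples W i) = span_in (ext W) (wedge W ` tuples W i)"
    using span_sub[OF vspace_ext[OF W] subsp_ext_pow[of i], of "wedge W ` tuples W i"] wedge_in_ext_pow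
    by (auto simp: ext_pow_def)
  then show ?thesis by (simp add: ext_pow_def)
qed

lemma ext_pows_subset: "(\<Union>i\<in>{1..}. carrier (ext_pow W i)) \<subseteq> carrier (ext W)"
  using subsp_carrier_D[OF subsp_ext_pow] by blast

lemma subsp_ext_pos: "subsp (ext W) (carrier (ext_pos W))"
  unfolding ext_pos_def using subsp_span[OF vspace_ext[OF W] ext_pows_subset] by simp

lemma vspace_ext_pos: "vspace (ext_pos W)"
  using vspace_subsp[OF vspace_ext[OF W] subsp_ext_pos] by (simp add: ext_pos_def)

lemma ext_pow_in_pos: "1 \<le> i \<Longrightarrow> x \<in> carrier (ext_pow W i) \<Longrightarrow> x \<in> carrier (ext_pos W)"
  unfolding ext_pos_def using span_superset[OF vspace_ext[OF W] ext_pows_subset, of x] by auto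

lemma wedge_in_ext_pos: "ws \<in> lists (carrier W) \<Longrightarrow> ws \<noteq> [] \<Longrightarrow> wedge W ws \<in> carrier (ext_pos W)"
  by (rule ext_pow_in_pos[of "length ws"]) (auto intro: wedge_in_ext_pow simp: tuples_lists Suc_le_eq)

lemma ext_pos_span_in: "S \<subseteq> carrier (ext_pos W) \<Longrightarrow> span_in (ext_pos W) S = span_in (ext W) S"
  using span_sub[OF vspace_ext[OF W] subsp_ext_pos] by (simp add: ext_pos_def)

lemma ext_pos_span_least:
  assumes P: "subsp (ext W) P" and w: "\<And>ws. ws \<in> lists (carrier W) \<Longrightarrow> ws \<noteq> [] \<Longrightarrow> wedge W ws \<in> P"
  shows "carrier (ext_pos W) \<subseteq> P"
proof -
  note E = vspace_ext[OF W]
  have "carrier (ext_pow W i) \<subseteq> P" if "1 \<le> i" for i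
  proof -
    have "wedge W ws \<in> P" if "ws \<in> tuples W i" for ws
      using that \<open>1 \<le> i\<close> by (intro w) (auto simp: tuples_lists)
    then have "span_in (ext W) (wedge W ` tuples W i) \<subseteq> P" by (intro span_least[OF E P]) blast
    then show ?thesis by (simp add: ext_pow_def)
  qed
  then have "span_in (ext W) (\<Union>i\<in>{1..}. carrier (ext_pow W i)) \<subseteq> P" by (intro span_least[OF E P]) auto
  then show ?thesis by (simp add: ext_pos_def)
qed

lemma ext_pos_span: "carrier (ext_pos W) \<subseteq> span_in (ext_pos W) (wedge W ` {ws \<in> lists (carrier W). ws \<noteq> []})"
proof -
  note E = vspace_ext[OF W]
  let ?S = "wedge W ` {ws \<in> lists (carrier W). ws \<noteq> []}"
  have S: "?S \<subseteq> carrier (ext W)" "?S \<subseteq> carrier (ext_pos W)" using wedge_closed[OF W] wedge_in_ext_pos by auto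
  have "carrier (ext_pos W) \<subseteq> span_in (ext W) ?S"
    using span_superset[OF E S(1)] by (intro ext_pos_span_least subsp_span[OF E S(1)]) blast
  then show ?thesis using ext_pos_span_in[OF S(2)] by simp
qed

text \<open>The function that is \<open>1\<close> on the empty list and \<open>0\<close> elsewhere is alternating.\<close>
lemma augmentation_props:
  shows augmentation_lin: "augmentation W \<in> lin (ext W) scalars"
    and augmentation_wedge: "\<And>ws. ws \<in> lists (carrier W) \<Longrightarrow> augmentation W (wedge W ws) = (if ws = [] then 1 else 0)"
proof -
  note E = vspace_ext[OF W]
  let ?P = "\<lambda>e. e \<one>\<^bsub>ext W\<^esub> = (1::'k) \<and> (\<forall>i\<ge>1. \<forall>x\<in>carrier (ext_pow W i). e x = 0)"
  have "alternating W scalars (\<lambda>ws. if ws = [] then 1 else (0::'k))"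
    by (auto simp: alternating_def linmap_def)
  from ext_lift[OF W vspace_scalars this] obtain h where
    h: "h \<in> lin (ext W) scalars" "\<And>ws. ws \<in> lists (carrier W) \<Longrightarrow> h (wedge W ws) = (if ws = [] then 1 else 0)"
    by blast
  have "h x = 0" if "1 \<le> i" "x \<in> carrier (ext_pow W i)" for i x
  proof -
    have "h x \<in> {0}"
    proof (rule linmap_span_into[OF E vspace_scalars lin_linmap[OF h(1)]])
      show "subsp scalars {0::'k}" by (simp add: subsp_def)
      show "wedge W ` tuples W i \<subseteq> carrier (ext W)" by (rule wedge_tuples_subset)
      show "x \<in> span_in (ext W) (wedge W ` tuples W i)" using that by (simp add: ext_pow_def)
    qed (use that(1) h(2) in \<open>auto simp: tuples_lists simp del: in_lists_conv_set\<close>)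
    then show ?thesis by simp
  qed
  then have hP: "?P h" using h(2)[of "[]"] by (simp add: ext_one[OF W])
  have "augmentation W = h"
    unfolding augmentation_def
  proof (rule the_lin_eqI, rule h(1), rule hP)
    fix g assume g: "g \<in> lin (ext W) scalars" "?P g"
    show "g = h"
    proof (rule lin_eqI[OF E vspace_scalars g(1) h(1) _ ext_span[OF W]])
      fix s assume "s \<in> wedge W ` lists (carrier W)"
      then obtain ws where ws: "ws \<in> lists (carrier W)" "s = wedge W ws" by blast
      show "g s = h s"
      proof (cases "ws = []")
        case True
        then show ?thesis using g(2) hP ws by (simp add: ext_one[OF W])
      next
        case False
        then have "1 \<le> length ws" "s \<in> carrier (ext_pow W (length ws))"
          using ws by (auto simp: Suc_le_eq intro!: wedge_in_ext_pow simp: tuples_lists)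
        then show ?thesis using g(2) hP by metis
      qed
    qed (auto intro: wedge_closed[OF W])
  qed
  then show "augmentation W \<in> lin (ext W) scalars"
    "\<And>ws. ws \<in> lists (carrier W) \<Longrightarrow> augmentation W (wedge W ws) = (if ws = [] then 1 else 0)"
    using h by simp_all
qed

lemma augmented_ext: "augmented_algebra (ext W) (augmentation W)"
proof (rule augmented_algebra.intro)
  note E = vspace_ext[OF W]
  let ?e = "augmentation W"
  note lm = lin_linmap[OF augmentation_lin]
  show "vspace (ext W)" by (rule E)
  show "bilin (ext W) (ext W) (ext W) (\<lambda>x y. x \<otimes>\<^bsub>ext W\<^esub> y)" by (rule bilin_ext_mult[OF W])
  show "\<one>\<^bsub>ext W\<^esub> \<in> carrier (ext W)" by (simp add: ext_one[OF W] wedge_closed[OF W])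
  show "linmap (ext W) scalars ?e" by (rule lm)
  show "?e \<one>\<^bsub>ext W\<^esub> = 1" by (simp add: ext_one[OF W] augmentation_wedge)
  have sub: "wedge W ` lists (carrier W) \<subseteq> carrier (ext W)" by (auto intro: wedge_closed[OF W])
  have 1: "?e (wedge W us \<otimes>\<^bsub>ext W\<^esub> y) = ?e (wedge W us) * ?e y" if us: "us \<in> lists (carrier W)" and y: "y \<in> carrier (ext W)" for us y
  proof (rule linmap_eq_on_span[OF E vspace_scalars _ _ sub, where f="\<lambda>y. ?e (wedge W us \<otimes>\<^bsub>ext W\<^esub> y)" and g="\<lambda>y. ?e (wedge W us) * ?e y"])
    show "linmap (ext W) scalars (\<lambda>y. ?e (wedge W us \<otimes>\<^bsub>ext W\<^esub> y))"
      by (rule linmap_comp[OF _ lm]) (use bilin_ext_mult[OF W] wedge_closed[OF W us] in \<open>simp add: bilin_def\<close>)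
    show "linmap (ext W) scalars (\<lambda>y. ?e (wedge W us) * ?e y)"
      using linmap_smult_fun[OF vspace_scalars lm, of "?e (wedge W us)"] by simp
    show "y \<in> span_in (ext W) (wedge W ` lists (carrier W))" using y ext_span[OF W] by blast
    fix s assume "s \<in> wedge W ` lists (carrier W)"
    then obtain vs where vs: "vs \<in> lists (carrier W)" "s = wedge W vs" by blast
    have "us @ vs \<in> lists (carrier W)" using us vs by simp
    then have "?e (wedge W (us @ vs)) = (if us = [] then 1 else 0) * (if vs = [] then 1 else 0)"
      by (simp add: augmentation_wedge del: in_lists_conv_set)
    then show "?e (wedge W us \<otimes>\<^bsub>ext W\<^esub> s) = ?e (wedge W us) * ?e s"
      unfolding vs(2) wedge_append[OF W us vs(1), symmetric] augmentation_wedge[OF us] augmentation_wedge[OF vs(1)] .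
  qed
  fix x y assume x: "x \<in> carrier (ext W)" and y: "y \<in> carrier (ext W)"
  show "\<one>\<^bsub>ext W\<^esub> \<otimes>\<^bsub>ext W\<^esub> x = x" "x \<otimes>\<^bsub>ext W\<^esub> \<one>\<^bsub>ext W\<^esub> = x"
    using ext_one_mult[OF W x] ext_mult_one[OF W x] .
  show "?e (x \<otimes>\<^bsub>ext W\<^esub> y) = ?e x * ?e y"
  proof (rule linmap_eq_on_span[OF E vspace_scalars _ _ sub, where f="\<lambda>x. ?e (x \<otimes>\<^bsub>ext W\<^esub> y)" and g="\<lambda>x. ?e x * ?e y"])
    show "linmap (ext W) scalars (\<lambda>x. ?e (x \<otimes>\<^bsub>ext W\<^esub> y))"
      by (rule linmap_comp[OF _ lm]) (use bilin_ext_mult[OF W] y in \<open>simp add: bilin_def\<close>)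
    show "linmap (ext W) scalars (\<lambda>x. ?e x * ?e y)" by (rule linmap_scale[OF lm])
    show "x \<in> span_in (ext W) (wedge W ` lists (carrier W))" using x ext_span[OF W] by blast
  qed (use 1 y in auto)
qed

text \<open>
  The linear map \<open>x \<mapsto> x - \<epsilon>(x) \<cdot> 1\<close> sends every wedge product, including the empty one, to the part of
  positive degree, and it fixes the elements with \<open>\<epsilon>(x) = 0\<close>.
\<close>
lemma augmentation_zero_in_pos:
  assumes x: "x \<in> carrier (ext W)" and e: "augmentation W x = 0"
  shows "x \<in> carrier (ext_pos W)"
proof -
  note E = vspace_ext[OF W]
  interpret augmented_algebra "ext W" "augmentation W" by (rule augmented_ext)
  let ?e = "augmentation W" and ?o = "\<one>\<^bsub>ext W\<^esub>"
  let ?g = "\<lambda>x. x \<oplus>\<^bsub>ext W\<^esub> (- 1) \<odot>\<^bsub>ext W\<^esub> (?e x \<odot>\<^bsub>ext W\<^esub> ?o)"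
  have id: "linmap (ext W) (ext W) (\<lambda>x. x)" by (simp add: linmap_def)
  have g: "linmap (ext W) (ext W) ?g"
    by (intro linmap_add_fun[OF E id] linmap_smult_fun[OF E] linmap_smult_const[OF E eps]) simp
  have "?g x \<in> carrier (ext_pos W)"
  proof (rule linmap_span_into[OF E E g subsp_ext_pos])
    show "wedge W ` lists (carrier W) \<subseteq> carrier (ext W)" by (auto intro: wedge_closed[OF W])
    show "x \<in> span_in (ext W) (wedge W ` lists (carrier W))" using x ext_span[OF W] by blast
    fix s assume "s \<in> wedge W ` lists (carrier W)"
    then obtain ws where ws: "ws \<in> lists (carrier W)" "s = wedge W ws" by blast
    show "?g s \<in> carrier (ext_pos W)"
    proof (cases "ws = []")
      case True
      have "?o \<oplus>\<^bsub>ext W\<^esub> (- 1) \<odot>\<^bsub>ext W\<^esub> ?o = \<zero>\<^bsub>ext W\<^esub>"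
        using vs_neg_eq[OF E one_closed] vs_add_neg[OF E one_closed] by simp
      then show ?thesis using True ws subsp_ext_pos E by (simp add: ext_one[OF W, symmetric] subsp_def)
    next
      case False
      then show ?thesis using ws wedge_in_ext_pos[OF ws(1)] by (simp add: augmentation_wedge E wedge_closed[OF W] del: in_lists_conv_set)
    qed
  qed
  then show ?thesis using x e by (simp add: E)
qed

end

section \<open>The determinant form and its Laplace expansion\<close>

text \<open>
  The value \<open>0\<close> for lists of different lengths makes exterior powers of different degrees orthogonal.
\<close>
definition det_form :: "'v list \<Rightarrow> ('v \<Rightarrow> 'k::field) list \<Rightarrow> 'k" where
  "det_form vs fs = (if length vs = length fs
     then det (mat (length vs) (length vs) (\<lambda>(j, l). (fs ! l) (vs ! j))) else 0)"

lemma linmap_sum_fun: "(\<And>i. i \<in> A \<Longrightarrow> linmap M scalars (f i)) \<Longrightarrow> linmap M scalars (\<lambda>x. \<Sum>i\<in>A. f i x)"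
  using linmap_finsum_fun[OF vspace_scalars, of A M f] by (simp add: finsum_scalars)

lemma linmap_weighted_sum:
  assumes "\<And>s. s \<in> S \<Longrightarrow> linmap M scalars (f s)"
  shows "linmap M scalars (\<lambda>x. \<Sum>s\<in>S. c s * f s x)"
  using linmap_smult_fun[OF vspace_scalars assms] by (intro linmap_sum_fun) simp

text \<open>
  The Leibniz formula with the entries of row \<open>j\<close> isolated, which exhibits the linearity in this row.
\<close>
lemma det_row_expand:
  assumes j: "j < n"
  shows "det (mat n n (\<lambda>(i, l). if i = j then r l else a i l)) =
    (\<Sum>p | p permutes {0..<n}. (signof p * (\<Prod>i\<in>{0..<n} - {j}. a i (p i))) * r (p j :: nat))"
proof -
  have "(\<Prod>i = 0..<n. mat n n (\<lambda>(i, l). if i = j then r l else a i l) $$ (i, p i)) =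
      r (p j) * (\<Prod>i\<in>{0..<n} - {j}. a i (p i))" if p: "p permutes {0..<n}" for p
  proof -
    have "(\<Prod>i = 0..<n. mat n n (\<lambda>(i, l). if i = j then r l else a i l) $$ (i, p i)) =
        (\<Prod>i = 0..<n. if i = j then r (p i) else a i (p i))"
      using permutes_in_image[OF p] by (intro prod.cong) auto
    also have "\<dots> = r (p j) * (\<Prod>i\<in>{0..<n} - {j}. if i = j then r (p i) else a i (p i))"
      using j by (subst prod.remove[of _ j]) auto
    also have "(\<Prod>i\<in>{0..<n} - {j}. if i = j then r (p i) else a i (p i)) = (\<Prod>i\<in>{0..<n} - {j}. a i (p i))"
      by (intro prod.cong) auto
    finally show ?thesis .
  qed
  then show ?thesis
    by (subst det_def'[of _ n]) (auto intro!: sum.cong)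
qed

lemma linmap_det_row:
  assumes j: "j < n" and r: "\<And>l. l < n \<Longrightarrow> linmap M scalars (r l)"
  shows "linmap M scalars (\<lambda>x. det (mat n n (\<lambda>(i, l). if i = j then r l x else a i l)))"
  unfolding det_row_expand[OF j]
proof (rule linmap_sum_fun)
  fix p assume "p \<in> {p. p permutes {0..<n}}"
  then have "p j < n" using permutes_in_image[of p "{0..<n}" j] j by auto
  from linmap_smult_fun[OF vspace_scalars r[OF this]]
  show "linmap M scalars (\<lambda>x. (signof p * (\<Prod>i\<in>{0..<n} - {j}. a i (p i))) * r (p j) x)" by simp
qed

lemma det_equal_rows:
  assumes "i < n" "j < n" "i \<noteq> j" "\<And>l. l < n \<Longrightarrow> a i l = a j l"
  shows "det (mat n n (\<lambda>(i, l). a i l)) = (0 :: 'k::field)"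
  using assms by (intro det_identical_rows[of _ n i j]) auto

lemma det_form_transpose:
  "det_form vs fs = (if length vs = length fs
     then det (mat (length fs) (length fs) (\<lambda>(l, j). (fs ! l) (vs ! j))) else 0)"
proof -
  have "det (mat n n (\<lambda>(j, l). (fs ! l) (vs ! j))) = det (mat n n (\<lambda>(l, j). (fs ! l) (vs ! j)))" for n
    by (subst det_transpose[symmetric, of _ n]) (auto intro!: arg_cong[of _ _ det])
  then show ?thesis by (simp add: det_form_def)
qed

lemma nth_append_Cons_other: "i \<noteq> length us \<Longrightarrow> (us @ x # vs) ! i = (us @ y # vs) ! i"
  by (auto simp: nth_append nth_Cons')

lemma alternating_det_form_left:
  fixes V :: "('k::field, 'v) module"
  assumes V: "vspace V" and fs: "fs \<in> lists (carrier (dual V))"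
  shows "alternating V scalars (\<lambda>vs. det_form vs fs)"
  unfolding alternating_def
proof (intro conjI ballI)
  fix us vs assume us: "us \<in> lists (carrier V)" and vs: "vs \<in> lists (carrier V)"
  let ?n = "Suc (length us + length vs)"
  show "linmap V scalars (\<lambda>x. det_form (us @ x # vs) fs)"
  proof (cases "?n = length fs")
    case True
    \<comment> \<open>The row of \<open>x\<close> is split off from the list, where \<open>undefined\<close> takes its place.\<close>
    have "linmap V scalars (\<lambda>x. det (mat ?n ?n (\<lambda>(i, l). if i = length us then (fs ! l) x else (fs ! l) ((us @ undefined # vs) ! i))))"
      using fs True by (intro linmap_det_row) (auto simp: dual_simps lin_iff)
    moreover have "det_form (us @ x # vs) fs =
      det (mat ?n ?n (\<lambda>(i, l). if i = length us then (fs ! l) x else (fs ! l) ((us @ undefined # vs) ! i)))" for x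
      unfolding det_form_def using True
      by (simp, intro arg_cong[of _ _ det] eq_matI) (auto simp: nth_append_Cons_other[of _ us x vs undefined])
    ultimately show ?thesis by simp
  next
    case False
    then show ?thesis by (simp add: det_form_def linmap_def)
  qed
  fix x assume "x \<in> carrier V"
  show "det_form (us @ x # x # vs) fs = \<zero>\<^bsub>scalars\<^esub>"
    unfolding det_form_def using det_equal_rows[of "length us" "length fs" "Suc (length us)" "\<lambda>j l. (fs ! l) ((us @ x # x # vs) ! j)"]
    by (auto simp: nth_append)
qed simp

lemma alternating_det_form_right:
  fixes V :: "('k::field, 'v) module"
  assumes V: "vspace V" and vs: "vs \<in> lists (carrier V)"
  shows "alternating (dual V) scalars (\<lambda>fs. det_form vs fs)"
  unfolding alternating_def
proof (intro conjI ballI)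
  fix us ws :: "('v \<Rightarrow> 'k) list"
  let ?n = "Suc (length us + length ws)"
  show "linmap (dual V) scalars (\<lambda>x. det_form vs (us @ x # ws))"
  proof (cases "?n = length vs")
    case True
    have "linmap (dual V) scalars (\<lambda>x. det (mat ?n ?n (\<lambda>(i, l). if i = length us then x (vs ! l) else ((us @ undefined # ws) ! i) (vs ! l))))"
      using vs True by (intro linmap_det_row) (auto simp: dual_simps linmap_def)
    moreover have "det_form vs (us @ x # ws) =
      det (mat ?n ?n (\<lambda>(i, l). if i = length us then x (vs ! l) else ((us @ undefined # ws) ! i) (vs ! l)))" for x
      unfolding det_form_transpose using True
      by (simp, intro arg_cong[of _ _ det] eq_matI) (auto simp: nth_append_Cons_other[of _ us x ws undefined])
    ultimately show ?thesis by simp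
  next
    case False
    then show ?thesis by (simp add: det_form_def linmap_def)
  qed
  fix x
  show "det_form vs (us @ x # x # ws) = \<zero>\<^bsub>scalars\<^esub>"
    unfolding det_form_transpose using det_equal_rows[of "length us" "length vs" "Suc (length us)" "\<lambda>j l. ((us @ x # x # ws) ! j) (vs ! l)"]
    by (auto simp: nth_append)
qed simp

lemma det_form_Nil [simp]: "det_form vs [] = (if vs = [] then 1 else 0)"
  by (simp add: det_form_def)

lemma det_form_length: "length vs \<noteq> length fs \<Longrightarrow> det_form vs fs = 0"
  by (simp add: det_form_def)

lemma det_form_Cons:
  "det_form vs (f # fs) = (\<Sum>i<length vs. (- 1) ^ i * f (vs ! i) * det_form (take i vs @ drop (Suc i) vs) fs)"
proof (cases "length vs = Suc (length fs)")
  case True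
  let ?n = "length vs"
  let ?A = "mat ?n ?n (\<lambda>(j, l). ((f # fs) ! l) (vs ! j))"
  have "det_form vs (f # fs) = det ?A" using True by (simp add: det_form_def)
  also have "\<dots> = (\<Sum>i<?n. ?A $$ (i, 0) * cofactor ?A i 0)"
    using True by (intro laplace_expansion_column) auto
  also have "\<dots> = (\<Sum>i<?n. (- 1) ^ i * f (vs ! i) * det_form (take i vs @ drop (Suc i) vs) fs)"
  proof (intro sum.cong refl)
    fix i assume i: "i \<in> {..<?n}"
    have "mat_delete ?A i 0 = mat (length fs) (length fs) (\<lambda>(j, l). (fs ! l) ((take i vs @ drop (Suc i) vs) ! j))"
      using True i by (intro eq_matI) (auto simp: mat_delete_def nth_append)
    then have "det (mat_delete ?A i 0) = det_form (take i vs @ drop (Suc i) vs) fs"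
      using True i by (simp add: det_form_def)
    then show "?A $$ (i, 0) * cofactor ?A i 0 = (- 1) ^ i * f (vs ! i) * det_form (take i vs @ drop (Suc i) vs) fs"
      using i True by (cases "0 < ?n") (auto simp: cofactor_def simp del: length_greater_0_conv)
  qed
  finally show ?thesis .
next
  case False
  then show ?thesis by (auto simp: det_form_length intro!: sum.neutral[symmetric])
qed

text \<open>
  Naming the rows by arbitrary finite sets of indices, in place of positions in a list, lets rows be removed
  without renumbering the others.
\<close>
definition det_on :: "(nat \<Rightarrow> 'v) \<Rightarrow> nat set \<Rightarrow> ('v \<Rightarrow> 'k::field) list \<Rightarrow> 'k" where
  "det_on v U fs = det_form (map v (sorted_list_of_set U)) fs"

text \<open>
  The row \<open>i\<close> stands at the position that counts the smaller elements of \<open>U\<close>, which is the exponent of the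
  sign in the expansion along the first column.
\<close>
lemma det_on_Cons:
  assumes U: "finite U"
  shows "det_on v U (f # fs) = (\<Sum>i\<in>U. (- 1) ^ card {u \<in> U. u < i} * f (v i) * det_on v (U - {i}) fs)"
proof -
  define us where "us = sorted_list_of_set U"
  have us: "sorted us" "distinct us" "set us = U" "length us = card U" using U by (simp_all add: us_def)
  have 1: "card {u \<in> U. u < us ! m} = m" if m: "m < length us" for m
  proof -
    have "{u \<in> U. u < us ! m} = (\<lambda>l. us ! l) ` {..<m}"
    proof (intro equalityI subsetI)
      fix u assume "u \<in> {u \<in> U. u < us ! m}"
      then obtain l where l: "l < length us" "u = us ! l" "us ! l < us ! m" using us(3) by (auto simp: in_set_conv_nth)
      then have "l < m" using sorted_nth_mono[OF us(1), of m l] by (meson leD leI)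
      then show "u \<in> (\<lambda>l. us ! l) ` {..<m}" using l by auto
    next
      fix u assume "u \<in> (\<lambda>l. us ! l) ` {..<m}"
      then obtain l where l: "l < m" "u = us ! l" by auto
      then have "us ! l \<le> us ! m" "us ! l \<noteq> us ! m"
        using sorted_nth_mono[OF us(1), of l m] nth_eq_iff_index_eq[OF us(2), of l m] m by auto
      then show "u \<in> {u \<in> U. u < us ! m}" using l m us(3) by auto
    qed
    moreover have "inj_on (\<lambda>l. us ! l) {..<m}"
      using us(2) m by (auto simp: inj_on_def nth_eq_iff_index_eq)
    ultimately show ?thesis by (simp add: card_image)
  qed
  have 2: "sorted_list_of_set (U - {us ! m}) = take m us @ drop (Suc m) us" if m: "m < length us" for m
  proof (rule sorted_distinct_set_unique)
    have s: "us = take m us @ us ! m # drop (Suc m) us" using m by (rule id_take_nth_drop)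
    have "sorted (take m us @ us ! m # drop (Suc m) us)" "distinct (take m us @ us ! m # drop (Suc m) us)"
      using us(1,2) s by simp_all
    then show "sorted (take m us @ drop (Suc m) us)" "distinct (take m us @ drop (Suc m) us)"
      by (auto simp: sorted_append)
    have "U = set (take m us @ us ! m # drop (Suc m) us)" using us(3) s by simp
    then show "set (sorted_list_of_set (U - {us ! m})) = set (take m us @ drop (Suc m) us)"
      using \<open>distinct (take m us @ us ! m # drop (Suc m) us)\<close> U by auto
  qed (use U in simp_all)
  have "det_on v U (f # fs) = (\<Sum>m<length us. (- 1) ^ m * f (v (us ! m)) * det_form (map v (take m us @ drop (Suc m) us)) fs)"
    unfolding det_on_def us_def[symmetric] det_form_Cons by (simp add: take_map drop_map)
  also have "\<dots> = (\<Sum>m<length us. (- 1) ^ card {u \<in> U. u < us ! m} * f (v (us ! m)) * det_on v (U - {us ! m}) fs)"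
    unfolding det_on_def by (intro sum.cong) (simp_all add: 1 2)
  also have "\<dots> = (\<Sum>i\<in>U. (- 1) ^ card {u \<in> U. u < i} * f (v i) * det_on v (U - {i}) fs)"
    using us by (intro sum.reindex_bij_betw bij_betw_nth) auto
  finally show ?thesis .
qed

lemma split_sign_insert:
  assumes "finite A" "finite B" "i \<notin> A"
  shows "split_sign (insert i A) B = (- 1) ^ card {b \<in> B. b < i} * (split_sign A B :: 'k::field)"
proof -
  have "{(a, b) \<in> insert i A \<times> B. a > b} = {(a, b) \<in> A \<times> B. a > b} \<union> Pair i ` {b \<in> B. b < i}"
    by auto
  moreover have "finite {(a, b) \<in> A \<times> B. a > b}"
    using assms by (auto intro: finite_subset[of _ "A \<times> B"])
  moreover have "card ({(a, b) \<in> A \<times> B. a > b} \<union> Pair i ` {b \<in> B. b < i}) =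
      card {(a, b) \<in> A \<times> B. a > b} + card (Pair i ` {b \<in> B. b < i})"
    using assms calculation(2) by (intro card_Un_disjoint) auto
  moreover have "card (Pair i ` {b \<in> B. b < i}) = card {b \<in> B. b < i}"
    by (rule card_image) (simp add: inj_on_def)
  ultimately have "card {(a, b) \<in> insert i A \<times> B. a > b} = card {(a, b) \<in> A \<times> B. a > b} + card {b \<in> B. b < i}"
    by simp
  then show ?thesis by (simp add: split_sign_def power_add mult.commute)
qed

text \<open>
  Induction on \<open>fs\<close>: expand along the first column and apply the hypothesis to the remaining rows. The set \<open>S\<close>
  of rows that it assigns to \<open>fs\<close>, together with the row \<open>i\<close> of the expansion, is the set \<open>A\<close>. The signs agree
  because the rows in \<open>U\<close> before \<open>i\<close> lie either in \<open>A\<close>, where they give the sign of the expansion of the minor on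
  \<open>A\<close>, or in \<open>U - A\<close>, where they count the inversions that \<open>i\<close> adds to those of \<open>S\<close>.
\<close>
lemma det_on_append:
  fixes fs gs :: "('v \<Rightarrow> 'k::field) list"
  assumes "finite U"
  shows "det_on v U (fs @ gs) = (\<Sum>A\<in>Pow U. split_sign A (U - A) * det_on v A fs * det_on v (U - A) gs)"
  using assms
proof (induction fs arbitrary: U)
  case Nil
  have "(\<Sum>A\<in>Pow U. split_sign A (U - A) * det_on v A [] * det_on v (U - A) gs) =
      (\<Sum>A\<in>Pow U. if A = {} then det_on v U gs else 0)"
  proof (intro sum.cong refl)
    fix A assume "A \<in> Pow U"
    then have "finite A" using Nil by (auto intro: finite_subset)
    then show "split_sign A (U - A) * det_on v A [] * det_on v (U - A) gs = (if A = {} then det_on v U gs else 0)"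
      by (auto simp: det_on_def split_sign_def)
  qed
  then show ?case using Nil by simp
next
  case (Cons f fs)
  let ?c = "\<lambda>X i. (- 1) ^ card {u \<in> X. u < i} :: 'k"
  have "det_on v U ((f # fs) @ gs) = (\<Sum>i\<in>U. ?c U i * f (v i) * det_on v (U - {i}) (fs @ gs))"
    by (simp add: det_on_Cons[OF Cons.prems])
  also have "\<dots> = (\<Sum>i\<in>U. \<Sum>S\<in>Pow (U - {i}). ?c U i * f (v i) * (split_sign S (U - {i} - S) * det_on v S fs * det_on v (U - {i} - S) gs))"
    using Cons.prems by (simp add: Cons.IH sum_distrib_left)
  also have "\<dots> = (\<Sum>(i, S)\<in>(SIGMA i:U. Pow (U - {i})). ?c U i * f (v i) * (split_sign S (U - {i} - S) * det_on v S fs * det_on v (U - {i} - S) gs))"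
    using Cons.prems by (intro sum.Sigma) auto
  also have "\<dots> = (\<Sum>(A, i)\<in>(SIGMA A:Pow U. A). split_sign A (U - A) * (?c A i * f (v i) * det_on v (A - {i}) fs) * det_on v (U - A) gs)"
  proof (rule sum.reindex_bij_witness[of _ "\<lambda>(A, i). (i, A - {i})" "\<lambda>(i, S). (insert i S, i)"])
    fix x assume "x \<in> (SIGMA i:U. Pow (U - {i}))"
    then obtain i S where x: "x = (i, S)" and i: "i \<in> U" and S: "S \<subseteq> U - {i}" by auto
    let ?B = "U - insert i S"
    have fin: "finite S" "finite ?B" "finite (insert i S)" using S Cons.prems by (auto intro: finite_subset)
    have eqs: "U - {i} - S = ?B" "insert i S - {i} = S" using S by auto
    have "{u \<in> U. u < i} = {u \<in> insert i S. u < i} \<union> {u \<in> ?B. u < i}" using S i by auto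
    also have "card \<dots> = card {u \<in> insert i S. u < i} + card {u \<in> ?B. u < i}"
      using fin by (intro card_Un_disjoint) auto
    finally have "card {u \<in> U. u < i} = card {u \<in> insert i S. u < i} + card {u \<in> ?B. u < i}" .
    then have c: "?c U i = ?c (insert i S) i * ?c ?B i" by (simp add: power_add)
    have s: "split_sign (insert i S) ?B = ?c ?B i * (split_sign S ?B :: 'k)"
      using fin S by (intro split_sign_insert) auto
    have "split_sign (insert i S) ?B * (?c (insert i S) i * f (v i) * det_on v (insert i S - {i}) fs) * det_on v ?B gs =
        ?c U i * f (v i) * (split_sign S (U - {i} - S) * det_on v S fs * det_on v (U - {i} - S) gs)"
      unfolding eqs c s by (simp add: mult_ac)
    then show "(case (case x of (i, S) \<Rightarrow> (insert i S, i)) of (A, i) \<Rightarrow>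
        split_sign A (U - A) * (?c A i * f (v i) * det_on v (A - {i}) fs) * det_on v (U - A) gs) =
      (case x of (i, S) \<Rightarrow> ?c U i * f (v i) * (split_sign S (U - {i} - S) * det_on v S fs * det_on v (U - {i} - S) gs))"
      unfolding x prod.case .
  qed auto
  also have "\<dots> = (\<Sum>A\<in>Pow U. \<Sum>i\<in>A. split_sign A (U - A) * (?c A i * f (v i) * det_on v (A - {i}) fs) * det_on v (U - A) gs)"
    using Cons.prems by (intro sum.Sigma[symmetric]) (auto intro: finite_subset)
  also have "\<dots> = (\<Sum>A\<in>Pow U. split_sign A (U - A) * det_on v A (f # fs) * det_on v (U - A) gs)"
  proof (intro sum.cong refl)
    fix A assume "A \<in> Pow U"
    then have "finite A" using Cons.prems by (auto intro: finite_subset)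
    then show "(\<Sum>i\<in>A. split_sign A (U - A) * (?c A i * f (v i) * det_on v (A - {i}) fs) * det_on v (U - A) gs) =
        split_sign A (U - A) * det_on v A (f # fs) * det_on v (U - A) gs"
      by (simp add: det_on_Cons sum_distrib_left sum_distrib_right)
  qed
  finally show ?case .
qed

lemma nths_sorted_list: 
  assumes "A \<subseteq> {..<length vs}"
  shows "nths vs A = map ((!) vs) (sorted_list_of_set A)"
proof -
  let ?n = "length vs"
  have "zip vs [0..<?n] = map (\<lambda>i. (vs ! i, i)) [0..<?n]"
    by (rule nth_equalityI) auto
  then have "nths vs A = map ((!) vs) (filter (\<lambda>i. i \<in> A) [0..<?n])"
    by (simp add: nths_def filter_map comp_def)
  moreover have "filter (\<lambda>i. i \<in> A) [0..<?n] = sorted_list_of_set A"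
    using assms finite_subset[OF assms] by (intro sorted_distinct_set_unique) (auto intro: sorted_filter[of "\<lambda>x. x", simplified])
  ultimately show ?thesis by simp
qed

text \<open>Generalized Laplace expansion along the columns that belong to \<open>fs\<close>.\<close>
lemma det_form_append:
  assumes "fs \<noteq> []" "gs \<noteq> []"
  shows "det_form vs (fs @ gs) =
    (\<Sum>(A, B)\<in>splittings (length vs). split_sign A B * det_form (nths vs A) fs * det_form (nths vs B) gs)"
proof -
  let ?U = "{..<length vs}" and ?v = "(!) vs"
  have "sorted_list_of_set ?U = [0..<length vs]" by (simp add: sorted_list_of_set_range lessThan_atLeast0)
  then have "det_form vs (fs @ gs) = det_on ?v ?U (fs @ gs)" by (simp add: det_on_def map_nth)
  also have "\<dots> = (\<Sum>A\<in>Pow ?U. split_sign A (?U - A) * det_on ?v A fs * det_on ?v (?U - A) gs)"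
    by (rule det_on_append) simp
  also have "\<dots> = (\<Sum>A\<in>Pow ?U - {{}, ?U}. split_sign A (?U - A) * det_on ?v A fs * det_on ?v (?U - A) gs)"
  proof (intro sum.mono_neutral_right ballI)
    fix A assume "A \<in> Pow ?U - (Pow ?U - {{}, ?U})"
    then consider "A = {}" | "A = ?U" by auto
    then show "split_sign A (?U - A) * det_on ?v A fs * det_on ?v (?U - A) gs = 0"
      using assms by cases (simp_all add: det_on_def det_form_length)
  qed auto
  also have "\<dots> = (\<Sum>(A, B)\<in>splittings (length vs). split_sign A B * det_form (nths vs A) fs * det_form (nths vs B) gs)"
  proof (rule sum.reindex_bij_witness[of _ fst "\<lambda>A. (A, ?U - A)"])
    fix A assume A: "A \<in> Pow ?U - {{}, ?U}"
    then have "A \<subseteq> ?U" "?U - A \<subseteq> ?U" by auto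
    then show "(case (A, ?U - A) of (A, B) \<Rightarrow> split_sign A B * det_form (nths vs A) fs * det_form (nths vs B) gs) =
        split_sign A (?U - A) * det_on ?v A fs * det_on ?v (?U - A) gs"
      by (simp only: prod.case det_on_def nths_sorted_list)
    show "(A, ?U - A) \<in> splittings (length vs)" using A unfolding splittings_def by blast
  next
    fix P assume "P \<in> splittings (length vs)"
    then obtain A B where P: "P = (A, B)" "A \<noteq> {}" "B \<noteq> {}" "A \<inter> B = {}" "A \<union> B = ?U"
      unfolding splittings_def by blast
    then have "?U - A = B" by blast
    then show "(fst P, ?U - fst P) = P" using P(1) by simp
    show "fst P \<in> Pow ?U - {{}, ?U}" using P by auto
  qed simp
  finally show ?thesis .
qed

section \<open>The identification of the dual complex\<close>

locale fin_dim_space =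
  fixes V :: "('k::field, 'v) module"
  assumes V: "vspace V" and fd: "vectorspace.fin_dim class_ring V"
begin

abbreviation (input) "W \<equiv> dual V"
abbreviation (input) "P \<equiv> ext_pos V"
abbreviation (input) "R \<equiv> reduced (Lam V)"
abbreviation (input) "aug \<equiv> augmentation (dual V)"
abbreviation (input) "cls \<equiv> reduced_class (Lam V)"

lemmas W = vspace_dual[OF V]
lemmas EV = vspace_ext[OF V] and EW = vspace_ext[OF W]
lemmas PV = vspace_ext_pos[OF V]

sublocale A: augmented_algebra "Lam V" aug
  by (rule augmented_ext[OF W])

text \<open>
  The determinant is alternating in the columns, which gives a functional on \<open>\<Lambda>\<close> for fixed \<open>vs\<close>, and this
  functional is alternating in the rows.
\<close>
lemma ext_pairing_exists:
  "\<exists>D\<in>lin (ext V) (dual (Lam V)). \<forall>vs\<in>lists (carrier V). \<forall>fs\<in>lists (carrier W).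
     D (wedge V vs) (wedge W fs) = det_form vs fs"
proof -
  have "\<exists>h\<in>lin (Lam V) scalars. \<forall>fs\<in>lists (carrier W). h (wedge W fs) = det_form vs fs"
    if "vs \<in> lists (carrier V)" for vs
    by (rule ext_lift[OF W vspace_scalars alternating_det_form_right[OF V that]])
  then obtain \<Phi> where Phi: "\<And>vs. vs \<in> lists (carrier V) \<Longrightarrow> \<Phi> vs \<in> lin (Lam V) scalars"
    "\<And>vs fs. vs \<in> lists (carrier V) \<Longrightarrow> fs \<in> lists (carrier W) \<Longrightarrow> \<Phi> vs (wedge W fs) = det_form vs fs"
    by metis
  have sub: "wedge W ` lists (carrier W) \<subseteq> carrier (Lam V)" by (auto intro: wedge_closed[OF W])
  have "alternating V (dual (Lam V)) \<Phi>"
    unfolding alternating_def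
  proof (intro conjI ballI)
    fix vs assume "vs \<in> lists (carrier V)"
    then show "\<Phi> vs \<in> carrier (dual (Lam V))" using Phi(1) by (simp add: dual_simps)
  next
    fix us vs assume us: "us \<in> lists (carrier V)" and vs: "vs \<in> lists (carrier V)"
    have mem: "us @ x # vs \<in> lists (carrier V)" if "x \<in> carrier V" for x using us vs that by simp
    show "linmap V (dual (Lam V)) (\<lambda>x. \<Phi> (us @ x # vs))"
    proof (rule linmap_into_dual_on_span[OF V EW _ sub ext_span[OF W]])
      fix s assume "s \<in> wedge W ` lists (carrier W)"
      then obtain fs where fs: "fs \<in> lists (carrier W)" "s = wedge W fs" by blast
      have "linmap V scalars (\<lambda>x. det_form (us @ x # vs) fs)"
        by (rule alternating_linmap[OF alternating_det_form_left[OF V fs(1)] us vs])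
      then show "linmap V scalars (\<lambda>x. \<Phi> (us @ x # vs) s)"
        by (subst linmap_cong[OF V]) (simp_all only: fs Phi(2)[OF mem fs(1)])
    qed (rule Phi(1)[OF mem])
    fix x assume x: "x \<in> carrier V"
    have m2: "us @ x # x # vs \<in> lists (carrier V)" using us vs x by simp
    show "\<Phi> (us @ x # x # vs) = \<zero>\<^bsub>dual (Lam V)\<^esub>"
    proof (rule lin_eqI[OF EW vspace_scalars Phi(1)[OF m2] _ sub ext_span[OF W]])
      show "\<zero>\<^bsub>dual (Lam V)\<^esub> \<in> lin (Lam V) scalars"
        using vs_zero[OF vspace_dual[OF EW]] by (simp add: dual_simps)
      fix s assume s: "s \<in> wedge W ` lists (carrier W)"
      then obtain fs where fs: "fs \<in> lists (carrier W)" "s = wedge W fs" by blast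
      show "\<Phi> (us @ x # x # vs) s = \<zero>\<^bsub>dual (Lam V)\<^esub> s"
        using alternating_zero[OF alternating_det_form_left[OF V fs(1)] us vs x] s sub
        by (auto simp: fs(2) Phi(2)[OF m2 fs(1)] dual_simps)
    qed
  qed
  from ext_lift[OF V vspace_dual[OF EW] this] obtain D where
    D: "D \<in> lin (ext V) (dual (Lam V))" "\<And>vs. vs \<in> lists (carrier V) \<Longrightarrow> D (wedge V vs) = \<Phi> vs" by blast
  show ?thesis
    using D(1) by (intro bexI[of _ D] ballI) (simp_all only: D(2) Phi(2))
qed

text \<open>Each class has a representative in the augmentation ideal, which is spanned by nonempty wedge products.\<close>
lemma reduced_wedge_span: "carrier R \<subseteq> span_in R ((\<lambda>fs. cls (wedge W fs)) ` {fs \<in> lists (carrier W). fs \<noteq> []})"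
proof
  let ?S = "(\<lambda>fs. cls (wedge W fs)) ` {fs \<in> lists (carrier W). fs \<noteq> []}"
  fix C assume "C \<in> carrier R"
  then obtain x where x: "x \<in> carrier (Lam V)" "aug x = 0" "C = cls x" using A.B_cases by blast
  have xp: "x \<in> carrier (ext_pos W)" by (rule augmentation_zero_in_pos[OF W x(1,2)])
  have S: "?S \<subseteq> carrier R"
    using linmap_closed[OF A.linmap_cls] wedge_closed[OF W] by blast
  have "linmap (ext_pos W) R cls"
    using linmap_from_sub[OF subsp_ext_pos[OF W] A.linmap_cls] by (simp add: ext_pos_def)
  then have "cls x \<in> span_in R ?S"
  proof (rule linmap_span_into[OF vspace_ext_pos[OF W] A.vspace_B _ subsp_span[OF A.vspace_B S]])
    show "wedge W ` {fs \<in> lists (carrier W). fs \<noteq> []} \<subseteq> carrier (ext_pos W)"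
      using wedge_in_ext_pos[OF W] by blast
    show "x \<in> span_in (ext_pos W) (wedge W ` {fs \<in> lists (carrier W). fs \<noteq> []})"
      using ext_pos_span[OF W] xp by blast
    fix s assume "s \<in> wedge W ` {fs \<in> lists (carrier W). fs \<noteq> []}"
    then have "cls s \<in> ?S" by blast
    then show "cls s \<in> span_in R ?S" by (rule span_superset[OF A.vspace_B S])
  qed
  then show "C \<in> span_in R ?S" using x(3) by simp
qed

text \<open>
  The determinant pairing passes to \<open>\<Lambda>/k\<close> because elements of positive degree are orthogonal to the unit.
\<close>
lemma pairing_props:
  shows pairing_lin: "pairing V \<in> lin P (dual R)"
    and pairing_wedge: "\<And>vs fs. vs \<in> lists (carrier V) \<Longrightarrow> vs \<noteq> [] \<Longrightarrow> fs \<in> lists (carrier W) \<Longrightarrow>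
      pairing V (wedge V vs) (cls (wedge W fs)) = det_form vs fs"
proof -
  obtain D where D: "D \<in> lin (ext V) (dual (Lam V))" "\<And>vs fs. vs \<in> lists (carrier V) \<Longrightarrow> fs \<in> lists (carrier W) \<Longrightarrow>
     D (wedge V vs) (wedge W fs) = det_form vs fs" using ext_pairing_exists by blast
  note DL = lin_linmap[OF D(1)]
  have DP: "linmap P (dual (Lam V)) D"
    using linmap_from_sub[OF subsp_ext_pos[OF V] DL] by (simp add: ext_pos_def)
  let ?S = "wedge V ` {vs \<in> lists (carrier V). vs \<noteq> []}"
  have S: "?S \<subseteq> carrier P" using wedge_in_ext_pos[OF V] by blast
  have D1: "D x \<one>\<^bsub>Lam V\<^esub> = 0" if x: "x \<in> carrier P" for x
  proof -
    have "D x \<one>\<^bsub>Lam V\<^esub> \<in> {0}"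
    proof (rule linmap_span_into[OF PV vspace_scalars linmap_dual_eval[OF DP A.one_closed] _ S])
      show "subsp scalars {0::'k}" by (simp add: subsp_def)
      show "x \<in> span_in P ?S" using x ext_pos_span[OF V] by blast
      fix s assume "s \<in> ?S"
      then obtain vs where vs: "vs \<in> lists (carrier V)" "vs \<noteq> []" "s = wedge V vs" by blast
      show "D s \<one>\<^bsub>Lam V\<^esub> \<in> {0}"
        using vs(2) unfolding ext_one[OF W] vs(3) D(2)[OF vs(1) lists.Nil] by simp
    qed
    then show ?thesis by simp
  qed
  have "\<exists>h\<in>lin R scalars. \<forall>l\<in>carrier (Lam V). h (cls l) = D x l" if x: "x \<in> carrier P" for x
  proof -
    have "D x \<in> lin (Lam V) scalars" using linmap_closed[OF DP x] by (simp add: dual_simps)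
    then have l: "linmap (Lam V) scalars (D x)" by (rule lin_linmap)
    have "D x n = \<zero>\<^bsub>scalars\<^esub>" if "n \<in> unit_line (Lam V)" for n
      using that linmap_smult[OF l A.one_closed] D1[OF x] by (auto simp: unit_line_def)
    from quot_lift[OF EW A.subsp_unit_line vspace_scalars l this]
    show ?thesis unfolding reduced_def reduced_class_def .
  qed
  then obtain F where F: "\<And>x. x \<in> carrier P \<Longrightarrow> F x \<in> lin R scalars"
    "\<And>x l. x \<in> carrier P \<Longrightarrow> l \<in> carrier (Lam V) \<Longrightarrow> F x (cls l) = D x l" by metis
  have "linmap P (dual R) F"
  proof (rule linmap_into_dual_on_span[OF PV A.vspace_B F(1)])
    show "carrier R \<subseteq> carrier R" "carrier R \<subseteq> span_in R (carrier R)" using span_superset[OF A.vspace_B] by auto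
    fix s assume "s \<in> carrier R"
    then obtain l where l: "l \<in> carrier (Lam V)" "s = cls l" using A.B_cases by blast
    show "linmap P scalars (\<lambda>x. F x s)"
      using linmap_dual_eval[OF DP l(1)] by (subst linmap_cong[OF PV]) (simp_all add: l F(2))
  qed
  then have FL: "restrict F (carrier P) \<in> lin P (dual R)" by (rule lin_restrict[OF PV])
  have Fw: "restrict F (carrier P) (wedge V vs) (cls (wedge W fs)) = det_form vs fs"
    if "vs \<in> lists (carrier V)" "vs \<noteq> []" "fs \<in> lists (carrier W)" for vs fs
    using wedge_in_ext_pos[OF V that(1,2)] wedge_closed[OF W that(3)] F(2) D(2)[OF that(1,3)] by simp
  have "pairing V = restrict F (carrier P)"
    unfolding pairing_def
  proof (rule the_lin_eqI, rule FL)
    show "\<forall>i\<ge>1. \<forall>i'. \<forall>vs\<in>tuples V i. \<forall>fs\<in>tuples (dual V) i'.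
       restrict F (carrier P) (wedge V vs) (cls (wedge (dual V) fs)) =
         (if i' = i then det (mat i i (\<lambda>(j, l). (fs ! l) (vs ! j))) else 0)"
    proof (intro allI impI ballI)
      fix i i' :: nat and vs fs assume "1 \<le> i" "vs \<in> tuples V i" "fs \<in> tuples (dual V) i'"
      then have m: "vs \<in> lists (carrier V)" "vs \<noteq> []" "fs \<in> lists (carrier W)" "length vs = i" "length fs = i'"
        by (auto simp: tuples_def)
      show "restrict F (carrier P) (wedge V vs) (cls (wedge (dual V) fs)) =
         (if i' = i then det (mat i i (\<lambda>(j, l). (fs ! l) (vs ! j))) else 0)"
        unfolding Fw[OF m(1-3)] det_form_def m(4,5) by simp
    qed
    fix G assume G: "G \<in> lin P (dual R)" and Gw: "\<forall>i\<ge>1. \<forall>i'. \<forall>vs\<in>tuples V i. \<forall>fs\<in>tuples (dual V) i'.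
       G (wedge V vs) (cls (wedge (dual V) fs)) =
         (if i' = i then det (mat i i (\<lambda>(j, l). (fs ! l) (vs ! j))) else 0)"
    show "G = restrict F (carrier P)"
    proof (rule lin_eqI[OF PV vspace_dual[OF A.vspace_B] G FL S ext_pos_span[OF V]])
      fix s assume s: "s \<in> ?S"
      then obtain vs where vs: "vs \<in> lists (carrier V)" "vs \<noteq> []" "s = wedge V vs" by blast
      have sP: "s \<in> carrier P" using s S by blast
      let ?Y = "(\<lambda>fs. cls (wedge W fs)) ` {fs \<in> lists (carrier W). fs \<noteq> []}"
      show "G s = restrict F (carrier P) s"
      proof (rule lin_eqI[OF A.vspace_B vspace_scalars _ _ _ reduced_wedge_span])
        show "G s \<in> lin R scalars" "restrict F (carrier P) s \<in> lin R scalars"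
          using linmap_closed[OF lin_linmap[OF G] sP] linmap_closed[OF lin_linmap[OF FL] sP] by (simp_all add: dual_simps)
        show "?Y \<subseteq> carrier R" using linmap_closed[OF A.linmap_cls] wedge_closed[OF W] by blast
        fix y assume "y \<in> ?Y"
        then obtain fs where fs: "fs \<in> lists (carrier W)" "y = cls (wedge W fs)" by blast
        have "vs \<in> tuples V (length vs)" "fs \<in> tuples W (length fs)" "1 \<le> length vs"
          using vs fs by (simp_all add: tuples_lists[OF V] tuples_lists[OF W] Suc_le_eq del: in_lists_conv_set)
        then have "G (wedge V vs) (cls (wedge W fs)) = det_form vs fs"
          using Gw by (simp add: det_form_def)
        then show "G s y = restrict F (carrier P) s y" using Fw[OF vs(1,2) fs(1)] vs(3) fs(2) by simp
      qed
    qed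
  qed
  then show "pairing V \<in> lin P (dual R)"
    "\<And>vs fs. vs \<in> lists (carrier V) \<Longrightarrow> vs \<noteq> [] \<Longrightarrow> fs \<in> lists (carrier W) \<Longrightarrow>
      pairing V (wedge V vs) (cls (wedge W fs)) = det_form vs fs"
    using FL Fw by simp_all
qed

text \<open>
  For words of equal length the matrix of the values is the identity if the words agree; otherwise an
  index that occurs only in the first word gives a row of zeros.
\<close>
lemma pairing_dual_bases:
  "\<exists>(I :: nat list set) e f. finite I \<and> e ` I \<subseteq> carrier P \<and> carrier P \<subseteq> span_in P (e ` I) \<and>
     f ` I \<subseteq> carrier R \<and> carrier R \<subseteq> span_in R (f ` I) \<and>
     (\<forall>i\<in>I. \<forall>j\<in>I. pairing V (e i) (f j) = (if i = j then 1 else 0))"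
proof -
  from dual_basis_exists[OF V fd] obtain n :: nat and b \<beta> where
    bs: "b ` {..<n} \<subseteq> carrier V \<and> carrier V \<subseteq> span_in V (b ` {..<n}) \<and>
     \<beta> ` {..<n} \<subseteq> carrier W \<and> carrier W \<subseteq> span_in W (\<beta> ` {..<n}) \<and>
     (\<forall>i<n. \<forall>j<n. \<beta> i (b j) = (if i = j then 1 else 0))" by (elim exE)
  have b: "b ` {..<n} \<subseteq> carrier V" "carrier V \<subseteq> span_in V (b ` {..<n})"
    and beta: "\<beta> ` {..<n} \<subseteq> carrier W" "carrier W \<subseteq> span_in W (\<beta> ` {..<n})"
    and bb: "\<And>i j. i < n \<Longrightarrow> j < n \<Longrightarrow> \<beta> i (b j) = (if i = j then 1 else 0)"
    using bs by simp_all
  let ?I = "increasing_words n - {[]}"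
  let ?e = "\<lambda>xs. wedge V (map b xs)" and ?f = "\<lambda>xs. cls (wedge W (map \<beta> xs))"
  have lt: "x < n" if "xs \<in> increasing_words n" "x \<in> set xs" for x xs
    using that by (auto simp: increasing_words_def)
  have bm: "map b xs \<in> lists (carrier V)" "map \<beta> xs \<in> lists (carrier W)" if "xs \<in> increasing_words n" for xs
    using b(1) beta(1) lt[OF that] by (auto simp: image_subset_iff)
  have e: "?e ` ?I \<subseteq> carrier P" using wedge_in_ext_pos[OF V bm(1)] by auto
  have f: "?f ` ?I \<subseteq> carrier R" using linmap_closed[OF A.linmap_cls] wedge_closed[OF W bm(2)] by auto
  have eE: "?e ` ?I \<subseteq> carrier (ext V)" using wedge_closed[OF V bm(1)] by auto
  have "wedge V vs \<in> span_in (ext V) (?e ` ?I)" if vs: "vs \<in> lists (carrier V)" "vs \<noteq> []" for vs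
  proof -
    have "{wedge V (map b xs) |xs. xs \<in> increasing_words n \<and> length xs = length vs} \<subseteq> ?e ` ?I"
    proof
      fix s assume "s \<in> {wedge V (map b xs) |xs. xs \<in> increasing_words n \<and> length xs = length vs}"
      then obtain xs where xs: "s = ?e xs" "xs \<in> increasing_words n" "length xs = length vs" by blast
      have "xs \<in> ?I" using xs(2,3) vs(2) by auto
      then show "s \<in> ?e ` ?I" unfolding xs(1) by (rule imageI)
    qed
    from span_mono[OF EV eE this] show ?thesis
      by (rule subsetD) (rule wedge_in_span_increasing[OF V b vs(1)])
  qed
  then have "carrier P \<subseteq> span_in (ext V) (?e ` ?I)"
    by (rule ext_pos_span_least[OF V subsp_span[OF EV eE]])
  then have spe: "carrier P \<subseteq> span_in P (?e ` ?I)" using ext_pos_span_in[OF V e] by simp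
  have fE: "(\<lambda>xs. wedge W (map \<beta> xs)) ` ?I \<subseteq> carrier (Lam V)" using wedge_closed[OF W bm(2)] by auto
  have "cls (wedge W fs) \<in> span_in R (?f ` ?I)" if fs: "fs \<in> lists (carrier W)" "fs \<noteq> []" for fs
  proof (rule linmap_span_into[OF EW A.vspace_B A.linmap_cls subsp_span[OF A.vspace_B f] fE])
    have "{wedge W (map \<beta> xs) |xs. xs \<in> increasing_words n \<and> length xs = length fs} \<subseteq> (\<lambda>xs. wedge W (map \<beta> xs)) ` ?I"
    proof
      fix s assume "s \<in> {wedge W (map \<beta> xs) |xs. xs \<in> increasing_words n \<and> length xs = length fs}"
      then obtain xs where xs: "s = wedge W (map \<beta> xs)" "xs \<in> increasing_words n" "length xs = length fs" by blast
      have "xs \<in> ?I" using xs(2,3) fs(2) by auto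
      then show "s \<in> (\<lambda>xs. wedge W (map \<beta> xs)) ` ?I" unfolding xs(1) by (rule imageI)
    qed
    from span_mono[OF EW fE this] show "wedge W fs \<in> span_in (Lam V) ((\<lambda>xs. wedge W (map \<beta> xs)) ` ?I)"
      by (rule subsetD) (rule wedge_in_span_increasing[OF W beta fs(1)])
    fix s assume "s \<in> (\<lambda>xs. wedge W (map \<beta> xs)) ` ?I"
    then show "cls s \<in> span_in R (?f ` ?I)" using span_superset[OF A.vspace_B f] by blast
  qed
  then have "span_in R ((\<lambda>fs. cls (wedge W fs)) ` {fs \<in> lists (carrier W). fs \<noteq> []}) \<subseteq> span_in R (?f ` ?I)"
    by (intro span_least[OF A.vspace_B subsp_span[OF A.vspace_B f]]) blast
  then have spf: "carrier R \<subseteq> span_in R (?f ` ?I)"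
    by (rule order_trans[OF reduced_wedge_span])
  have "pairing V (?e xs) (?f ys) = (if xs = ys then 1 else 0)" if xs: "xs \<in> ?I" and ys: "ys \<in> ?I" for xs ys
  proof -
    have "pairing V (?e xs) (?f ys) = det_form (map b xs) (map \<beta> ys)"
      using xs ys bm by (intro pairing_wedge) auto
    also have "\<dots> = (if xs = ys then 1 else 0)"
    proof (cases "length xs = length ys")
      case len: True
      let ?m = "length xs"
      have val: "\<beta> (ys ! l) (b (xs ! j)) = (if ys ! l = xs ! j then 1 else 0)" if "l < ?m" "j < ?m" for l j
        using that len xs ys by (intro bb lt[OF _ nth_mem]) auto
      have dist: "distinct xs" using xs by (auto simp: increasing_words_def strict_sorted_iff)
      show ?thesis
      proof (cases "xs = ys")
        case True
        have "mat ?m ?m (\<lambda>(j, l). (map \<beta> ys ! l) (map b xs ! j)) = 1\<^sub>m ?m"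
          using val True dist by (intro eq_matI) (auto simp: nth_eq_iff_index_eq)
        then show ?thesis using True by (simp add: det_form_def)
      next
        case False
        then obtain x where "x \<in> set xs" "x \<notin> set ys"
          using increasing_words_eq[of xs n ys] xs ys len by blast
        then obtain j where j: "j < ?m" "xs ! j \<notin> set ys" by (metis in_set_conv_nth)
        have z: "\<beta> (ys ! l) (b (xs ! j)) = 0" if "l < ?m" for l
          using val[OF that j(1)] j(2) that len by (metis nth_mem)
        have m: "(\<lambda>(i, l). (map \<beta> ys ! l) (map b xs ! i)) = (\<lambda>(i, l). if i = j then (map \<beta> ys ! l) (map b xs ! j) else (map \<beta> ys ! l) (map b xs ! i))"
          by auto
        have "det (mat ?m ?m (\<lambda>(i, l). (map \<beta> ys ! l) (map b xs ! i))) = 0"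
          unfolding m det_row_expand[OF j(1)]
        proof (intro sum.neutral ballI)
          fix p assume "p \<in> {p. p permutes {0..<?m}}"
          then have "p j < ?m" using permutes_in_image[of p "{0..<?m}" j] j by auto
          then show "signof p * (\<Prod>i\<in>{0..<?m} - {j}. (map \<beta> ys ! p i) (map b xs ! i)) * (map \<beta> ys ! p j) (map b xs ! j) = 0"
            using z j(1) len by simp
        qed
        moreover have "det_form (map b xs) (map \<beta> ys) = det (mat ?m ?m (\<lambda>(i, l). (map \<beta> ys ! l) (map b xs ! i)))"
          unfolding det_form_def length_map len by simp
        ultimately show ?thesis using False by simp
      qed
    qed (auto simp: det_form_length)
    finally show ?thesis .
  qed
  then show ?thesis
    using finite_increasing_words e spe f spf by (intro exI[of _ ?I] exI[of _ ?e] exI[of _ ?f]) auto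
qed

lemma tpow_pairing_props:
  shows tpow_pairing_lin: "tpow_pairing V p \<in> lin (tpow P p) (dual (tpow R p))"
    and tpow_pairing_pure: "\<And>as ls. as \<in> tuples P p \<Longrightarrow> ls \<in> tuples R p \<Longrightarrow>
      tpow_pairing V p (pure_tpow P as) (pure_tpow R ls) = (\<Prod>j<p. pairing V (as ! j) (ls ! j))"
proof -
  from tpow_pairing_exists[OF PV A.vspace_B lin_linmap[OF pairing_lin], of p] obtain G where
    G: "G \<in> lin (tpow P p) (dual (tpow R p))" "\<forall>as\<in>tuples P p. \<forall>ls\<in>tuples R p.
     G (pure_tpow P as) (pure_tpow R ls) = (\<Prod>j<p. pairing V (as ! j) (ls ! j))" by blast
  have "tpow_pairing V p = G"
    unfolding tpow_pairing_def
  proof (rule the_lin_eqI, rule G(1), rule G(2))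
    fix H assume H: "H \<in> lin (tpow P p) (dual (tpow R p))" "\<forall>as\<in>tuples P p. \<forall>ls\<in>tuples R p.
     H (pure_tpow P as) (pure_tpow R ls) = (\<Prod>j<p. pairing V (as ! j) (ls ! j))"
    show "H = G"
      by (rule tpow_pairing_unique[OF PV A.vspace_B H(1) G(1)]) (simp add: H(2) G(2))
  qed
  then show "tpow_pairing V p \<in> lin (tpow P p) (dual (tpow R p))"
    "\<And>as ls. as \<in> tuples P p \<Longrightarrow> ls \<in> tuples R p \<Longrightarrow>
      tpow_pairing V p (pure_tpow P as) (pure_tpow R ls) = (\<Prod>j<p. pairing V (as ! j) (ls ! j))"
    using G by simp_all
qed

lemma bij_tpow_pairing: "bij_betw (tpow_pairing V p) (carrier (tpow P p)) (carrier (dual (tpow R p)))"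
proof -
  from pairing_dual_bases obtain I :: "nat list set" and e f where
    bs: "finite I \<and> e ` I \<subseteq> carrier P \<and> carrier P \<subseteq> span_in P (e ` I) \<and>
     f ` I \<subseteq> carrier R \<and> carrier R \<subseteq> span_in R (f ` I) \<and>
     (\<forall>i\<in>I. \<forall>j\<in>I. pairing V (e i) (f j) = (if i = j then 1 else 0))" by (elim exE)
  have I: "finite I" "e ` I \<subseteq> carrier P" "carrier P \<subseteq> span_in P (e ` I)"
     "f ` I \<subseteq> carrier R" "carrier R \<subseteq> span_in R (f ` I)"
     and ef: "\<And>i j. i \<in> I \<Longrightarrow> j \<in> I \<Longrightarrow> pairing V (e i) (f j) = (if i = j then 1 else 0)"
    using bs by simp_all
  show ?thesis
    by (rule tpow_pairing_bij[OF PV A.vspace_B lin_linmap[OF pairing_lin] I ef tpow_pairing_lin tpow_pairing_pure])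
qed

lemma bij_cobar_ident: "bij_betw (cobar_ident V p) (carrier (tpow P p)) (bar_hom (Lam V) aug p)"
proof -
  have "bij_betw (the_inv_into (bar_hom (Lam V) aug p) (bar_restrict (Lam V) p) \<circ> tpow_pairing V p)
    (carrier (tpow P p)) (bar_hom (Lam V) aug p)"
    by (rule bij_betw_trans[OF bij_tpow_pairing bij_betw_the_inv_into[OF A.bij_bar_restrict]])
  then show ?thesis by (simp add: cobar_ident_def[abs_def] comp_def)
qed

lemma cobar_ident_gen:
  assumes x: "x \<in> carrier (tpow P p)" and ys: "ys \<in> tuples (Lam V) p"
  shows "cobar_ident V p x (bar_gen (Lam V) \<one>\<^bsub>Lam V\<^esub> ys) = tpow_pairing V p x (pure_tpow R (map cls ys))"
proof -
  have "tpow_pairing V p x \<in> carrier (dual (tpow R p))"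
    using bij_betwE[OF bij_tpow_pairing] x by blast
  then have "bar_restrict (Lam V) p (cobar_ident V p x) = tpow_pairing V p x"
    unfolding cobar_ident_def by (intro f_the_inv_into_f_bij_betw[OF A.bij_bar_restrict])
  then show ?thesis using A.bar_restrict_gen[OF ys, of "cobar_ident V p x"] by simp
qed

lemma cobar_diff_props:
  assumes x: "x \<in> carrier (tpow P p)"
  shows cobar_diff_closed: "cobar_diff V (Suc p) x \<in> carrier (tpow P (Suc p))"
    and cobar_diff_ident: "cobar_ident V (Suc p) (cobar_diff V (Suc p) x) = bar_codiff (Lam V) aug (Suc p) (cobar_ident V p x)"
proof -
  have "cobar_ident V p x \<in> bar_hom (Lam V) aug p" using bij_betwE[OF bij_cobar_ident] x by blast
  then have h: "bar_codiff (Lam V) aug (Suc p) (cobar_ident V p x) \<in> bar_hom (Lam V) aug (Suc p)" by (rule A.bar_codiff_hom)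
  note bij = bij_cobar_ident[of "Suc p"]
  show "cobar_diff V (Suc p) x \<in> carrier (tpow P (Suc p))"
    unfolding cobar_diff_def diff_Suc_1 using bij_betwE[OF bij_betw_the_inv_into[OF bij]] h by blast
  show "cobar_ident V (Suc p) (cobar_diff V (Suc p) x) = bar_codiff (Lam V) aug (Suc p) (cobar_ident V p x)"
    unfolding cobar_diff_def diff_Suc_1 using bij h by (intro f_the_inv_into_f) (auto simp: bij_betw_def)
qed

abbreviation (input) "aug_tuples q \<equiv> {ys \<in> tuples (Lam V) q. \<forall>y\<in>set ys. aug y = 0}"

text \<open>The value of a tensor \<open>z\<close> over \<open>V\<close>, viewed as a functional, at the classes of \<open>ys\<close>.\<close>
abbreviation (input) "ev q z ys \<equiv> tpow_pairing V q z (pure_tpow R (map cls ys))"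

text \<open>
  Up to the signs the dual differential is dual to multiplying two adjacent entries. The comparison with \<open>\<delta>\<close>
  rests on this formula.
\<close>
lemma pairing_cobar_diff:
  assumes x: "x \<in> carrier (tpow P p)" and ys: "ys \<in> aug_tuples (Suc p)"
  shows "ev (Suc p) (cobar_diff V (Suc p) x) ys =
    (\<Sum>j\<in>{1..p}. (- 1) ^ j * ev p x (contract (Lam V) j ys))"
proof -
  have y: "ys \<in> tuples (Lam V) (Suc p)" "\<And>y. y \<in> set ys \<Longrightarrow> aug y = 0" using ys by auto
  have f: "cobar_ident V p x \<in> bar_hom (Lam V) aug p" using bij_betwE[OF bij_cobar_ident] x by blast
  have "ev (Suc p) (cobar_diff V (Suc p) x) ys =
     bar_codiff (Lam V) aug (Suc p) (cobar_ident V p x) (bar_gen (Lam V) \<one>\<^bsub>Lam V\<^esub> ys)"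
    by (simp only: cobar_ident_gen[OF cobar_diff_closed[OF x] y(1), symmetric] cobar_diff_ident[OF x])
  also have "\<dots> = (\<Sum>j\<in>{1..p}. (- 1) ^ j * cobar_ident V p x (bar_gen (Lam V) \<one>\<^bsub>Lam V\<^esub> (contract (Lam V) j ys)))"
    by (rule A.bar_codiff_aug_ideal[OF f y])
  also have "\<dots> = (\<Sum>j\<in>{1..p}. (- 1) ^ j * ev p x (contract (Lam V) j ys))"
    using A.contract_tuples[OF y(1)] by (intro sum.cong refl) (simp add: cobar_ident_gen[OF x])
  finally show ?thesis .
qed

text \<open>
  Tensors of classes of elements of the augmentation ideal span the tensor power of \<open>\<Lambda>/k\<close>, and the pairing
  is injective in its first argument.
\<close>
lemma tpow_pairing_separates:
  assumes z: "z \<in> carrier (tpow P q)" "z' \<in> carrier (tpow P q)"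
    and e: "\<And>ys. ys \<in> aug_tuples q \<Longrightarrow>
      ev q z ys = ev q z' ys"
  shows "z = z'"
proof -
  let ?Y = "(\<lambda>ys. pure_tpow R (map cls ys)) ` aug_tuples q"
  have "tpow_pairing V q z = tpow_pairing V q z'"
  proof (rule lin_eqI[OF A.vspace_Bp vspace_scalars _ _ _ A.tpow_B_span])
    show "tpow_pairing V q z \<in> lin (tpow R q) scalars" "tpow_pairing V q z' \<in> lin (tpow R q) scalars"
      using z linmap_closed[OF lin_linmap[OF tpow_pairing_lin]] by (simp_all add: dual_simps)
    show "?Y \<subseteq> carrier (tpow R q)" by (auto intro: A.pure_cls_closed)
    fix s assume "s \<in> ?Y"
    then obtain ys where "ys \<in> aug_tuples q" "s = pure_tpow R (map cls ys)" by blast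
    then show "tpow_pairing V q z s = tpow_pairing V q z' s" using e by simp
  qed
  then show ?thesis using bij_tpow_pairing z by (auto simp: bij_betw_def inj_on_def)
qed

lemma linmap_tpow_pairing:
  "ys \<in> tuples (Lam V) q \<Longrightarrow> linmap (tpow P q) scalars (\<lambda>z. ev q z ys)"
  by (rule linmap_dual_eval[OF lin_linmap[OF tpow_pairing_lin] A.pure_cls_closed])

text \<open>
  The definition by inverse functions does not show linearity, but the values at the tensors that separate
  points depend linearly on the argument.
\<close>
lemma linmap_cobar_diff: "linmap (tpow P p) (tpow P (Suc p)) (cobar_diff V (Suc p))"
proof (rule linmapI, erule cobar_diff_closed)
  note T0 = vspace_tpow[OF PV, of p] and T1 = vspace_tpow[OF PV, of "Suc p"]
  fix x y assume x: "x \<in> carrier (tpow P p)" and y: "y \<in> carrier (tpow P p)"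
  have xy: "x \<oplus>\<^bsub>tpow P p\<^esub> y \<in> carrier (tpow P p)" by (rule vs_add[OF T0 x y])
  show "cobar_diff V (Suc p) (x \<oplus>\<^bsub>tpow P p\<^esub> y) = cobar_diff V (Suc p) x \<oplus>\<^bsub>tpow P (Suc p)\<^esub> cobar_diff V (Suc p) y"
  proof (rule tpow_pairing_separates)
    fix ys assume ys: "ys \<in> aug_tuples (Suc p)"
    then have y1: "ys \<in> tuples (Lam V) (Suc p)" by simp
    have c: "contract (Lam V) j ys \<in> tuples (Lam V) p" if "j \<in> {1..p}" for j
      using that by (intro A.contract_tuples[OF y1]) auto
    show "ev (Suc p) (cobar_diff V (Suc p) (x \<oplus>\<^bsub>tpow P p\<^esub> y)) ys =
      ev (Suc p) (cobar_diff V (Suc p) x \<oplus>\<^bsub>tpow P (Suc p)\<^esub> cobar_diff V (Suc p) y) ys"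
      unfolding linmap_add[OF linmap_tpow_pairing[OF y1] cobar_diff_closed[OF x] cobar_diff_closed[OF y]]
        pairing_cobar_diff[OF x ys] pairing_cobar_diff[OF y ys] pairing_cobar_diff[OF xy ys] scalars_simps sum.distrib[symmetric]
      by (intro sum.cong refl) (simp add: linmap_add[OF linmap_tpow_pairing[OF c] x y] distrib_left)
  qed (simp_all add: T1 cobar_diff_closed x y xy)
next
  note T0 = vspace_tpow[OF PV, of p] and T1 = vspace_tpow[OF PV, of "Suc p"]
  fix r x assume x: "x \<in> carrier (tpow P p)"
  have rx: "r \<odot>\<^bsub>tpow P p\<^esub> x \<in> carrier (tpow P p)" by (rule vs_smult[OF T0 x])
  show "cobar_diff V (Suc p) (r \<odot>\<^bsub>tpow P p\<^esub> x) = r \<odot>\<^bsub>tpow P (Suc p)\<^esub> cobar_diff V (Suc p) x"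
  proof (rule tpow_pairing_separates)
    fix ys assume ys: "ys \<in> aug_tuples (Suc p)"
    then have y1: "ys \<in> tuples (Lam V) (Suc p)" by simp
    have c: "contract (Lam V) j ys \<in> tuples (Lam V) p" if "j \<in> {1..p}" for j
      using that by (intro A.contract_tuples[OF y1]) auto
    show "ev (Suc p) (cobar_diff V (Suc p) (r \<odot>\<^bsub>tpow P p\<^esub> x)) ys =
      ev (Suc p) (r \<odot>\<^bsub>tpow P (Suc p)\<^esub> cobar_diff V (Suc p) x) ys"
      unfolding linmap_smult[OF linmap_tpow_pairing[OF y1] cobar_diff_closed[OF x]]
        pairing_cobar_diff[OF x ys] pairing_cobar_diff[OF rx ys] scalars_simps sum_distrib_left
      by (intro sum.cong refl) (simp add: linmap_smult[OF linmap_tpow_pairing[OF c] x] mult.left_commute)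
  qed (simp_all add: T1 cobar_diff_closed x rx)
qed

end

section \<open>The insertion maps\<close>

lemma tuples_2: "xs \<in> tuples W 2 \<longleftrightarrow> (\<exists>x\<in>carrier W. \<exists>y\<in>carrier W. xs = [x, y])"
  by (auto simp: tuples_def length_Suc_conv numeral_2_eq_2)

lemma insert_at_props:
  assumes W: "vspace W" and as: "as \<in> tuples W p" and j: "j < p"
  shows insert_at_lin: "insert_at W as j \<in> lin (tpow W 2) (tpow W (Suc p))"
    and insert_at_pure: "\<And>x y. x \<in> carrier W \<Longrightarrow> y \<in> carrier W \<Longrightarrow>
      insert_at W as j (pure_tpow W [x, y]) = pure_tpow W (take j as @ [x, y] @ drop (Suc j) as)"
proof -
  have l: "length as = p" using as by (rule tuples_length)
  let ?\<psi> = "\<lambda>xs. take j as @ xs @ drop (Suc j) as"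
  have psi: "?\<psi> xs \<in> tuples W (Suc p)" if "xs \<in> tuples W 2" for xs
    using that as j by (auto simp: tuples_def dest: in_set_takeD in_set_dropD)
  have "multilin W 2 (tpow W (Suc p)) (\<lambda>xs. pure_tpow W (?\<psi> xs))"
  proof (rule multilin_slot[OF W multilin_pure_tpow[OF W] psi])
    fix xs i assume xs: "xs \<in> tuples W 2" and i: "i < (2::nat)"
    have "linmap W W (\<lambda>x. x)" by (simp add: linmap_def)
    moreover have "?\<psi> (xs[i := x]) = (?\<psi> xs)[j + i := x]" for x
      using l j i tuples_length[OF xs] by (simp add: list_update_append)
    moreover have "j + i < Suc p" using i j by simp
    ultimately show "\<exists>i'<Suc p. \<exists>h. linmap W W h \<and> (\<forall>x\<in>carrier W. ?\<psi> (xs[i := x]) = (?\<psi> xs)[i' := h x])"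
      by blast
  qed
  from tpow_lift[OF W vspace_tpow[OF W] this] obtain h where
    h: "h \<in> lin (tpow W 2) (tpow W (Suc p))" "\<And>xs. xs \<in> tuples W 2 \<Longrightarrow> h (pure_tpow W xs) = pure_tpow W (?\<psi> xs)"
    by blast
  have hx: "h (pure_tpow W [x, y]) = pure_tpow W (take j as @ [x, y] @ drop (Suc j) as)" if "x \<in> carrier W" "y \<in> carrier W" for x y
    using that h(2)[of "[x, y]"] by (simp add: tuples_2)
  have "insert_at W as j = h"
    unfolding insert_at_def l Suc_eq_plus1[symmetric]
  proof (rule the_lin_eqI, rule h(1))
    show "\<forall>x\<in>carrier W. \<forall>y\<in>carrier W. h (pure_tpow W [x, y]) = pure_tpow W (take j as @ [x, y] @ drop (Suc j) as)"
      using hx by blast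
    fix g assume g: "g \<in> lin (tpow W 2) (tpow W (Suc p))"
      "\<forall>x\<in>carrier W. \<forall>y\<in>carrier W. g (pure_tpow W [x, y]) = pure_tpow W (take j as @ [x, y] @ drop (Suc j) as)"
    show "g = h"
    proof (rule lin_eqI[OF vspace_tpow[OF W] vspace_tpow[OF W] g(1) h(1) _ tpow_span[OF W]])
      fix s assume "s \<in> pure_tpow W ` tuples W 2"
      then obtain x y where "x \<in> carrier W" "y \<in> carrier W" "s = pure_tpow W [x, y]" by (auto simp: tuples_2)
      then show "g s = h s" using g(2) hx by simp
    qed (auto intro: pure_tpow_closed[OF W])
  qed
  then show "insert_at W as j \<in> lin (tpow W 2) (tpow W (Suc p))"
    "\<And>x y. x \<in> carrier W \<Longrightarrow> y \<in> carrier W \<Longrightarrow>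
      insert_at W as j (pure_tpow W [x, y]) = pure_tpow W (take j as @ [x, y] @ drop (Suc j) as)"
    using h(1) hx by simp_all
qed

section \<open>Comparison of the differential with \<open>\<delta>\<close>\<close>

context fin_dim_space
begin

abbreviation (input) "n \<equiv> vectorspace.dim class_ring V"

lemmas TP = vspace_tpow[OF PV]

lemma multidegrees_nth:
  "ks \<in> multidegrees V t p \<Longrightarrow> j < p \<Longrightarrow> 1 \<le> ks ! j \<and> ks ! j \<le> n"
proof -
  assume ks: "ks \<in> multidegrees V t p" and j: "j < p"
  then have "ks ! j \<in> set ks" "set ks \<subseteq> {1..n}" by (auto simp: multidegrees_def)
  then have "ks ! j \<in> {1..n}" by (rule rev_subsetD)
  then show ?thesis by simp
qed

lemma homog_tuples_P:
  assumes "ks \<in> multidegrees V t p" "as \<in> homog_tuples V ks"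
  shows "as \<in> tuples P p"
proof -
  have l: "length as = p" "length ks = p" using assms by (auto simp: multidegrees_def homog_tuples_def)
  have "as ! j \<in> carrier P" if "j < p" for j
    using assms(2) multidegrees_nth[OF assms(1) that] that l
    by (intro ext_pow_in_pos[OF V, of "ks ! j"]) (auto simp: homog_tuples_def)
  then show ?thesis using l by (auto simp: tuples_def in_set_conv_nth)
qed

abbreviation (input) "Tgens t p \<equiv> \<Union>ks\<in>multidegrees V t p. pure_tpow P ` homog_tuples V ks"

lemma Tgens_closed: "Tgens t p \<subseteq> carrier (tpow P p)"
  using homog_tuples_P pure_tpow_closed[OF PV] by blast

lemma subsp_T: "subsp (tpow P p) (carrier (T V t p))"
  unfolding T_def using subsp_span[OF TP Tgens_closed] by simp

lemma vspace_T: "vspace (T V t p)"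
  using vspace_subsp[OF TP subsp_T[of p t]] by (simp add: T_def)

lemma pure_in_T: "ks \<in> multidegrees V t p \<Longrightarrow> as \<in> homog_tuples V ks \<Longrightarrow> pure_tpow P as \<in> carrier (T V t p)"
  unfolding T_def using span_superset[OF TP Tgens_closed, of "pure_tpow P as" t p] by auto

lemma T_span: "carrier (T V t p) \<subseteq> span_in (T V t p) (Tgens t p)"
proof -
  have "Tgens t p \<subseteq> carrier (T V t p)" using pure_in_T by blast
  then have "span_in (T V t p) (Tgens t p) = span_in (tpow P p) (Tgens t p)"
    using span_sub[OF TP subsp_T[of p t], of "Tgens t p"] by (simp add: T_def)
  then show ?thesis by (simp add: T_def)
qed

lemma T_eq: "T V t p = (tpow P p)\<lparr>carrier := carrier (T V t p)\<rparr>"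
  by (simp add: T_def)

lemma T_simps: "x \<oplus>\<^bsub>T V t p\<^esub> y = x \<oplus>\<^bsub>tpow P p\<^esub> y" "c \<odot>\<^bsub>T V t p\<^esub> x = c \<odot>\<^bsub>tpow P p\<^esub> x"
  by (simp_all add: T_def)

lemma T_finsum: "(\<And>i. i \<in> S \<Longrightarrow> g i \<in> carrier (T V t p)) \<Longrightarrow> finsum (T V t p) g S = finsum (tpow P p) g S"
  by (subst T_eq) (rule finsum_sub[OF TP subsp_T])

lemma T_carrier_D: "x \<in> carrier (T V t p) \<Longrightarrow> x \<in> carrier (tpow P p)"
  by (rule subsp_carrier_D[OF subsp_T])

lemma linmap_into_T: "linmap M (tpow P p) f \<Longrightarrow> (\<And>x. x \<in> carrier M \<Longrightarrow> f x \<in> carrier (T V t p)) \<Longrightarrow> linmap M (T V t p) f"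
  by (subst T_eq) (simp add: linmap_into_sub[OF subsp_T])

lemma linmap_from_T: "linmap (tpow P p) K f \<Longrightarrow> linmap (T V t p) K f"
  by (subst T_eq) (rule linmap_from_sub[OF subsp_T])

subsection \<open>One tensor factor\<close>

lemma splittings_nths:
  assumes "(S, S') \<in> splittings i" "vs \<in> tuples V i"
  shows "nths vs S \<in> lists (carrier V)" "nths vs S \<noteq> []" "length (nths vs S) = card S"
    "nths vs S' \<in> lists (carrier V)" "nths vs S' \<noteq> []" "length (nths vs S') = card S'"
    "card S + card S' = i" "1 \<le> card S" "1 \<le> card S'"
proof -
  have s: "S \<noteq> {}" "S' \<noteq> {}" "S \<inter> S' = {}" "S \<union> S' = {..<i}" using assms(1) by (auto simp: splittings_def)
  then have fin: "finite S" "finite S'" by (metis finite_Un finite_lessThan)+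
  have l: "length vs = i" "set vs \<subseteq> carrier V" using assms(2) by (auto simp: tuples_def)
  have "{j. j < length vs \<and> j \<in> S} = S" "{j. j < length vs \<and> j \<in> S'} = S'" using s(4) l by auto
  then show c: "length (nths vs S) = card S" "length (nths vs S') = card S'" by (simp_all add: length_nths)
  show "1 \<le> card S" "1 \<le> card S'" using s fin by (simp_all add: Suc_le_eq card_gt_0_iff)
  then show "nths vs S \<noteq> []" "nths vs S' \<noteq> []" using c by auto
  show "nths vs S \<in> lists (carrier V)" "nths vs S' \<in> lists (carrier V)"
    using l set_nths_subset[of vs S] set_nths_subset[of vs S'] by auto
  show "card S + card S' = i" using card_Un_disjoint[OF fin s(3)] s(4) by simp
qed

text \<open>
  The map \<open>\<delta>\<close> is adjoint to multiplication. Both sides are bilinear in \<open>l\<close> and \<open>m\<close>; for wedge products the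
  identity is the Laplace expansion along the columns belonging to \<open>l\<close>.
\<close>
lemma pairing_mult_split:
  assumes vs: "vs \<in> tuples V i" "1 \<le> i" and l: "l \<in> carrier (ext_pos W)" and m: "m \<in> carrier (ext_pos W)"
  shows "pairing V (wedge V vs) (cls (l \<otimes>\<^bsub>Lam V\<^esub> m)) =
    (\<Sum>p\<in>splittings i. split_sign (fst p) (snd p) * (pairing V (wedge V (nths vs (fst p))) (cls l) *
       pairing V (wedge V (nths vs (snd p))) (cls m)))"
proof -
  have vsl: "vs \<in> lists (carrier V)" "vs \<noteq> []" "length vs = i" using vs by (auto simp: tuples_def)
  let ?S = "wedge W ` {fs \<in> lists (carrier W). fs \<noteq> []}"
  have S: "?S \<subseteq> carrier (ext_pos W)" using wedge_in_ext_pos[OF W] by blast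
  note EP = vspace_ext_pos[OF W]
  have inc: "linmap (ext_pos W) K f" if "linmap (Lam V) K f" for K :: "('k, 'z) module" and f
    using linmap_from_sub[OF subsp_ext_pos[OF W] that] by (simp add: ext_pos_def)
  have sub: "x \<in> carrier (Lam V)" if "x \<in> carrier (ext_pos W)" for x
    by (rule subsp_carrier_D[OF subsp_ext_pos[OF W] that])
  have pl: "linmap R scalars (pairing V a)" if "a \<in> carrier P" for a
    using linmap_closed[OF lin_linmap[OF pairing_lin] that] by (simp add: dual_simps lin_iff)
  have pc: "linmap (Lam V) scalars (\<lambda>x. pairing V a (cls x))" if "a \<in> carrier P" for a
    by (rule linmap_comp[OF A.linmap_cls pl[OF that]])
  have wP: "wedge V vs \<in> carrier P" by (rule wedge_in_ext_pos[OF V vsl(1,2)])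
  have nP: "wedge V (nths vs (fst p)) \<in> carrier P" "wedge V (nths vs (snd p)) \<in> carrier P" if "p \<in> splittings i" for p
    using splittings_nths[of "fst p" "snd p", OF _ vs(1)] that by (auto intro: wedge_in_ext_pos[OF V] simp del: in_lists_conv_set)
  let ?rhs = "\<lambda>l m. \<Sum>p\<in>splittings i. split_sign (fst p) (snd p) * (pairing V (wedge V (nths vs (fst p))) (cls l) *
       pairing V (wedge V (nths vs (snd p))) (cls m))"
  have rl: "linmap (ext_pos W) scalars (\<lambda>l. ?rhs l m)" for m
    by (intro linmap_weighted_sum linmap_scale inc pc nP)
  have rr: "linmap (ext_pos W) scalars (\<lambda>m. ?rhs l m)" for l
  proof (intro linmap_weighted_sum)
    fix p assume "p \<in> splittings i"
    from linmap_smult_fun[OF vspace_scalars inc[OF pc[OF nP(2)[OF this]]]]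
    show "linmap (ext_pos W) scalars (\<lambda>m. pairing V (wedge V (nths vs (fst p))) (cls l) * pairing V (wedge V (nths vs (snd p))) (cls m))"
      by simp
  qed
  have base: "pairing V (wedge V vs) (cls (wedge W fs \<otimes>\<^bsub>Lam V\<^esub> wedge W gs)) = ?rhs (wedge W fs) (wedge W gs)"
    if fs: "fs \<in> lists (carrier W)" "fs \<noteq> []" and gs: "gs \<in> lists (carrier W)" "gs \<noteq> []" for fs gs
  proof -
    have fg: "fs @ gs \<in> lists (carrier W)" using fs gs by simp
    have "pairing V (wedge V vs) (cls (wedge W fs \<otimes>\<^bsub>Lam V\<^esub> wedge W gs)) = det_form vs (fs @ gs)"
      unfolding wedge_append[OF W fs(1) gs(1), symmetric] by (rule pairing_wedge[OF vsl(1,2) fg])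
    also have "\<dots> = (\<Sum>(A, B)\<in>splittings i. split_sign A B * det_form (nths vs A) fs * det_form (nths vs B) gs)"
      using det_form_append[OF fs(2) gs(2), of vs] by (simp add: vsl(3))
    also have "\<dots> = ?rhs (wedge W fs) (wedge W gs)"
    proof (intro sum.cong refl)
      fix p assume p: "p \<in> splittings i"
      obtain A B where AB: "p = (A, B)" by (cases p)
      note s = splittings_nths[OF p[unfolded AB] vs(1)]
      show "(case p of (A, B) \<Rightarrow> split_sign A B * det_form (nths vs A) fs * det_form (nths vs B) gs) =
        split_sign (fst p) (snd p) * (pairing V (wedge V (nths vs (fst p))) (cls (wedge W fs)) *
           pairing V (wedge V (nths vs (snd p))) (cls (wedge W gs)))"
        unfolding AB prod.case fst_conv snd_conv
          pairing_wedge[OF s(1,2) fs(1)] pairing_wedge[OF s(4,5) gs(1)] by (rule mult.assoc)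
    qed
    finally show ?thesis .
  qed
  have 1: "pairing V (wedge V vs) (cls (wedge W fs \<otimes>\<^bsub>Lam V\<^esub> m)) = ?rhs (wedge W fs) m"
    if fs: "fs \<in> lists (carrier W)" "fs \<noteq> []" and m: "m \<in> carrier (ext_pos W)" for fs m
  proof (rule linmap_eq_on_span[OF EP vspace_scalars _ rr S, where f = "\<lambda>m. pairing V (wedge V vs) (cls (wedge W fs \<otimes>\<^bsub>Lam V\<^esub> m))"])
    show "linmap (ext_pos W) scalars (\<lambda>m. pairing V (wedge V vs) (cls (wedge W fs \<otimes>\<^bsub>Lam V\<^esub> m)))"
      by (intro inc linmap_comp[OF A.linmap_mult_right[OF wedge_closed[OF W fs(1)]] pc[OF wP]])
    show "m \<in> span_in (ext_pos W) ?S" using m ext_pos_span[OF W] by blast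
  qed (use base[OF fs] in blast)
  show ?thesis
  proof (rule linmap_eq_on_span[OF EP vspace_scalars _ rl S, where f = "\<lambda>l. pairing V (wedge V vs) (cls (l \<otimes>\<^bsub>Lam V\<^esub> m))"])
    show "linmap (ext_pos W) scalars (\<lambda>l. pairing V (wedge V vs) (cls (l \<otimes>\<^bsub>Lam V\<^esub> m)))"
      by (intro inc linmap_comp[OF A.linmap_mult_left[OF sub[OF m]] pc[OF wP]])
    show "l \<in> span_in (ext_pos W) ?S" using l ext_pos_span[OF W] by blast
  qed (use 1[OF _ _ m] in blast)
qed

lemma pairing_cobar_diff_single:
  assumes a: "a \<in> carrier P" and l: "l \<in> carrier (Lam V)" "aug l = 0" and m: "m \<in> carrier (Lam V)" "aug m = 0"
  shows "ev 2 (cobar_diff V 2 (pure_tpow P [a])) [l, m] = - pairing V a (cls (l \<otimes>\<^bsub>Lam V\<^esub> m))"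
proof -
  have p: "pure_tpow P [a] \<in> carrier (tpow P 1)" using a by (intro pure_tpow_closed[OF PV]) (simp add: tuples_def)
  have ys: "[l, m] \<in> aug_tuples (Suc 1)" using l m by (simp add: tuples_def)
  have lm: "[cls (l \<otimes>\<^bsub>Lam V\<^esub> m)] \<in> tuples R 1" "[a] \<in> tuples P 1"
    using l m a linmap_closed[OF A.linmap_cls] by (simp_all add: tuples_def)
  have "contract (Lam V) 1 [l, m] = [l \<otimes>\<^bsub>Lam V\<^esub> m]" by (simp add: contract_def)
  then show ?thesis
    using pairing_cobar_diff[OF p ys] tpow_pairing_pure[OF lm(2,1)] by (simp add: numeral_2_eq_2)
qed

text \<open>The value that is prescribed for \<open>\<delta>(v\<^sub>1 \<and> \<dots> \<and> v\<^sub>i)\<close>.\<close>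
definition split_sum :: "nat \<Rightarrow> 'v list \<Rightarrow> (('v list \<Rightarrow>\<^sub>0 'k) set list \<Rightarrow>\<^sub>0 'k) set" where
  "split_sum i vs = finsum (T V i 2)
       (\<lambda>(A, B). split_sign A B \<odot>\<^bsub>T V i 2\<^esub>
          pure_tpow (ext_pos V) [wedge V (nths vs A), wedge V (nths vs B)])
       (splittings i)"

lemma split_sum_eq:
  assumes vs: "vs \<in> tuples V i" and i: "1 \<le> i" "i \<le> n"
  shows "split_sum i vs \<in> carrier (T V i 2)"
    and "(- 1) \<odot>\<^bsub>tpow P 2\<^esub> cobar_diff V 2 (pure_tpow P [wedge V vs]) = split_sum i vs"
proof -
  let ?t = "\<lambda>p. split_sign (fst p) (snd p) \<odot>\<^bsub>tpow P 2\<^esub> pure_tpow P [wedge V (nths vs (fst p)), wedge V (nths vs (snd p))]"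
  have ss: "split_sum i vs = finsum (T V i 2) ?t (splittings i)"
    unfolding split_sum_def T_simps by (simp add: case_prod_unfold)
  have tup: "[wedge V (nths vs (fst p)), wedge V (nths vs (snd p))] \<in> tuples P 2" if "p \<in> splittings i" for p
    using splittings_nths[of "fst p" "snd p", OF _ vs] that
    by (auto simp: tuples_2 intro: wedge_in_ext_pos[OF V] simp del: in_lists_conv_set)
  have gT: "pure_tpow P [wedge V (nths vs (fst p)), wedge V (nths vs (snd p))] \<in> carrier (T V i 2)" if p: "p \<in> splittings i" for p
  proof (rule pure_in_T)
    note s = splittings_nths[of "fst p" "snd p", OF _ vs]
    have "(fst p, snd p) \<in> splittings i" using p by simp
    note s = s[OF this]
    show "[card (fst p), card (snd p)] \<in> multidegrees V i 2"
      using s i unfolding multidegrees_def by auto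
    have "wedge V (nths vs (fst p)) \<in> carrier (ext_pow V (card (fst p)))" "wedge V (nths vs (snd p)) \<in> carrier (ext_pow V (card (snd p)))"
      by (intro wedge_in_ext_pow[OF V], use s in \<open>auto simp: tuples_def\<close>)+
    then show "[wedge V (nths vs (fst p)), wedge V (nths vs (snd p))] \<in> homog_tuples V [card (fst p), card (snd p)]"
      by (simp add: homog_tuples_def nth_Cons split: nat.splits)
  qed
  then have tT: "?t p \<in> carrier (T V i 2)" if "p \<in> splittings i" for p
    using that vs_smult[OF vspace_T] by (simp add: T_simps)
  have fT: "finsum (T V i 2) ?t (splittings i) = finsum (tpow P 2) ?t (splittings i)"
    by (rule T_finsum[OF tT])
  show sT: "split_sum i vs \<in> carrier (T V i 2)"
    unfolding ss by (rule vs_finsum_closed[OF vspace_T tT])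
  have vsl: "vs \<in> lists (carrier V)" "vs \<noteq> []" using vs i by (auto simp: tuples_def)
  have wP: "wedge V vs \<in> carrier P" by (rule wedge_in_ext_pos[OF V vsl])
  have p1: "pure_tpow P [wedge V vs] \<in> carrier (tpow P 1)" using wP by (intro pure_tpow_closed[OF PV]) (simp add: tuples_def)
  have c2: "cobar_diff V 2 (pure_tpow P [wedge V vs]) \<in> carrier (tpow P 2)"
    using cobar_diff_closed[OF p1] by (simp add: numeral_2_eq_2)
  show "(- 1) \<odot>\<^bsub>tpow P 2\<^esub> cobar_diff V 2 (pure_tpow P [wedge V vs]) = split_sum i vs"
  proof (rule tpow_pairing_separates)
    show "(- 1) \<odot>\<^bsub>tpow P 2\<^esub> cobar_diff V 2 (pure_tpow P [wedge V vs]) \<in> carrier (tpow P 2)"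
      by (rule vs_smult[OF TP c2])
    show "split_sum i vs \<in> carrier (tpow P 2)" by (rule T_carrier_D[OF sT])
    fix ys assume ys: "ys \<in> aug_tuples 2"
    then obtain l m where lm: "ys = [l, m]" "l \<in> carrier (Lam V)" "m \<in> carrier (Lam V)" "aug l = 0" "aug m = 0"
      by (auto simp: tuples_2)
    have y1: "ys \<in> tuples (Lam V) 2" using ys by simp
    note lp = linmap_tpow_pairing[OF y1]
    have cl: "map cls [l, m] \<in> tuples R 2" using lm linmap_closed[OF A.linmap_cls] by (simp add: tuples_2)
    have "ev 2 (split_sum i vs) ys =
      (\<Sum>p\<in>splittings i. ev 2 (?t p) ys)"
      unfolding ss fT by (rule linmap_sum[OF TP lp T_carrier_D[OF tT]])
    also have "\<dots> = (\<Sum>p\<in>splittings i. split_sign (fst p) (snd p) * (pairing V (wedge V (nths vs (fst p))) (cls l) *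
       pairing V (wedge V (nths vs (snd p))) (cls m)))"
    proof (intro sum.cong refl)
      fix p assume p: "p \<in> splittings i"
      have "ev 2 (?t p) ys = split_sign (fst p) (snd p) *
        ev 2 (pure_tpow P [wedge V (nths vs (fst p)), wedge V (nths vs (snd p))]) ys"
        using linmap_smult[OF lp pure_tpow_closed[OF PV tup[OF p]]] by simp
      then show "ev 2 (?t p) ys =
        split_sign (fst p) (snd p) * (pairing V (wedge V (nths vs (fst p))) (cls l) * pairing V (wedge V (nths vs (snd p))) (cls m))"
        using tpow_pairing_pure[OF tup[OF p] cl] by (simp add: lm(1) numeral_2_eq_2)
    qed
    also have "\<dots> = pairing V (wedge V vs) (cls (l \<otimes>\<^bsub>Lam V\<^esub> m))"
      using augmentation_zero_in_pos[OF W] lm by (intro pairing_mult_split[OF vs i(1), symmetric]) auto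
    also have "\<dots> = ev 2 ((- 1) \<odot>\<^bsub>tpow P 2\<^esub> cobar_diff V 2 (pure_tpow P [wedge V vs])) ys"
      using linmap_smult[OF lp c2, of "- 1"] pairing_cobar_diff_single[OF wP lm(2,4,3,5)] by (simp add: lm(1))
    finally show "ev 2 ((- 1) \<odot>\<^bsub>tpow P 2\<^esub> cobar_diff V 2 (pure_tpow P [wedge V vs])) ys =
      ev 2 (split_sum i vs) ys" by (rule sym)
  qed
qed

text \<open>
  The prescription for \<open>\<delta>\<close> on \<open>\<and>\<^sup>iV\<close> is consistent because the linear map \<open>-\<partial>\<^sup>*\<close> satisfies it.
\<close>
lemma delta1_props:
  assumes i: "1 \<le> i" "i \<le> n" and a: "a \<in> carrier (ext_pow V i)"
  shows delta1_in_T: "delta1 V i a \<in> carrier (T V i 2)"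
    and delta1_eq: "delta1 V i a = (- 1) \<odot>\<^bsub>tpow P 2\<^esub> cobar_diff V 2 (pure_tpow P [a])"
proof -
  let ?E = "ext_pow V i" and ?z = "\<lambda>a. (- 1) \<odot>\<^bsub>tpow P 2\<^esub> cobar_diff V 2 (pure_tpow P [a])"
  note E = vspace_ext_pow[OF V, of i]
  have "linmap (tpow P 1) (tpow P 2) (cobar_diff V 2)"
    using linmap_cobar_diff[of 1] by (simp add: numeral_2_eq_2)
  then have "linmap P (tpow P 2) ?z"
    by (intro linmap_smult_fun[OF TP] linmap_comp[OF linmap_pure_tpow_singleton[OF PV]])
  moreover have "x \<in> carrier P" if "x \<in> carrier ?E" for x by (rule ext_pow_in_pos[OF V i(1) that])
  ultimately have z: "linmap ?E (tpow P 2) ?z"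
    by (auto simp: linmap_def ext_pow_def ext_pos_def)
  have S: "wedge V ` tuples V i \<subseteq> carrier ?E" using wedge_in_ext_pow[OF V] by blast
  have zT: "?z x \<in> carrier (T V i 2)" if x: "x \<in> carrier ?E" for x
  proof (rule linmap_span_into[OF E TP z subsp_T S])
    show "x \<in> span_in ?E (wedge V ` tuples V i)" using x ext_pow_span[OF V] by blast
    fix s assume "s \<in> wedge V ` tuples V i"
    then obtain vs where "vs \<in> tuples V i" "s = wedge V vs" by blast
    then show "?z s \<in> carrier (T V i 2)" using split_sum_eq[of vs i] i by simp
  qed
  have zl: "restrict ?z (carrier ?E) \<in> lin ?E (T V i 2)"
    by (rule lin_restrict[OF E linmap_into_T[OF z zT]])
  have zv: "restrict ?z (carrier ?E) (wedge V vs) = split_sum i vs" if "vs \<in> tuples V i" for vs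
    using split_sum_eq(2)[OF that i] wedge_in_ext_pow[OF V that] by simp
  have "delta1 V i = restrict ?z (carrier ?E)"
    unfolding delta1_def split_sum_def[symmetric]
  proof (rule the_lin_eqI, rule zl)
    show "\<forall>vs\<in>tuples V i. restrict ?z (carrier ?E) (wedge V vs) = split_sum i vs" using zv by blast
    fix d assume d: "d \<in> lin ?E (T V i 2)" "\<forall>vs\<in>tuples V i. d (wedge V vs) = split_sum i vs"
    show "d = restrict ?z (carrier ?E)"
    proof (rule lin_eqI[OF E vspace_T d(1) zl S ext_pow_span[OF V]])
      fix s assume "s \<in> wedge V ` tuples V i"
      then obtain vs where "vs \<in> tuples V i" "s = wedge V vs" by blast
      then show "d s = restrict ?z (carrier ?E) s" using d(2) zv by metis
    qed
  qed
  then show "delta1 V i a = ?z a" "delta1 V i a \<in> carrier (T V i 2)" using a zT by simp_all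
qed

subsection \<open>Several tensor factors\<close>

text \<open>
  The inserted tensor is evaluated at the entries \<open>j\<close> and \<open>j + 1\<close>; the factors behind it meet the entry one
  place further on.
\<close>
lemma pairing_insert_at:
  assumes as: "as \<in> tuples P p" and j: "j < p" and z: "z \<in> carrier (tpow P 2)" and ys: "ys \<in> tuples (Lam V) (Suc p)"
  shows "ev (Suc p) (insert_at P as j z) ys =
    (\<Prod>i<j. pairing V (as ! i) (cls (ys ! i))) *
    ev 2 z [ys ! j, ys ! Suc j] *
    (\<Prod>i\<in>{Suc j..<p}. pairing V (as ! i) (cls (ys ! Suc i)))"
proof -
  let ?c = "\<Prod>i<j. pairing V (as ! i) (cls (ys ! i))" and ?d = "\<Prod>i\<in>{Suc j..<p}. pairing V (as ! i) (cls (ys ! Suc i))"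
  have y2: "[ys ! j, ys ! Suc j] \<in> tuples (Lam V) 2"
    using j tuples_nth[OF ys] by (simp add: tuples_2)
  have l: "length as = p" "length ys = Suc p" using tuples_length[OF as] tuples_length[OF ys] .
  let ?r = "\<lambda>z. ?c * ev 2 z [ys ! j, ys ! Suc j] * ?d"
  show ?thesis
  proof (rule linmap_eq_on_span[OF TP vspace_scalars, of 2 "\<lambda>z. ev (Suc p) (insert_at P as j z) ys" ?r "pure_tpow P ` tuples P 2" z])
    show "linmap (tpow P 2) scalars (\<lambda>z. ev (Suc p) (insert_at P as j z) ys)"
      by (rule linmap_comp[OF lin_linmap[OF insert_at_lin[OF PV as j]] linmap_tpow_pairing[OF ys]])
    have "linmap (tpow P 2) scalars (\<lambda>z. ?c * ev 2 z [ys ! j, ys ! Suc j])"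
      using linmap_smult_fun[OF vspace_scalars linmap_tpow_pairing[OF y2], of ?c] by simp
    then show "linmap (tpow P 2) scalars ?r" by (rule linmap_scale)
    show "pure_tpow P ` tuples P 2 \<subseteq> carrier (tpow P 2)" by (auto intro: pure_tpow_closed[OF PV])
    show "z \<in> span_in (tpow P 2) (pure_tpow P ` tuples P 2)" using z tpow_span[OF PV] by blast
    fix s assume "s \<in> pure_tpow P ` tuples P 2"
    then obtain x y where xy: "x \<in> carrier P" "y \<in> carrier P" "s = pure_tpow P [x, y]" by (auto simp: tuples_2)
    let ?bs = "take j as @ [x, y] @ drop (Suc j) as"
    have bs: "?bs \<in> tuples P (Suc p)" using as j xy by (auto simp: tuples_def dest: in_set_takeD in_set_dropD)
    have cy: "map cls ys \<in> tuples R (Suc p)" by (rule A.map_cls_tuples[OF ys])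
    let ?g = "\<lambda>i. pairing V (?bs ! i) (cls (ys ! i))"
    have "ev (Suc p) (insert_at P as j s) ys = (\<Prod>i<Suc p. ?g i)"
      unfolding xy(3) insert_at_pure[OF PV as j xy(1,2)] tpow_pairing_pure[OF bs cy]
      using l by (intro prod.cong) auto
    also have "{..<Suc p} = {..<j} \<union> ({j, Suc j} \<union> {Suc (Suc j)..<Suc p})" using j by auto
    also have "(\<Prod>i\<in>{..<j} \<union> ({j, Suc j} \<union> {Suc (Suc j)..<Suc p}). ?g i) =
        (\<Prod>i<j. ?g i) * ((\<Prod>i\<in>{j, Suc j}. ?g i) * (\<Prod>i\<in>{Suc (Suc j)..<Suc p}. ?g i))"
      by (subst prod.union_disjoint, simp, simp, force, subst prod.union_disjoint) auto
    also have "(\<Prod>i<j. ?g i) = ?c" using j l by (intro prod.cong) (auto simp: nth_append)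
    also have "(\<Prod>i\<in>{j, Suc j}. ?g i) = pairing V x (cls (ys ! j)) * pairing V y (cls (ys ! Suc j))"
      using j l by (simp add: nth_append)
    also have "(\<Prod>i\<in>{Suc (Suc j)..<Suc p}. ?g i) = ?d"
      unfolding prod.shift_bounds_Suc_ivl using j l by (intro prod.cong) (auto simp: nth_append nth_Cons' Suc_diff_le)
    also have "pairing V x (cls (ys ! j)) * pairing V y (cls (ys ! Suc j)) = ev 2 s [ys ! j, ys ! Suc j]"
    proof -
      have "[x, y] \<in> tuples P 2" using xy by (simp add: tuples_2)
      from tpow_pairing_pure[OF this A.map_cls_tuples[OF y2]] show ?thesis
        by (simp add: xy(3) numeral_2_eq_2)
    qed
    finally show "ev (Suc p) (insert_at P as j s) ys = ?r s"
      by (simp add: mult.assoc)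
  qed
qed

text \<open>
  The value that is prescribed for \<open>\<delta>(\<alpha>\<^sub>1 \<otimes> \<dots> \<otimes> \<alpha>\<^sub>p)\<close>, with factors numbered from \<open>0\<close>, so that the sign of the
  \<open>j\<close>-th summand is \<open>(-1)\<^sup>j\<close>.
\<close>
definition delta_sum :: "nat \<Rightarrow> nat \<Rightarrow> nat list \<Rightarrow> ('v list \<Rightarrow>\<^sub>0 'k) set list \<Rightarrow> (('v list \<Rightarrow>\<^sub>0 'k) set list \<Rightarrow>\<^sub>0 'k) set" where
  "delta_sum t p ks as = (\<Oplus>\<^bsub>T V t (p + 1)\<^esub> j\<in>{..<p}.
            (- 1) ^ j \<odot>\<^bsub>T V t (p + 1)\<^esub>
              insert_at (ext_pos V) as j (delta1 V (ks ! j) (as ! j)))"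

text \<open>In the multidegree the entry \<open>k\<^sub>j\<close> is replaced by two positive entries with the same sum.\<close>
lemma insert_at_in_T:
  assumes ks: "ks \<in> multidegrees V t p" and as: "as \<in> homog_tuples V ks" and j: "j < p"
    and z: "z \<in> carrier (T V (ks ! j) 2)"
  shows "insert_at P as j z \<in> carrier (T V t (Suc p))"
proof -
  note asP = homog_tuples_P[OF ks as]
  have l: "length as = p" "length ks = p" using tuples_length[OF asP] ks by (auto simp: multidegrees_def)
  note lm = lin_linmap[OF insert_at_lin[OF PV asP j]]
  show ?thesis
  proof (rule linmap_span_into[OF TP TP lm subsp_T Tgens_closed])
    show "z \<in> span_in (tpow P 2) (Tgens (ks ! j) 2)" using z by (simp add: T_def)
    fix s assume "s \<in> Tgens (ks ! j) 2"
    then obtain ms bs where ms: "ms \<in> multidegrees V (ks ! j) 2" and bs: "bs \<in> homog_tuples V ms" "s = pure_tpow P bs" by blast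
    have bsP: "bs \<in> tuples P 2" by (rule homog_tuples_P[OF ms bs(1)])
    then obtain x y where xy: "x \<in> carrier P" "y \<in> carrier P" "bs = [x, y]" by (auto simp: tuples_2)
    obtain a b where ab: "ms = [a, b]" using ms by (auto simp: multidegrees_def length_Suc_conv numeral_2_eq_2)
    have abn: "a \<in> {1..n}" "b \<in> {1..n}" "a + b = ks ! j" using ms by (auto simp: multidegrees_def ab)
    have xa: "x \<in> carrier (ext_pow V a)" "y \<in> carrier (ext_pow V b)"
      using bs(1) by (auto simp: homog_tuples_def ab xy(3) nth_Cons split: nat.splits dest: spec[of _ 0] spec[of _ 1])
    let ?ks = "take j ks @ [a, b] @ drop (Suc j) ks" and ?as = "take j as @ [x, y] @ drop (Suc j) as"
    have kd: "ks = take j ks @ ks ! j # drop (Suc j) ks" using j l by (intro id_take_nth_drop) simp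
    have "sum_list ?ks = sum_list (take j ks @ ks ! j # drop (Suc j) ks)" using abn(3) by simp
    then have "sum_list ?ks = sum_list ks" using kd by simp
    moreover have "set ks \<subseteq> {1..n}" "sum_list ks = t" using ks by (auto simp: multidegrees_def)
    moreover have "set ?ks \<subseteq> {1..n}" using \<open>set ks \<subseteq> {1..n}\<close> abn by (auto dest: in_set_takeD in_set_dropD)
    ultimately have k: "?ks \<in> multidegrees V t (Suc p)" using j l unfolding multidegrees_def by simp
    have "?as ! i \<in> carrier (ext_pow V (?ks ! i))" if i: "i < Suc p" for i
    proof -
      have asn: "as ! i' \<in> carrier (ext_pow V (ks ! i'))" if "i' < p" for i' using as l that by (auto simp: homog_tuples_def)
      consider "i < j" | "i = j" | "i = Suc j" | i' where "i = Suc i'" "j < i'" "i' < p"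
        using i by (metis Suc_less_eq2 less_antisym linorder_neqE_nat not_less_eq)
      then show ?thesis
      proof cases
        case 4
        then have "?as ! i = as ! i'" "?ks ! i = ks ! i'" using l j by (auto simp: nth_append nth_Cons' Suc_diff_le)
        then show ?thesis using asn[OF 4(3)] by simp
      qed (use l j xa asn in \<open>auto simp: nth_append\<close>)
    qed
    then have a: "?as \<in> homog_tuples V ?ks" using j l by (simp add: homog_tuples_def)
    show "insert_at P as j s \<in> carrier (T V t (Suc p))"
      unfolding bs(2) xy(3) insert_at_pure[OF PV asP j xy(1,2)] by (rule pure_in_T[OF k a])
  qed
qed

text \<open>
  By \<open>delta1_eq\<close> the \<open>j\<close>-th summand of \<open>\<delta>\<close> takes at the classes of \<open>ys\<close> the value of the tensor \<open>as\<close> at the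
  list in which the entries \<open>j\<close> and \<open>j + 1\<close> of \<open>ys\<close> are multiplied. The dual differential has the same
  summands, numbered from \<open>1\<close> instead of \<open>0\<close> and hence with the opposite sign.
\<close>
lemma delta_sum_eq:
  assumes ks: "ks \<in> multidegrees V t p" and as: "as \<in> homog_tuples V ks"
  shows "delta_sum t p ks as \<in> carrier (T V t (Suc p))"
    and "(- 1) \<odot>\<^bsub>tpow P (Suc p)\<^esub> cobar_diff V (Suc p) (pure_tpow P as) = delta_sum t p ks as"
proof -
  note asP = homog_tuples_P[OF ks as]
  have l: "length as = p" "length ks = p" using tuples_length[OF asP] ks by (auto simp: multidegrees_def)
  let ?t = "\<lambda>j. (- 1) ^ j \<odot>\<^bsub>tpow P (Suc p)\<^esub> insert_at P as j (delta1 V (ks ! j) (as ! j))"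
  have ds: "delta_sum t p ks as = finsum (T V t (Suc p)) ?t {..<p}"
    unfolding delta_sum_def T_simps by simp
  have asj: "as ! j \<in> carrier (ext_pow V (ks ! j))" "as ! j \<in> carrier P" if "j < p" for j
    using as that l tuples_nth[OF asP that] by (auto simp: homog_tuples_def)
  have kj: "1 \<le> ks ! j" "ks ! j \<le> n" if "j < p" for j using multidegrees_nth[OF ks that] by auto
  have dT: "delta1 V (ks ! j) (as ! j) \<in> carrier (T V (ks ! j) 2)" if "j < p" for j
    by (rule delta1_in_T[OF kj[OF that] asj(1)[OF that]])
  have iT: "insert_at P as j (delta1 V (ks ! j) (as ! j)) \<in> carrier (T V t (Suc p))" if "j < p" for j
    by (rule insert_at_in_T[OF ks as that dT[OF that]])
  have tT: "?t j \<in> carrier (T V t (Suc p))" if "j \<in> {..<p}" for j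
    using vs_smult[OF vspace_T iT, of j] that by (simp add: T_simps)
  have fT: "finsum (T V t (Suc p)) ?t {..<p} = finsum (tpow P (Suc p)) ?t {..<p}" by (rule T_finsum[OF tT])
  show sT: "delta_sum t p ks as \<in> carrier (T V t (Suc p))"
    unfolding ds by (rule vs_finsum_closed[OF vspace_T tT])
  have pc: "pure_tpow P as \<in> carrier (tpow P p)" by (rule pure_tpow_closed[OF PV asP])
  have cc: "cobar_diff V (Suc p) (pure_tpow P as) \<in> carrier (tpow P (Suc p))" by (rule cobar_diff_closed[OF pc])
  show "(- 1) \<odot>\<^bsub>tpow P (Suc p)\<^esub> cobar_diff V (Suc p) (pure_tpow P as) = delta_sum t p ks as"
  proof (rule tpow_pairing_separates[OF vs_smult[OF TP cc] T_carrier_D[OF sT]])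
    fix ys assume ys: "ys \<in> aug_tuples (Suc p)"
    then have y1: "ys \<in> tuples (Lam V) (Suc p)" by simp
    have ly: "length ys = Suc p" by (rule tuples_length[OF y1])
    have yn: "ys ! j \<in> carrier (Lam V)" "aug (ys ! j) = 0" if "j < Suc p" for j
      using tuples_nth[OF y1 that] ys that ly nth_mem[of j ys] by auto
    note lp = linmap_tpow_pairing[OF y1]
    let ?pr = "\<lambda>j. (\<Prod>i<j. pairing V (as ! i) (cls (ys ! i))) * pairing V (as ! j) (cls (ys ! j \<otimes>\<^bsub>Lam V\<^esub> ys ! Suc j)) *
       (\<Prod>i\<in>{Suc j..<p}. pairing V (as ! i) (cls (ys ! Suc i)))"
    have ct: "ev p (pure_tpow P as) (contract (Lam V) (Suc j) ys) = ?pr j" if j: "j < p" for j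
    proof -
      have c: "contract (Lam V) (Suc j) ys \<in> tuples (Lam V) p" using j by (intro A.contract_tuples[OF y1]) auto
      let ?g = "\<lambda>i. pairing V (as ! i) (cls (contract (Lam V) (Suc j) ys ! i))"
      have "ev p (pure_tpow P as) (contract (Lam V) (Suc j) ys) = (\<Prod>i<p. ?g i)"
        unfolding tpow_pairing_pure[OF asP A.map_cls_tuples[OF c]] using tuples_length[OF c] by (intro prod.cong) auto
      also have "{..<p} = {..<j} \<union> ({j} \<union> {Suc j..<p})" using j by auto
      also have "(\<Prod>i\<in>{..<j} \<union> ({j} \<union> {Suc j..<p}). ?g i) = (\<Prod>i<j. ?g i) * (?g j * (\<Prod>i\<in>{Suc j..<p}. ?g i))"
        by (subst prod.union_disjoint, simp, simp, force, subst prod.union_disjoint) auto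
      also have "(\<Prod>i<j. ?g i) = (\<Prod>i<j. pairing V (as ! i) (cls (ys ! i)))"
        using j ly by (intro prod.cong) (auto simp: contract_nth)
      also have "?g j = pairing V (as ! j) (cls (ys ! j \<otimes>\<^bsub>Lam V\<^esub> ys ! Suc j))" using j ly by (simp add: contract_nth)
      also have "(\<Prod>i\<in>{Suc j..<p}. ?g i) = (\<Prod>i\<in>{Suc j..<p}. pairing V (as ! i) (cls (ys ! Suc i)))"
        using j ly by (intro prod.cong) (auto simp: contract_nth)
      finally show ?thesis by (simp add: mult.assoc)
    qed
    have it: "ev (Suc p) (?t j) ys = (- 1) ^ j * ?pr j" if j: "j \<in> {..<p}" for j
    proof -
      have j: "j < p" using j by simp
      have p1: "pure_tpow P [as ! j] \<in> carrier (tpow P 1)"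
        using asj(2)[OF j] by (intro pure_tpow_closed[OF PV]) (simp add: tuples_def)
      have c2: "cobar_diff V 2 (pure_tpow P [as ! j]) \<in> carrier (tpow P 2)"
        using cobar_diff_closed[OF p1] by (simp add: numeral_2_eq_2)
      have y2: "[ys ! j, ys ! Suc j] \<in> tuples (Lam V) 2" using yn j by (simp add: tuples_2)
      have d: "ev 2 (delta1 V (ks ! j) (as ! j)) [ys ! j, ys ! Suc j] =
          pairing V (as ! j) (cls (ys ! j \<otimes>\<^bsub>Lam V\<^esub> ys ! Suc j))"
        unfolding delta1_eq[OF kj[OF j] asj(1)[OF j]] linmap_smult[OF linmap_tpow_pairing[OF y2] c2]
        using pairing_cobar_diff_single[OF asj(2)[OF j], of "ys ! j" "ys ! Suc j"] yn j by simp
      show ?thesis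
        unfolding linmap_smult[OF lp T_carrier_D[OF iT[OF j]]] pairing_insert_at[OF asP j T_carrier_D[OF dT[OF j]] y1] d
        by simp
    qed
    have "ev (Suc p) ((- 1) \<odot>\<^bsub>tpow P (Suc p)\<^esub> cobar_diff V (Suc p) (pure_tpow P as)) ys =
       - (\<Sum>j\<in>{1..p}. (- 1) ^ j * ev p (pure_tpow P as) (contract (Lam V) j ys))"
      unfolding linmap_smult[OF lp cc] pairing_cobar_diff[OF pc ys] by simp
    also have "(\<Sum>j\<in>{1..p}. (- 1) ^ j * ev p (pure_tpow P as) (contract (Lam V) j ys)) =
       (\<Sum>j<p. (- 1) ^ Suc j * ev p (pure_tpow P as) (contract (Lam V) (Suc j) ys))"
      by (rule sum.reindex_bij_witness[of _ Suc "\<lambda>j. j - 1"]) auto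
    also have "- \<dots> = (\<Sum>j<p. (- 1) ^ j * ?pr j)"
      unfolding sum_negf[symmetric] by (intro sum.cong refl) (simp add: ct)
    also have "\<dots> = (\<Sum>j<p. ev (Suc p) (?t j) ys)"
      by (intro sum.cong refl) (simp only: it)
    also have "\<dots> = ev (Suc p) (delta_sum t p ks as) ys"
      unfolding ds fT by (rule linmap_sum[OF TP lp T_carrier_D[OF tT], symmetric])
    finally show "ev (Suc p) ((- 1) \<odot>\<^bsub>tpow P (Suc p)\<^esub> cobar_diff V (Suc p) (pure_tpow P as)) ys =
      ev (Suc p) (delta_sum t p ks as) ys" .
  qed
qed

lemma delta_eq:
  assumes x: "x \<in> carrier (T V t p)"
  shows "delta V t p x \<in> carrier (T V t (Suc p))"
    and "delta V t p x = (- 1) \<odot>\<^bsub>tpow P (Suc p)\<^esub> cobar_diff V (Suc p) x"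
proof -
  let ?z = "\<lambda>x. (- 1) \<odot>\<^bsub>tpow P (Suc p)\<^esub> cobar_diff V (Suc p) x"
  have z: "linmap (T V t p) (tpow P (Suc p)) ?z"
    by (intro linmap_from_T linmap_smult_fun[OF TP] linmap_cobar_diff)
  have S: "Tgens t p \<subseteq> carrier (T V t p)" using pure_in_T by blast
  have zT: "?z x \<in> carrier (T V t (Suc p))" if x: "x \<in> carrier (T V t p)" for x
  proof (rule linmap_span_into[OF vspace_T TP z subsp_T S])
    show "x \<in> span_in (T V t p) (Tgens t p)" using x T_span by blast
    fix s assume "s \<in> Tgens t p"
    then obtain ks as where "ks \<in> multidegrees V t p" "as \<in> homog_tuples V ks" "s = pure_tpow P as" by blast
    then show "?z s \<in> carrier (T V t (Suc p))" using delta_sum_eq[of ks t p as] by simp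
  qed
  have zl: "restrict ?z (carrier (T V t p)) \<in> lin (T V t p) (T V t (Suc p))"
    by (rule lin_restrict[OF vspace_T linmap_into_T[OF z zT]])
  have zv: "restrict ?z (carrier (T V t p)) (pure_tpow P as) = delta_sum t p ks as"
    if "ks \<in> multidegrees V t p" "as \<in> homog_tuples V ks" for ks as
    using delta_sum_eq(2)[OF that] pure_in_T[OF that] by simp
  have "delta V t p = restrict ?z (carrier (T V t p))"
    unfolding delta_def delta_sum_def[symmetric] unfolding Suc_eq_plus1[symmetric]
  proof (rule the_lin_eqI, rule zl)
    show "\<forall>ks\<in>multidegrees V t p. \<forall>as\<in>homog_tuples V ks.
       restrict ?z (carrier (T V t p)) (pure_tpow P as) = delta_sum t p ks as" using zv by blast
    fix d assume d: "d \<in> lin (T V t p) (T V t (Suc p))" "\<forall>ks\<in>multidegrees V t p. \<forall>as\<in>homog_tuples V ks.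
       d (pure_tpow P as) = delta_sum t p ks as"
    show "d = restrict ?z (carrier (T V t p))"
    proof (rule lin_eqI[OF vspace_T vspace_T d(1) zl S T_span])
      fix s assume "s \<in> Tgens t p"
      then obtain ks as where "ks \<in> multidegrees V t p" "as \<in> homog_tuples V ks" "s = pure_tpow P as" by blast
      then show "d s = restrict ?z (carrier (T V t p)) s" using d(2) zv by metis
    qed
  qed
  then show "delta V t p x \<in> carrier (T V t (Suc p))" "delta V t p x = ?z x" using x zT by simp_all
qed

lemma cobar_diff_eq_neg_delta:
  assumes x: "x \<in> carrier (T V t p)"
  shows "cobar_diff V (Suc p) x = \<ominus>\<^bsub>T V t (Suc p)\<^esub> delta V t p x"
proof -
  have c: "cobar_diff V (Suc p) x \<in> carrier (tpow P (Suc p))" by (rule cobar_diff_closed[OF T_carrier_D[OF x]])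
  have "\<ominus>\<^bsub>T V t (Suc p)\<^esub> delta V t p x = (- 1) \<odot>\<^bsub>tpow P (Suc p)\<^esub> delta V t p x"
    using vs_neg_eq[OF vspace_T delta_eq(1)[OF x]] by (simp add: T_simps)
  also have "\<dots> = (- 1 * - 1) \<odot>\<^bsub>tpow P (Suc p)\<^esub> cobar_diff V (Suc p) x"
    unfolding delta_eq(2)[OF x] by (rule vs_mult_smult[OF TP c, symmetric])
  also have "\<dots> = cobar_diff V (Suc p) x" using c by (simp add: TP)
  finally show ?thesis by (rule sym)
qed

end

theorem proposition5:
  fixes V :: "('k::field, 'v) module" and n :: nat
  assumes "vectorspace class_ring V"
    and "vectorspace.fin_dim class_ring V"
    and "vectorspace.dim class_ring V = n"
    and "n \<ge> 2"
  shows "(\<forall>p. bij_betw (cobar_ident V p) (carrier (tpow (ext_pos V) p))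
                (bar_hom (Lam V) (augmentation (dual V)) p)) \<and>
         (\<forall>t p. 1 \<le> t \<and> 1 \<le> p \<and> p \<le> t - 1 \<longrightarrow>
            (\<forall>x\<in>carrier (T V t p).
               delta V t p x \<in> carrier (T V t (p + 1)) \<and>
               cobar_diff V (p + 1) x = \<ominus>\<^bsub>T V t (p + 1)\<^esub> delta V t p x))"
proof -
  interpret fin_dim_space V by (rule fin_dim_space.intro[OF assms(1,2)])
  show ?thesis
    unfolding Suc_eq_plus1[symmetric]
    using bij_cobar_ident delta_eq(1) cobar_diff_eq_neg_delta by blast
qed

end
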